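(* Let $q$ be a prime power, $S=\mathbb{F}_q[x,y]$, $G=GL_2(\mathbb{F}_q)$. One has an $S^G$-module direct sum decomposition $S_G=N_1\oplus N_2$, in which - $N_1=S^G\cdot X^qY$ is a free $S^G$-module on the basis $\{X^qY\}$, and - $N_2$ is the $S^G$-submodule spanned by $\{1,XY,X^2Y,\dots,X^{q-2}Y\}$, whose $S^G$-module structure is a direct sum of $q-1$ copies of $S^G/(D_{2,0})$ with these elements as basis. In particular, there is a set $M=M_1\sqcup M_2$ of homogeneous elements minimally generating $S_G$ as an $S^G$-module such that: the $\mathbb{F}_q[D_{2,1}]$-submodule of $S_G$ generated by $M_1$ is $\mathbb{F}_q[D_{2,1}]$-free and the $\mathbb{F}_q[D_{2,0},D_{2,1}]$-submodule generated by $M_2$ is $\mathbb{F}_q[D_{2,0},D_{2,1}]$-free; $D_{2,0}$ annihilates every element of $M_1$; and $M_2$ is a singleton whose element has degree $q^2-1$. Moreover $$\mathrm{Hilb}(S_G,t)=\frac{t^{q^2-1}}{(1-t^{q^2-1})(1-t^{q^2-q})}+\frac{1+t^{2(q-1)}+t^{3(q-1)}+\cdots+t^{(q-1)^2}}{1-t^{q^2-q}}=1+\frac{t^{2(q-1)}}{1-t^{q-1}}+\frac{t^{2(q^2-1)}}{(1-t^{q^2-1})(1-t^{q^2-q})}.$$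
   Context: $S$ has the standard grading. $g=\begin{bmatrix}a&b\\c&d\end{bmatrix}\in G$ acts on $S$ by the algebra automorphism $x\mapsto ax+cy$, $y\mapsto bx+dy$. $X:=x^{q-1}$, $Y:=y^{q-1}$, $D_{2,1}:=Y^q+XY^{q-1}+\cdots+X^{q-1}Y+X^q$, $D_{2,0}:=XY^q+X^2Y^{q-1}+\cdots+X^qY$ (the Dickson polynomials). By Dickson's theorem $S^G=\mathbb{F}_q[D_{2,0},D_{2,1}]$, a polynomial algebra. The $G$-cofixed space is $S_G=S/N$, where $N$ is the $\mathbb{F}_q$-span of all $g(f)-f$ with $g\in G$, $f\in S$; it is a graded $S^G$-module, and elements of $S$ are identified with their images in $S_G$. The set $\{1,XY,\dots,X^{q-2}Y\}$ consists of $1$ and $X^iY$ for $1\le i\le q-2$, and the numerator $1+t^{2(q-1)}+\cdots+t^{(q-1)^2}$ means $1+\sum_{j=2}^{q-1}t^{j(q-1)}$ (both reduce to the term $1$ when $q=2$). $\mathrm{Hilb}(U,t)=\sum_d\dim_{\mathbb{F}_q}(U_d)t^d$. *)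

theory Defs
  imports "HOL-Analysis.Analysis"
begin

section \<open>The polynomial ring \<open>S = F[x,y]\<close> and the action of \<open>GL\<^sub>2(F)\<close>\<close>

text \<open>
  The field with \<open>q\<close> elements is a type of class \<open>finite_field\<close>, with \<open>q = CARD('a)\<close>.
  An element of \<open>S\<close> is a polynomial in the (outer) variable \<open>y\<close> over the polynomials in
  the (inner) variable \<open>x\<close>: the coefficient of \<open>x\<^sup>i y\<^sup>j\<close> in \<open>f\<close> is \<open>coeff (coeff f j) i\<close>.
\<close>

type_synonym 'a bipoly = "'a poly poly"

definition cst :: "'a \<Rightarrow> 'a::comm_ring_1 bipoly" where "cst c = [:[:c:]:]"
definition var_x :: "'a::comm_ring_1 bipoly" where "var_x = [:[:0, 1:]:]"
definition var_y :: "'a::comm_ring_1 bipoly" where "var_y = [:0, 1:]"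

definition homogeneous :: "nat \<Rightarrow> 'a::comm_ring_1 bipoly \<Rightarrow> bool" where
  "homogeneous d f \<longleftrightarrow> (\<forall>i j. coeff (coeff f j) i \<noteq> 0 \<longrightarrow> i + j = d)"

text \<open>\<open>subst u v f\<close> is \<open>f(u,v)\<close>.\<close>

definition subst :: "'a bipoly \<Rightarrow> 'a bipoly \<Rightarrow> 'a bipoly \<Rightarrow> 'a::comm_ring_1 bipoly" where
  "subst u v f = poly (map_poly (\<lambda>p. poly (map_poly cst p) u) f) v"

definition act :: "'a::comm_ring_1^2^2 \<Rightarrow> 'a bipoly \<Rightarrow> 'a bipoly" where
  "act g = subst (cst (g$1$1) * var_x + cst (g$2$1) * var_y)
                 (cst (g$1$2) * var_x + cst (g$2$2) * var_y)"

lemma poly_map_poly_add: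
  fixes h :: "'a::comm_ring_1 \<Rightarrow> 'b::comm_ring_1"
  assumes [simp]: "h 0 = 0" and add: "\<And>a b. h (a + b) = h a + h b"
  shows "poly (map_poly h (p + q)) u = poly (map_poly h p) u + poly (map_poly h q) u"
proof (induction p arbitrary: q)
  case (pCons a p)
  obtain b r where q: "q = pCons b r" by (cases q)
  show ?case
    by (simp add: q map_poly_pCons add pCons.IH algebra_simps)
qed simp

lemma poly_map_poly_mult:
  fixes h :: "'a::comm_ring_1 \<Rightarrow> 'b::comm_ring_1"
  assumes [simp]: "h 0 = 0" and add: "\<And>a b. h (a + b) = h a + h b"
    and mult: "\<And>a b. h (a * b) = h a * h b"
  shows "poly (map_poly h (p * q)) u = poly (map_poly h p) u * poly (map_poly h q) u"
proof (induction p)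
  case (pCons a p)
  have "poly (map_poly h (smult a q)) u = h a * poly (map_poly h q) u"
    by (induction q) (simp_all add: map_poly_pCons mult algebra_simps)
  then show ?case
    by (simp add: poly_map_poly_add[of h, OF _ add] map_poly_pCons pCons.IH algebra_simps)
qed simp

lemma cst_simps: "cst 0 = 0" "cst 1 = 1" "cst (a + b) = cst a + cst b" "cst (a * b) = cst a * cst b"
  "cst (- a) = - cst a" "cst (a - b) = cst a - cst b"
  by (simp_all add: cst_def one_pCons)

lemma cst_power: "cst (a ^ n) = cst a ^ n"
  by (induction n) (simp_all add: cst_simps)

lemma cst_mult: "cst c * f = smult [:c:] f"
  by (simp add: cst_def)

lemma subst_add: "subst u v (f + g) = subst u v f + subst u v g"
  unfolding subst_def
  by (rule poly_map_poly_add) (simp_all add: poly_map_poly_add cst_simps)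

lemma subst_mult: "subst u v (f * g) = subst u v f * subst u v g"
  unfolding subst_def
  by (rule poly_map_poly_mult) (simp_all add: poly_map_poly_add poly_map_poly_mult cst_simps)

lemma act_add: "act g (f + h) = act g f + act g h"
  by (simp add: act_def subst_add)

lemma act_mult: "act g (f * h) = act g f * act g h"
  by (simp add: act_def subst_mult)

lemma act_cst: "act g (cst c) = cst c"
  by (simp add: act_def subst_def cst_def map_poly_pCons)

lemma act_x: "act g var_x = cst (g$1$1) * var_x + cst (g$2$1) * var_y"
  by (simp add: act_def subst_def var_x_def map_poly_pCons cst_simps)

lemma act_y: "act g var_y = cst (g$1$2) * var_x + cst (g$2$2) * var_y"
  by (simp add: act_def subst_def var_y_def map_poly_pCons cst_simps map_poly_1')

lemma act_0: "act g 0 = 0" and act_1: "act g 1 = 1"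
  using act_cst[of g 0] act_cst[of g 1] by (simp_all add: cst_simps)

lemma act_uminus: "act g (- f) = - act g f"
  using act_add[of g f "- f"] by (simp add: act_0 minus_unique)

lemma act_diff: "act g (f - h) = act g f - act g h"
  using act_add[of g f "- h"] by (simp add: act_uminus)

lemma act_power: "act g (f ^ n) = act g f ^ n"
  by (induction n) (simp_all add: act_1 act_mult)


section \<open>The Dickson polynomials\<close>

definition big_X :: "'a::finite_field bipoly" where "big_X = var_x ^ (CARD('a) - 1)"
definition big_Y :: "'a::finite_field bipoly" where "big_Y = var_y ^ (CARD('a) - 1)"

definition dickson_1 :: "'a::finite_field bipoly" where
  "dickson_1 = (\<Sum>i = 0..CARD('a). big_X ^ i * big_Y ^ (CARD('a) - i))"
definition dickson_0 :: "'a::finite_field bipoly" where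
  "dickson_0 = (\<Sum>i = 1..CARD('a). big_X ^ i * big_Y ^ (CARD('a) + 1 - i))"

lemma card_gt_1: "CARD('a::finite_field) > 1"
proof -
  have "card {0, 1::'a} \<le> CARD('a)" by (rule card_mono) auto
  then show ?thesis by simp
qed

text \<open>The \<open>q\<close>-th power is additive, since \<open>(1 + T)\<^sup>q - 1 - T\<^sup>q\<close> has degree less than \<open>q\<close> and
  vanishes at all \<open>q\<close> field elements.\<close>

lemma of_nat_card_choose:
  assumes "0 < k" "k < CARD('a::finite_field)"
  shows "of_nat (CARD('a) choose k) = (0::'a)"
proof -
  define q where "q = CARD('a)"
  define P :: "'a poly" where "P = (\<Sum>k\<in>{0<..<q}. monom (of_nat (q choose k)) k)"
  have "P = 0"
  proof (rule ccontr)
    assume "P \<noteq> 0"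
    have q1: "q > 1" unfolding q_def by (rule card_gt_1)
    have "poly P t = 0" for t
    proof -
      have set: "{..q} = insert 0 (insert q {0<..<q})" using q1 by auto
      have "(t + 1) ^ q = (\<Sum>k\<le>q. of_nat (q choose k) * t ^ k * 1 ^ (q - k))"
        by (rule binomial_ring)
      also have "\<dots> = 1 + t ^ q + poly P t"
        unfolding set using q1 by (simp add: P_def poly_sum poly_monom algebra_simps)
      finally show ?thesis
        by (simp add: q_def finite_field_power_card_eq_same algebra_simps)
    qed
    then have "card {t. poly P t = 0} = q" by (simp add: q_def)
    moreover have "card {t. poly P t = 0} \<le> degree P" by (rule card_poly_roots_bound[OF \<open>P \<noteq> 0\<close>])
    moreover have "degree P \<le> q - 1" unfolding P_def
      by (rule degree_sum_le) (auto intro: order_trans[OF degree_monom_le])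
    ultimately show False using q1 by simp
  qed
  then have "coeff P k = 0" by simp
  moreover have "coeff P k = of_nat (q choose k)"
    using assms by (simp add: P_def coeff_sum q_def)
  ultimately show ?thesis by (simp add: q_def)
qed

lemma power_card_add:
  fixes u v :: "'a::finite_field bipoly"
  shows "(u + v) ^ CARD('a) = u ^ CARD('a) + v ^ CARD('a)"
proof -
  define q where "q = CARD('a)"
  have q1: "q > 1" unfolding q_def by (rule card_gt_1)
  have set: "{..q} = insert 0 (insert q {0<..<q})" using q1 by auto
  have z: "(of_nat (q choose k) :: 'a bipoly) = 0" if "k \<in> {0<..<q}" for k
    using of_nat_card_choose[where ?'a = 'a, of k] that by (simp add: q_def of_nat_poly)
  have "(u + v) ^ q = (\<Sum>k\<le>q. of_nat (q choose k) * u ^ k * v ^ (q - k))"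
    by (rule binomial_ring)
  also have "\<dots> = u ^ q + v ^ q" unfolding set using q1 by (simp add: z)
  finally show ?thesis by (simp add: q_def)
qed

lemma power_card_lin:
  fixes u v :: "'a::finite_field bipoly"
  shows "(cst a * u + cst b * v) ^ CARD('a) = cst a * u ^ CARD('a) + cst b * v ^ CARD('a)"
  by (simp add: power_card_add power_mult_distrib finite_field_power_card_eq_same flip: cst_power)

lemma power_card_diff:
  fixes u v :: "'a::finite_field bipoly"
  shows "(u - v) ^ CARD('a) = u ^ CARD('a) - v ^ CARD('a)"
  using power_card_add[of "u - v" v] by simp

lemma big_X_neq_big_Y: "big_X \<noteq> (big_Y :: 'a::finite_field bipoly)"
proof
  assume "big_X = (big_Y :: 'a bipoly)"
  moreover have "degree (big_X :: 'a bipoly) = 0"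
    by (simp add: big_X_def var_x_def poly_const_pow)
  moreover have "degree (big_Y :: 'a bipoly) = CARD('a) - 1"
    by (simp add: big_Y_def var_y_def degree_power_eq)
  ultimately show False using card_gt_1[where ?'a = 'a] by simp
qed

lemma var_neq_0: "var_x \<noteq> (0 :: 'a::comm_ring_1 bipoly)" "var_y \<noteq> (0 :: 'a::comm_ring_1 bipoly)"
  by (simp_all add: var_x_def var_y_def)

definition dickson_L :: "'a::finite_field bipoly" where
  "dickson_L = var_x ^ CARD('a) * var_y - var_x * var_y ^ CARD('a)"

lemma dickson_L_eq: "dickson_L = var_x * var_y * (big_X - big_Y :: 'a::finite_field bipoly)"
proof -
  have "u ^ CARD('a) = u * u ^ (CARD('a) - 1)" for u :: "'a bipoly"
    using card_gt_1[where ?'a = 'a] by (simp flip: power_Suc)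
  then show ?thesis
    by (simp add: dickson_L_def big_X_def big_Y_def algebra_simps)
qed

lemma dickson_L_neq_0: "dickson_L \<noteq> (0 :: 'a::finite_field bipoly)"
  using big_X_neq_big_Y by (simp add: dickson_L_eq var_neq_0)

lemma act_dickson_L: "act g dickson_L = cst (det g) * (dickson_L :: 'a::finite_field bipoly)"
  by (simp only: dickson_L_def act_diff act_mult act_power act_x act_y power_card_lin det_2 cst_simps)
     (simp add: algebra_simps)

lemma dickson_L_mult_dickson_1:
  "dickson_L * dickson_1 = (var_x ^ (CARD('a)\<^sup>2) * var_y - var_x * var_y ^ (CARD('a)\<^sup>2)
     :: 'a::finite_field bipoly)"
proof -
  define q where "q = CARD('a)"
  have q1: "q > 1" unfolding q_def by (rule card_gt_1)
  have "q * q = Suc ((q - 1) * Suc q)" using q1 by (cases q) (simp_all add: algebra_simps)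
  then have pw: "u ^ (q\<^sup>2) = u * (u ^ (q - 1)) ^ Suc q" for u :: "'a bipoly"
    by (simp only: power2_eq_square power_Suc power_mult)
  have "(big_X - big_Y :: 'a bipoly) * dickson_1 = big_X ^ Suc q - big_Y ^ Suc q"
    unfolding diff_power_eq_sum dickson_1_def lessThan_Suc_atMost atLeast0AtMost q_def ..
  then have "dickson_L * dickson_1 =
      var_x * var_y * (big_X ^ Suc q - big_Y ^ Suc q :: 'a bipoly)"
    by (simp add: dickson_L_eq mult.assoc)
  then show ?thesis
    unfolding q_def[symmetric] pw by (simp add: big_X_def big_Y_def q_def algebra_simps)
qed

lemma dickson_0_eq: "dickson_0 = (dickson_L ^ (CARD('a) - 1) :: 'a::finite_field bipoly)"
proof -
  define q where "q = CARD('a)"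
  have q1: "q > 1" unfolding q_def by (rule card_gt_1)
  then have Sq: "Suc (q - 1) = q" by simp
  have "(\<Sum>i<q. big_X ^ i * big_Y ^ (q - 1 - i)) * (big_X - big_Y) = (big_X ^ q - big_Y ^ q :: 'a bipoly)"
    using diff_power_eq_sum[of "big_X :: 'a bipoly" "q - 1" big_Y] unfolding Sq
    by (simp only: mult.commute)
  also have "\<dots> = (big_X - big_Y) ^ (q - 1) * (big_X - big_Y)"
    using power_Suc2[of "big_X - big_Y :: 'a bipoly" "q - 1"] power_card_diff[of "big_X :: 'a bipoly" big_Y]
    unfolding Sq q_def[symmetric] by simp
  finally have s: "(\<Sum>i<q. big_X ^ i * big_Y ^ (q - 1 - i)) = ((big_X - big_Y) ^ (q - 1) :: 'a bipoly)"
    using big_X_neq_big_Y[where ?'a = 'a] by simp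
  have "(dickson_0 :: 'a bipoly) = (\<Sum>i<q. big_X ^ Suc i * big_Y ^ (q - i))"
    unfolding dickson_0_def q_def[symmetric]
    by (rule sum.reindex_bij_witness[of _ Suc "\<lambda>i. i - 1"]) (auto simp: Suc_diff_le)
  also have "\<dots> = big_X * big_Y * (\<Sum>i<q. big_X ^ i * big_Y ^ (q - 1 - i))"
    unfolding sum_distrib_left
  proof (rule sum.cong)
    fix i assume "i \<in> {..<q}"
    then have "q - i = Suc (q - 1 - i)" by auto
    then show "big_X ^ Suc i * big_Y ^ (q - i) = big_X * big_Y * (big_X ^ i * big_Y ^ (q - 1 - i))"
      by (simp add: algebra_simps)
  qed simp
  also have "\<dots> = dickson_L ^ (q - 1)"
    unfolding s by (simp only: dickson_L_eq power_mult_distrib big_X_def big_Y_def q_def)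
  finally show ?thesis by (simp add: q_def)
qed

lemma act_dickson_0:
  assumes "invertible (g :: 'a::finite_field^2^2)"
  shows "act g dickson_0 = dickson_0"
proof -
  have "det g \<noteq> 0" using assms by (simp add: invertible_det_nz)
  moreover have "det g ^ CARD('a) = det g * det g ^ (CARD('a) - 1)"
    using card_gt_1[where ?'a = 'a] by (simp flip: power_Suc)
  ultimately have "det g ^ (CARD('a) - 1) = 1"
    by (simp add: finite_field_power_card_eq_same)
  then show ?thesis
    by (simp add: dickson_0_eq act_power act_dickson_L power_mult_distrib cst_simps flip: cst_power)
qed

lemma act_dickson_1:
  assumes "invertible (g :: 'a::finite_field^2^2)"
  shows "act g dickson_1 = dickson_1"
proof -
  define q where "q = CARD('a)"
  have lin: "(cst a * u + cst b * v) ^ (q\<^sup>2) = cst a * u ^ (q\<^sup>2) + cst b * v ^ (q\<^sup>2)"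
    for a b :: 'a and u v
    by (simp add: power2_eq_square power_mult q_def power_card_lin)
  have d: "cst (det g) \<noteq> 0" using assms by (simp add: invertible_det_nz cst_def)
  have "cst (det g) * dickson_L * act g dickson_1 = act g (dickson_L * dickson_1)"
    by (simp add: act_mult act_dickson_L)
  also have "\<dots> = cst (det g) * (dickson_L * dickson_1)"
    by (simp only: dickson_L_mult_dickson_1 act_diff act_mult act_power act_x act_y lin[unfolded q_def]
          det_2 cst_simps)
       (simp add: algebra_simps)
  finally show ?thesis using d dickson_L_neq_0[where ?'a = 'a] by (simp add: mult.assoc)
qed


section \<open>The invariant ring\<close>

typedef (overloaded) 'a invar =
  "{f :: 'a::finite_field bipoly. \<forall>g. invertible g \<longrightarrow> act g f = f}"
  by (rule exI[of _ 0]) (simp add: act_0)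

setup_lifting type_definition_invar

instantiation invar :: (finite_field) comm_ring_1
begin
lift_definition zero_invar :: "'a invar" is 0 by (simp add: act_0)
lift_definition one_invar :: "'a invar" is 1 by (simp add: act_1)
lift_definition plus_invar :: "'a invar \<Rightarrow> 'a invar \<Rightarrow> 'a invar" is "(+)" by (simp add: act_add)
lift_definition minus_invar :: "'a invar \<Rightarrow> 'a invar \<Rightarrow> 'a invar" is "(-)" by (simp add: act_diff)
lift_definition uminus_invar :: "'a invar \<Rightarrow> 'a invar" is uminus by (simp add: act_uminus)
lift_definition times_invar :: "'a invar \<Rightarrow> 'a invar \<Rightarrow> 'a invar" is "(*)" by (simp add: act_mult)
instance by standard (transfer; simp add: algebra_simps)+
end

lift_definition invar_cst :: "'a::finite_field \<Rightarrow> 'a invar" is cst by (rule allI impI act_cst)+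

lift_definition D0 :: "'a::finite_field invar" is dickson_0 by (blast intro: act_dickson_0)
lift_definition D1 :: "'a::finite_field invar" is dickson_1 by (blast intro: act_dickson_1)

text \<open>\<open>adjoin A\<close> is the \<open>F\<close>-subalgebra \<open>F[A]\<close> of the invariant ring.\<close>

inductive_set adjoin :: "'a::finite_field invar set \<Rightarrow> 'a invar set" for A where
  "invar_cst c \<in> adjoin A"
| "a \<in> A \<Longrightarrow> a \<in> adjoin A"
| "r \<in> adjoin A \<Longrightarrow> s \<in> adjoin A \<Longrightarrow> r + s \<in> adjoin A"
| "r \<in> adjoin A \<Longrightarrow> s \<in> adjoin A \<Longrightarrow> r * s \<in> adjoin A"


section \<open>The cofixed space\<close>

global_interpretation bipoly_vs: vector_space "\<lambda>(c::'a::field) (f::'a bipoly). smult [:c:] f"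
  by standard (simp_all add: cst_simps algebra_simps flip: cst_mult)

definition coinv_kernel :: "'a::finite_field bipoly set" where
  "coinv_kernel = bipoly_vs.span {act g f - f | g f. invertible g}"

lemma coinv_kernel_mult_invar:
  assumes "f \<in> coinv_kernel" "\<And>g. invertible g \<Longrightarrow> act g r = r"
  shows "r * f \<in> coinv_kernel"
  using assms(1) unfolding coinv_kernel_def
proof (induction rule: bipoly_vs.span_induct_alt)
  case base
  show ?case by (simp add: bipoly_vs.span_zero)
next
  case (step c x y)
  then obtain g f where x: "x = act g f - f" and g: "invertible g" by blast
  have "r * x = act g (r * f) - r * f"
    by (simp add: x act_mult assms(2)[OF g] algebra_simps)
  then have "r * x \<in> bipoly_vs.span {act g f - f | g f. invertible g}"
    using g by (intro bipoly_vs.span_base) blast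
  then show ?case
    using step.IH by (simp add: distrib_left bipoly_vs.span_add bipoly_vs.span_scale)
qed

lemma coinv_kernel_simps:
  "0 \<in> coinv_kernel"
  "f \<in> coinv_kernel \<Longrightarrow> g \<in> coinv_kernel \<Longrightarrow> f + g \<in> coinv_kernel"
  "f \<in> coinv_kernel \<Longrightarrow> - f \<in> coinv_kernel"
  unfolding coinv_kernel_def
  by (auto intro: bipoly_vs.span_zero bipoly_vs.span_add bipoly_vs.span_neg)

definition coinv_rel :: "'a::finite_field bipoly \<Rightarrow> 'a bipoly \<Rightarrow> bool" where
  "coinv_rel f g \<longleftrightarrow> f - g \<in> coinv_kernel"

lemma coinv_rel_add: "coinv_rel a b \<Longrightarrow> coinv_rel c d \<Longrightarrow> coinv_rel (a + c) (b + d)"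
  using coinv_kernel_simps(2)[of "a - b" "c - d"] by (simp add: coinv_rel_def algebra_simps)

lemma coinv_rel_uminus: "coinv_rel a b \<Longrightarrow> coinv_rel (- a) (- b)"
  using coinv_kernel_simps(3)[of "a - b"] by (simp add: coinv_rel_def)

lemma coinv_rel_diff: "coinv_rel a b \<Longrightarrow> coinv_rel c d \<Longrightarrow> coinv_rel (a - c) (b - d)"
  using coinv_rel_add[OF _ coinv_rel_uminus, of a b c d] by simp

quotient_type (overloaded) 'a cofixed = "'a::finite_field bipoly" / coinv_rel
proof (rule equivpI)
  show "reflp (coinv_rel :: 'a bipoly \<Rightarrow> _)" by (simp add: reflp_def coinv_rel_def coinv_kernel_simps)
  show "symp (coinv_rel :: 'a bipoly \<Rightarrow> _)"
  proof (rule sympI)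
    fix f g :: "'a bipoly"
    assume "coinv_rel f g"
    then show "coinv_rel g f"
      using coinv_kernel_simps(3)[of "f - g"] by (simp add: coinv_rel_def)
  qed
  show "transp (coinv_rel :: 'a bipoly \<Rightarrow> _)"
  proof (rule transpI)
    fix f g h :: "'a bipoly"
    assume "coinv_rel f g" "coinv_rel g h"
    then show "coinv_rel f h"
      using coinv_kernel_simps(2)[of "f - g" "g - h"] by (simp add: coinv_rel_def)
  qed
qed

instantiation cofixed :: (finite_field) ab_group_add
begin
lift_definition zero_cofixed :: "'a cofixed" is 0 .
lift_definition plus_cofixed :: "'a cofixed \<Rightarrow> 'a cofixed \<Rightarrow> 'a cofixed" is "(+)"
  by (rule coinv_rel_add)
lift_definition uminus_cofixed :: "'a cofixed \<Rightarrow> 'a cofixed" is uminus by (rule coinv_rel_uminus)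
lift_definition minus_cofixed :: "'a cofixed \<Rightarrow> 'a cofixed \<Rightarrow> 'a cofixed" is "(-)"
  by (rule coinv_rel_diff)
instance
  by standard (transfer; simp add: algebra_simps coinv_rel_def coinv_kernel_simps)+
end

definition cof :: "'a::finite_field bipoly \<Rightarrow> 'a cofixed" where "cof = abs_cofixed"

lemma cof_eq_iff: "cof f = cof g \<longleftrightarrow> f - g \<in> coinv_kernel"
  by (simp add: cof_def cofixed.abs_eq_iff coinv_rel_def)

lift_definition cof_scale :: "'a::finite_field invar \<Rightarrow> 'a cofixed \<Rightarrow> 'a cofixed"
    (infixr \<open>\<odot>\<close> 75) is "\<lambda>r f. r * f"
  unfolding coinv_rel_def by (simp add: coinv_kernel_mult_invar flip: right_diff_distrib)

global_interpretation SG: module "cof_scale :: 'a::finite_field invar \<Rightarrow> _"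
  by standard (transfer; simp add: algebra_simps coinv_rel_def coinv_kernel_simps)+

global_interpretation cof_vs: vector_space "\<lambda>(c::'a::finite_field) (v::'a cofixed). invar_cst c \<odot> v"
proof
  fix a b :: 'a and u v :: "'a cofixed"
  have 1: "invar_cst (a + b) = invar_cst a + invar_cst b" "invar_cst (a * b) = invar_cst a * invar_cst b"
    "invar_cst 1 = (1 :: 'a invar)"
    by (transfer; simp add: cst_simps)+
  show "invar_cst a \<odot> (u + v) = invar_cst a \<odot> u + invar_cst a \<odot> v"
    by (rule SG.scale_right_distrib)
  show "invar_cst (a + b) \<odot> u = invar_cst a \<odot> u + invar_cst b \<odot> u"
    by (simp add: 1 SG.scale_left_distrib)
  show "invar_cst a \<odot> invar_cst b \<odot> u = invar_cst (a * b) \<odot> u" "invar_cst 1 \<odot> u = u"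
    by (simp_all add: 1)
qed

definition cof_deg :: "nat \<Rightarrow> 'a::finite_field cofixed set" where
  "cof_deg d = cof ` {f. homogeneous d f}"

definition Hilb :: "(nat \<Rightarrow> 'a::finite_field cofixed set) \<Rightarrow> rat fps" where
  "Hilb U = Abs_fps (\<lambda>d. of_nat (cof_vs.dim (U d)))"

text \<open>The elements \<open>1, XY, X\<^sup>2Y, \<dots>\<close>\<close>

definition N2_gen :: "nat \<Rightarrow> 'a::finite_field cofixed" where
  "N2_gen i = (if i = 0 then cof 1 else cof (big_X ^ i * big_Y))"


section \<open>Modules over subrings of the invariant ring\<close>

text \<open>The cofixed space as a module over a subring \<open>R\<close> of the invariant ring; for \<open>R = UNIV\<close>
  these are \<open>SG.span\<close> and \<open>SG.independent\<close>.\<close>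

definition span_over :: "'a::finite_field invar set \<Rightarrow> 'a cofixed set \<Rightarrow> 'a cofixed set" where
  "span_over R B = {\<Sum>b\<in>T. r b \<odot> b | T r. finite T \<and> T \<subseteq> B \<and> (\<forall>b\<in>T. r b \<in> R)}"

definition independent_over :: "'a::finite_field invar set \<Rightarrow> 'a cofixed set \<Rightarrow> bool" where
  "independent_over R B \<longleftrightarrow>
     (\<forall>T r. finite T \<longrightarrow> T \<subseteq> B \<longrightarrow> (\<forall>b\<in>T. r b \<in> R) \<longrightarrow> (\<Sum>b\<in>T. r b \<odot> b) = 0 \<longrightarrow> (\<forall>b\<in>T. r b = 0))"

definition free_over :: "'a::finite_field invar set \<Rightarrow> 'a cofixed set \<Rightarrow> bool" where
  "free_over R V \<longleftrightarrow> (\<exists>B. independent_over R B \<and> span_over R B = V)"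

lemma span_over_UNIV: "span_over UNIV B = SG.span B"
  unfolding span_over_def SG.span_explicit by auto

lemma independent_over_UNIV: "independent_over UNIV B \<longleftrightarrow> SG.independent B"
  unfolding independent_over_def SG.independent_explicit_module by auto


section \<open>Copies of \<open>S\<^sup>G/(D\<^sub>0)\<close>\<close>

definition D0_rel :: "'a::finite_field invar \<Rightarrow> 'a invar \<Rightarrow> bool" where
  "D0_rel r s \<longleftrightarrow> D0 dvd r - s"

lemma D0_rel_add: "D0_rel a b \<Longrightarrow> D0_rel c d \<Longrightarrow> D0_rel (a + c) (b + d)"
  unfolding D0_rel_def using dvd_add[of D0 "a - b" "c - d"] by (simp add: algebra_simps)

lemma D0_rel_uminus: "D0_rel a b \<Longrightarrow> D0_rel (- a) (- b)"
  unfolding D0_rel_def using dvd_minus_iff[of D0 "a - b"] by simp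

lemma D0_rel_diff: "D0_rel a b \<Longrightarrow> D0_rel c d \<Longrightarrow> D0_rel (a - c) (b - d)"
  using D0_rel_add[OF _ D0_rel_uminus, of a b c d] by simp

quotient_type (overloaded) 'a dquot = "'a::finite_field invar" / D0_rel
proof (rule equivpI)
  show "reflp (D0_rel :: 'a invar \<Rightarrow> _)" by (simp add: reflp_def D0_rel_def)
  show "symp (D0_rel :: 'a invar \<Rightarrow> _)"
  proof (rule sympI)
    fix r s :: "'a invar"
    assume "D0_rel r s"
    then show "D0_rel s r"
      using dvd_minus_iff[of D0 "r - s"] by (simp add: D0_rel_def)
  qed
  show "transp (D0_rel :: 'a invar \<Rightarrow> _)"
  proof (rule transpI)
    fix r s t :: "'a invar"
    assume "D0_rel r s" "D0_rel s t"
    then show "D0_rel r t"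
      using dvd_add[of D0 "r - s" "s - t"] by (simp add: D0_rel_def)
  qed
qed

instantiation dquot :: (finite_field) ab_group_add
begin
lift_definition zero_dquot :: "'a dquot" is 0 .
lift_definition plus_dquot :: "'a dquot \<Rightarrow> 'a dquot \<Rightarrow> 'a dquot" is "(+)" by (rule D0_rel_add)
lift_definition uminus_dquot :: "'a dquot \<Rightarrow> 'a dquot" is uminus by (rule D0_rel_uminus)
lift_definition minus_dquot :: "'a dquot \<Rightarrow> 'a dquot \<Rightarrow> 'a dquot" is "(-)"
  by (rule D0_rel_diff)
instance by standard (transfer; simp add: algebra_simps D0_rel_def)+
end

lift_definition dquot_one :: "'a::finite_field dquot" is 1 .

lifting_forget invar.lifting

lift_definition dquot_scale :: "'a::finite_field invar \<Rightarrow> 'a dquot \<Rightarrow> 'a dquot"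
    (infixr \<open>\<otimes>\<close> 75) is "(*)"
  unfolding D0_rel_def by (simp add: dvd_mult flip: right_diff_distrib)

global_interpretation dquot: module "dquot_scale :: 'a::finite_field invar \<Rightarrow> _"
  by standard (transfer; simp add: algebra_simps D0_rel_def)+

lifting_update invar.lifting

text \<open>The direct sum of \<open>n\<close> copies of \<open>S\<^sup>G/(D\<^sub>0)\<close>, as functions supported on \<open>{..<n}\<close>.\<close>

definition dquot_copies :: "nat \<Rightarrow> (nat \<Rightarrow> 'a::finite_field dquot) set" where
  "dquot_copies n = {h. \<forall>i\<ge>n. h i = 0}"

text \<open>\<open>V\<close> is a direct sum of \<open>n\<close> copies of \<open>S\<^sup>G/(D\<^sub>0)\<close> with basis \<open>e 0, \<dots>, e (n - 1)\<close>:
  some isomorphism of \<open>S\<^sup>G\<close>-modules takes the standard basis to \<open>e\<close>.\<close>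

definition dquot_basis :: "nat \<Rightarrow> (nat \<Rightarrow> 'a::finite_field cofixed) \<Rightarrow> 'a cofixed set \<Rightarrow> bool" where
  "dquot_basis n e V \<longleftrightarrow>
     (\<exists>\<phi>. bij_betw \<phi> (dquot_copies n) V
        \<and> (\<forall>h\<in>dquot_copies n. \<forall>k\<in>dquot_copies n. \<phi> (\<lambda>i. h i + k i) = \<phi> h + \<phi> k)
        \<and> (\<forall>h\<in>dquot_copies n. \<forall>r. \<phi> (\<lambda>i. r \<otimes> h i) = r \<odot> \<phi> h)
        \<and> (\<forall>i<n. \<phi> (\<lambda>j. if j = i then dquot_one else 0) = e i))"

end

theory Submission
  imports Defs
begin

text \<open>
  Since \<open>GL\<^sub>2\<close> is generated by the diagonal torus, the swap of the variables and the shear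
  \<open>y \<mapsto> y - x\<close>, the torus reduces \<open>S\<^sub>G\<close> to a quotient of \<open>F[X,Y]\<close>, and the shear yields
  \<open>X\<^sup>c Y (Y - X)\<^sup>b = 0\<close> for \<open>c \<ge> 1\<close> and \<open>1 \<le> b \<le> q - 1\<close>. Hence all monomials \<open>X\<^sup>i Y\<^sup>j\<close> with
  \<open>i, j \<ge> 1\<close> and a fixed degree \<open>i + j \<le> 2q\<close> agree in \<open>S\<^sub>G\<close>, and \<open>X\<^sup>i = 0\<close> for \<open>i \<ge> 1\<close>; with
  \<open>X\<^sup>q\<^sup>+\<^sup>1 = X D\<^sub>1 - D\<^sub>0\<close> this gives the generators and shows that \<open>D\<^sub>0\<close> kills all of them but \<open>X\<^sup>q Y\<close>.

  Independence is detected by two maps that factor through \<open>S\<^sub>G\<close>. The trace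
  \<open>f \<mapsto> \<Sum>\<^sub>g g f\<close> is \<open>S\<^sup>G\<close>-linear and sends \<open>X\<^sup>q Y\<close> to \<open>D\<^sub>0\<close>, so \<open>X\<^sup>q Y\<close> is torsion-free. The sum of
  \<open>f(a x, b x)\<close> over the nonzero rows \<open>(a, b)\<close> is semilinear over restriction to the line
  \<open>y = 0\<close>, whose kernel on the invariants is \<open>(D\<^sub>0)\<close>, and sends the other generators to
  \<open>\<plusminus>\<close> powers of \<open>x\<close> whose degrees are distinct modulo \<open>q(q - 1)\<close>.
\<close>

section \<open>Bivariate polynomials\<close>

text \<open>Neither detecting map suffices alone. The trace takes values in a domain, so it kills
  the \<open>D0\<close>-torsion summand; restriction to y = 0 sends \<open>D0\<close> to 0, so the
  row sum sees coefficients only modulo \<open>D0\<close>. This fixes the order: a relation among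
  the generators is first multiplied by \<open>D0\<close>, which removes the torsion part and lets
  the trace settle the coefficient of X^q Y; the row sum is applied to what remains. The bound 2q
  explains which generators are torsion. For i >= 1, \<open>D0\<close> times X^i Y is a sum of q
  monomials of degree i + q + 2; while this is at most 2q they all coincide and the sum is q = 0.
  This is the range i <= q - 2, and X^q Y lies beyond it. The missing X^(q-1) Y is
  \<open>- D1\<close> applied to 1. For the Hilbert series the same two ingredients are used degree
  by degree: the elements D0^a D1^b X^q Y and D1^b times the other generators form a basis of each
  graded component.\<close>

lemma bipoly_induct [case_names cst x y add mult]:
  fixes f :: "'a::comm_ring_1 bipoly"
  assumes cst: "\<And>c. P (cst c)" and x: "P var_x" and y: "P var_y"
    and add: "\<And>f g. P f \<Longrightarrow> P g \<Longrightarrow> P (f + g)" and mult: "\<And>f g. P f \<Longrightarrow> P g \<Longrightarrow> P (f * g)"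
  shows "P f"
proof (induction f)
  case 0
  show ?case using cst[of 0] by (simp add: cst_simps)
next
  case (pCons p f)
  have "P [:p:]"
  proof (induction p)
    case 0
    show ?case using cst[of 0] by (simp add: cst_simps)
  next
    case (pCons c p)
    have "[:pCons c p:] = cst c + var_x * [:p:]" by (simp add: cst_def var_x_def)
    then show ?case using add[OF cst mult[OF x pCons.IH]] by simp
  qed
  moreover have "pCons p f = [:p:] + var_y * f" by (simp add: var_y_def)
  ultimately show ?case using add[OF _ mult[OF y pCons.IH]] by simp
qed

text \<open>Valid for singular matrices too, which is what allows restriction to a line and the row
  sum to be written as actions of rank one matrices.\<close>

lemma act_act: "act g (act h f) = act (g ** h) f"
  by (induction f rule: bipoly_induct)
    (simp_all add: act_cst act_x act_y act_add act_mult matrix_matrix_mult_def sum_2 cst_simps algebra_simps)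

lemma act_sum: "act g (sum f I) = (\<Sum>i\<in>I. act g (f i))"
  by (induction I rule: infinite_finite_induct) (simp_all add: act_0 act_add)

abbreviation mat2 :: "'a::zero \<Rightarrow> 'a \<Rightarrow> 'a \<Rightarrow> 'a \<Rightarrow> 'a^2^2" where
  "mat2 a b c d \<equiv> vector [vector [a, b], vector [c, d]]"

lemma invertible_mat2: "invertible (mat2 a b c d :: 'a::field^2^2) \<longleftrightarrow> a * d - b * c \<noteq> 0"
  by (simp add: invertible_det_nz det_2)

lemma monom_bipoly: "cst c * var_x ^ i * var_y ^ j = monom (monom c i) j"
proof -
  have x: "var_x ^ i = [:monom 1 i :: 'a poly:]"
    by (simp add: var_x_def poly_const_pow monom_altdef)
  have y: "var_y ^ j = (monom 1 j :: 'a bipoly)"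
    by (simp add: var_y_def monom_altdef)
  show ?thesis by (simp add: x y cst_def smult_monom mult_smult_left)
qed

lemma bipoly_sum_monomials:
  "f = (\<Sum>j\<le>degree f. \<Sum>i\<le>degree (coeff f j). cst (coeff (coeff f j) i) * var_x ^ i * var_y ^ j)"
proof -
  have "(\<Sum>i\<le>degree (coeff f j). monom (monom (coeff (coeff f j) i) i) j) = monom (coeff f j) j" for j
    using poly_as_sum_of_monoms[of "coeff f j"] by (simp flip: monom_sum)
  then show ?thesis by (simp add: monom_bipoly poly_as_sum_of_monoms)
qed

lemma homogeneous_mult:
  assumes "homogeneous d f" "homogeneous e g"
  shows "homogeneous (d + e) (f * g)"
  unfolding homogeneous_def
proof (intro allI impI)
  fix i j assume "coeff (coeff (f * g) j) i \<noteq> 0"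
  then have "(\<Sum>k\<le>j. \<Sum>l\<le>i. coeff (coeff f k) l * coeff (coeff g (j - k)) (i - l)) \<noteq> 0"
    by (simp add: coeff_mult coeff_sum)
  then obtain k where k: "k \<le> j"
    and "(\<Sum>l\<le>i. coeff (coeff f k) l * coeff (coeff g (j - k)) (i - l)) \<noteq> 0"
    by (meson atMost_iff sum.neutral)
  then obtain l where l: "l \<le> i" and "coeff (coeff f k) l * coeff (coeff g (j - k)) (i - l) \<noteq> 0"
    by (meson atMost_iff sum.neutral)
  then have "coeff (coeff f k) l \<noteq> 0" "coeff (coeff g (j - k)) (i - l) \<noteq> 0" by auto
  then have "l + k = d" "(i - l) + (j - k) = e" using assms unfolding homogeneous_def by blast+
  then show "i + j = d + e" using k l by simp
qed

lemma homogeneous_monomial: "homogeneous (i + j) (cst c * var_x ^ i * var_y ^ j)"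
  by (auto simp: homogeneous_def monom_bipoly coeff_monom split: if_splits)

lemma homogeneous_1: "homogeneous 0 1"
  using homogeneous_monomial[of 0 0 1] by (simp add: cst_simps)

lemma homogeneous_power: "homogeneous d f \<Longrightarrow> homogeneous (n * d) (f ^ n)"
  by (induction n) (auto simp: homogeneous_1 intro: homogeneous_mult)

lemma homogeneous_0: "homogeneous d 0"
  by (simp add: homogeneous_def)

lemma homogeneous_add: "homogeneous d f \<Longrightarrow> homogeneous d g \<Longrightarrow> homogeneous d (f + g)"
  by (auto simp: homogeneous_def) (metis add_0_left)

lemma homogeneous_sum:
  fixes f :: "'b \<Rightarrow> 'a::comm_ring_1 bipoly"
  shows "(\<And>i. i \<in> I \<Longrightarrow> homogeneous d (f i)) \<Longrightarrow> homogeneous d (sum f I)"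
  by (induction I rule: infinite_finite_induct) (auto intro: homogeneous_0 homogeneous_add)

lemma homogeneous_big: "homogeneous ((i + j) * (CARD('a) - 1)) (big_X ^ i * big_Y ^ j :: 'a::finite_field bipoly)"
  using homogeneous_monomial[of "(CARD('a) - 1) * i" "(CARD('a) - 1) * j" "1::'a"]
  by (simp add: big_X_def big_Y_def cst_simps algebra_simps flip: power_mult)

lemma homogeneous_dickson:
  "homogeneous ((CARD('a))\<^sup>2 - CARD('a)) (dickson_1 :: 'a::finite_field bipoly)"
  "homogeneous ((CARD('a))\<^sup>2 - 1) (dickson_0 :: 'a::finite_field bipoly)"
proof -
  have q: "(CARD('a))\<^sup>2 - CARD('a) = CARD('a) * (CARD('a) - 1)"
    "(CARD('a))\<^sup>2 - 1 = (CARD('a) + 1) * (CARD('a) - 1)"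
    by (simp_all add: power2_eq_square algebra_simps)
  show "homogeneous ((CARD('a))\<^sup>2 - CARD('a)) (dickson_1 :: 'a bipoly)"
    unfolding dickson_1_def q
  proof (rule homogeneous_sum)
    fix i assume "i \<in> {0..CARD('a)}"
    then show "homogeneous (CARD('a) * (CARD('a) - 1)) (big_X ^ i * big_Y ^ (CARD('a) - i) :: 'a bipoly)"
      using homogeneous_big[of i "CARD('a) - i", where ?'a = 'a] by simp
  qed
  show "homogeneous ((CARD('a))\<^sup>2 - 1) (dickson_0 :: 'a bipoly)"
    unfolding dickson_0_def q
  proof (rule homogeneous_sum)
    fix i assume "i \<in> {1..CARD('a)}"
    then show "homogeneous ((CARD('a) + 1) * (CARD('a) - 1)) (big_X ^ i * big_Y ^ (CARD('a) + 1 - i) :: 'a bipoly)"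
      using homogeneous_big[of i "CARD('a) + 1 - i", where ?'a = 'a] by simp
  qed
qed

section \<open>Relations in the cofixed space\<close>

lemma finite_field_power_minus_1:
  "a \<noteq> (0 :: 'a::finite_field) \<Longrightarrow> a ^ (CARD('a) - 1) = 1"
proof -
  assume a: "a \<noteq> 0"
  have "a * a ^ (CARD('a) - 1) = a * 1"
    using card_gt_1[where ?'a = 'a] by (simp add: finite_field_power_card_eq_same flip: power_Suc)
  then show ?thesis using a by simp
qed

lemma of_nat_card_eq_0: "of_nat CARD('a) = (0 :: 'a::finite_field)"
  using of_nat_card_choose[where ?'a = 'a, of 1] card_gt_1[where ?'a = 'a] by simp

text \<open>Otherwise, with r = n mod (q - 1), the polynomial T^r - 1 would vanish at all q - 1
  nonzero elements, more than its degree r allows. This takes the place of a primitive root.\<close>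

lemma power_neq_1_witness:
  assumes "\<not> (CARD('a) - 1) dvd n"
  obtains a :: "'a::finite_field" where "a \<noteq> 0" "a ^ n \<noteq> 1"
proof -
  have "\<exists>a :: 'a. a \<noteq> 0 \<and> a ^ n \<noteq> 1"
  proof (rule ccontr)
    assume "\<not> ?thesis"
    then have all: "a ^ n = 1" if "a \<noteq> 0" for a :: 'a using that by blast
    define m where "m = CARD('a) - 1"
    define r where "r = n mod m"
    have m: "m > 0" using card_gt_1[where ?'a = 'a] by (simp add: m_def)
    have r: "0 < r" "r < m" using assms m by (auto simp: r_def m_def mod_greater_zero_iff_not_dvd)
    define P :: "'a poly" where "P = monom 1 r - 1"
    have "coeff P r = 1" using r by (simp add: P_def)
    then have "P \<noteq> 0" by auto
    have "poly P a = 0" if "a \<noteq> 0" for a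
    proof -
      have "a ^ n = a ^ (m * (n div m) + r)" by (simp add: r_def)
      also have "\<dots> = a ^ r"
        using that finite_field_power_minus_1[of a] by (simp add: power_add power_mult m_def)
      finally show ?thesis using all[OF that] by (simp add: P_def poly_monom)
    qed
    then have "UNIV - {0} \<subseteq> {a. poly P a = 0}" by auto
    then have "m \<le> card {a. poly P a = 0}"
      using card_mono[of "{a. poly P a = 0}" "UNIV - {0}"] by (simp add: m_def)
    also have "\<dots> \<le> degree P" by (rule card_poly_roots_bound[OF \<open>P \<noteq> 0\<close>])
    also have "\<dots> \<le> r" unfolding P_def by (intro degree_diff_le degree_monom_le) simp
    finally show False using r by simp
  qed
  then show thesis using that by blast
qed

text \<open>Replacing a by b a multiplies the sum by b^n. The condition \<open>0 < n\<close>
  reflects \<open>0 ^ 0 = 1\<close>: for n = 0 all q terms are 1, and q = 0 in the field.\<close>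

lemma sum_powers:
  "(\<Sum>a\<in>UNIV. a ^ n) = (if 0 < n \<and> CARD('a) - 1 dvd n then - 1 else 0 :: 'a::finite_field)"
proof (cases "n = 0")
  case True
  then show ?thesis by (simp add: of_nat_card_eq_0)
next
  case n: False
  show ?thesis
  proof (cases "CARD('a) - 1 dvd n")
    case True
    then have 1: "a ^ n = 1" if "a \<noteq> 0" for a :: 'a
      using that finite_field_power_minus_1[of a] by (auto simp: power_mult elim!: dvdE)
    have "(\<Sum>a\<in>UNIV. a ^ n) = (\<Sum>a\<in>UNIV - {0 :: 'a}. 1 :: 'a)"
      by (rule sum.mono_neutral_cong_right) (use n 1 in auto)
    also have "\<dots> = of_nat (CARD('a) - 1)" by simp
    also have "\<dots> = - 1"
      using card_gt_1[where ?'a = 'a] by (subst of_nat_diff) (simp_all add: of_nat_card_eq_0)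
    finally show ?thesis using n True by simp
  next
    case False
    then obtain b :: 'a where b: "b \<noteq> 0" "b ^ n \<noteq> 1" by (rule power_neq_1_witness)
    have "(\<Sum>a\<in>UNIV. a ^ n) = (\<Sum>a\<in>UNIV. (b * a) ^ n)"
      using b by (intro sum.reindex_bij_witness[of _ "\<lambda>a. b * a" "\<lambda>a. a / b"]) auto
    also have "\<dots> = b ^ n * (\<Sum>a\<in>UNIV. a ^ n)" by (simp add: power_mult_distrib sum_distrib_left)
    finally have "(b ^ n - 1) * (\<Sum>a\<in>UNIV. a ^ n) = 0" by (simp add: algebra_simps)
    then show ?thesis using b False by simp
  qed
qed

text \<open>Divide (u - v)^Q = u^Q - v^Q by u - v; if u = v, the sum consists of Q equal terms and
  is 0. It is used with Q = q for the shear and for Q = q, q^2 in the sums of linear forms.\<close>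

lemma power_card_minus_1_diff:
  fixes u v :: "'a::finite_field bipoly"
  assumes Q: "Q = CARD('a) ^ Suc e"
  shows "(u - v) ^ (Q - 1) = (\<Sum>k<Q. u ^ k * v ^ (Q - 1 - k))"
proof -
  have Q1: "1 < Q" unfolding Q using card_gt_1[where ?'a = 'a] by (intro one_less_power) simp_all
  show ?thesis
  proof (cases "u = v")
    case True
    have "(\<Sum>k<Q. u ^ k * u ^ (Q - 1 - k)) = (\<Sum>k<Q. u ^ (Q - 1))"
      by (rule sum.cong) (simp_all flip: power_add)
    also have "\<dots> = 0"
      using of_nat_card_eq_0[where ?'a = 'a] by (simp add: Q of_nat_poly)
    finally show ?thesis using Q1 True by (simp add: power_0_left)
  next
    case False
    have "(u - v) ^ Q = u ^ Q - v ^ Q"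
      unfolding Q by (induction e) (simp_all add: power_mult power_card_diff mult.commute[of "CARD('a)"])
    moreover have "Suc (Q - 1) = Q" using Q1 by simp
    ultimately have "(u - v) * (u - v) ^ (Q - 1) = (u - v) * (\<Sum>k<Q. u ^ k * v ^ (Q - 1 - k))"
      using diff_power_eq_sum[of u "Q - 1" v] by (simp flip: power_Suc)
    then show ?thesis using False by simp
  qed
qed

section \<open>The torus, the swap and the shear in the cofixed space\<close>

lemma cof_add: "cof (f + g) = cof f + cof g"
  and cof_diff: "cof (f - g) = cof f - cof g"
  and cof_0: "cof 0 = 0"
  by (simp_all add: cof_def plus_cofixed.abs_eq minus_cofixed.abs_eq zero_cofixed_def)

lemma cof_sum: "cof (sum f I) = (\<Sum>i\<in>I. cof (f i))"
  by (induction I rule: infinite_finite_induct) (simp_all add: cof_0 cof_add)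

lemma scale_cof: "r \<odot> cof f = cof (Rep_invar r * f)"
  using cof_scale.abs_eq[of "Rep_invar r" f] Rep_invar[of r]
  by (simp add: cof_def eq_onp_def Rep_invar_inverse)

lemma cof_cst: "cof (cst c * f) = invar_cst c \<odot> cof f"
  by (simp add: scale_cof invar_cst.rep_eq)

lemma cof_eq_0_iff: "cof f = 0 \<longleftrightarrow> f \<in> coinv_kernel"
  using cof_eq_iff[of f 0] by (simp add: cof_0)

lemma cof_act: "invertible g \<Longrightarrow> cof (act g f) = cof f"
  unfolding cof_eq_iff coinv_kernel_def by (intro bipoly_vs.span_base) blast

lemma cof_surj: "\<exists>f. v = cof f"
  unfolding cof_def by (metis Quotient_cofixed Quotient_abs_rep)

lemma act_diag:
  "act (mat2 a 0 0 b) var_x = cst a * var_x" "act (mat2 a 0 0 b) var_y = cst b * var_y"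
  by (simp_all add: act_x act_y cst_simps)

text \<open>The torus element \<open>mat2 a 0 0 1\<close> multiplies the polynomial by a^n, and a
  can be chosen with a^n different from 1.\<close>

lemma cof_torus:
  fixes P :: "'a::finite_field bipoly"
  assumes P: "\<And>a. a \<noteq> 0 \<Longrightarrow> act (mat2 a 0 0 1) P = P" and n: "\<not> (CARD('a) - 1) dvd n"
  shows "cof (var_x ^ n * P) = 0"
proof -
  obtain a :: 'a where a: "a \<noteq> 0" "a ^ n \<noteq> 1" using n by (rule power_neq_1_witness)
  have "cof (var_x ^ n * P) = cof (act (mat2 a 0 0 1) (var_x ^ n * P))"
    using a by (intro cof_act[symmetric]) (simp add: invertible_mat2)
  also have "\<dots> = invar_cst (a ^ n) \<odot> cof (var_x ^ n * P)"
    using a by (simp add: act_mult act_power act_diag P power_mult_distrib cst_power mult.assoc flip: cof_cst)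
  finally have "invar_cst (a ^ n - 1) \<odot> cof (var_x ^ n * P) = 0"
    using cof_vs.scale_left_diff_distrib[of "a ^ n" 1 "cof (var_x ^ n * P)"] by simp
  then show ?thesis using a cof_vs.scale_eq_0_iff[of "a ^ n - 1"] by simp
qed

lemma act_diag_y: "act (mat2 a 0 0 1) (var_y ^ n) = var_y ^ n"
  by (simp add: act_power act_diag cst_simps)

lemma act_diag_big:
  "a \<noteq> 0 \<Longrightarrow> act (mat2 a 0 0 1) big_X = (big_X :: 'a::finite_field bipoly)"
  "act (mat2 a 0 0 1) big_Y = (big_Y :: 'a::finite_field bipoly)"
proof -
  show "act (mat2 a 0 0 1) big_Y = (big_Y :: 'a bipoly)"
    by (simp add: big_Y_def act_diag_y)
  assume "a \<noteq> 0"
  then have "cst a ^ (CARD('a) - 1) = 1"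
    using finite_field_power_minus_1[of a] cst_simps(2) by (metis cst_power)
  then show "act (mat2 a 0 0 1) big_X = (big_X :: 'a bipoly)"
    by (simp only: big_X_def act_power act_diag power_mult_distrib mult_1)
qed

lemma cof_swap: "cof (act (mat2 0 1 1 0) f) = cof f"
  by (intro cof_act) (simp add: invertible_mat2)

lemma act_swap: "act (mat2 0 1 1 0) var_x = var_y" "act (mat2 0 1 1 0) var_y = var_x"
  by (simp_all add: act_x act_y cst_simps)

text \<open>This compares \<open>h y\<^sup>q\<^sup>-\<^sup>1\<close> with its image under the shear \<open>y \<mapsto> y - x\<close>.\<close>

lemma cof_shear:
  fixes h :: "'a::finite_field bipoly"
  assumes h: "act (mat2 1 (- 1) 0 1) h = h"
  shows "(\<Sum>k<CARD('a) - 1. cof (var_x ^ (CARD('a) - 1 - k) * (h * var_y ^ k))) = 0"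
proof -
  define q where "q = CARD('a)"
  have q: "1 < q" using card_gt_1 by (simp add: q_def)
  \<comment> \<open>The last term of the expansion is y^(q-1) itself and cancels in the difference,
    so the sum stops at k = q - 2.\<close>
  have s: "{..<q} = insert (q - 1) {..<q - 1}" using q by auto
  have "(var_y - var_x :: 'a bipoly) ^ (q - 1) = (\<Sum>k<q. var_y ^ k * var_x ^ (q - 1 - k))"
    by (rule power_card_minus_1_diff[of _ 0]) (simp add: q_def)
  then have "act (mat2 1 (- 1) 0 1) (h * var_y ^ (q - 1)) - h * var_y ^ (q - 1) =
      (\<Sum>k<q - 1. var_x ^ (q - 1 - k) * (h * var_y ^ k))"
    by (simp add: act_mult act_power h act_y cst_simps s distrib_left sum_distrib_left mult_ac)
  moreover have "cof (act (mat2 1 (- 1) 0 1) (h * var_y ^ (q - 1)) - h * var_y ^ (q - 1)) = 0"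
    unfolding cof_diff by (subst cof_act) (simp_all add: invertible_mat2)
  ultimately show ?thesis by (simp add: cof_sum q_def)
qed

text \<open>Take h = x^(c(q-1)) in the shear relation: for k > 0 the exponent of x is not divisible
  by q - 1 and the torus kills the term, so only k = 0, which is X^(c+1), is left.\<close>

lemma cof_power_big_X: "cof (big_X ^ Suc c) = (0 :: 'a::finite_field cofixed)"
proof -
  define m where "m = CARD('a) - 1"
  have m: "m > 0" using card_gt_1[where ?'a = 'a] by (simp add: m_def)
  define h :: "'a bipoly" where "h = var_x ^ (c * m)"
  have "(\<Sum>k<m. cof (var_x ^ (m - k) * (h * var_y ^ k))) = 0"
    unfolding m_def by (rule cof_shear) (simp add: h_def act_power act_x cst_simps)
  moreover have "cof (var_x ^ (m - k) * (h * var_y ^ k)) = 0" if "k < m" "k \<noteq> 0" for k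
  proof -
    have "\<not> m dvd (m - k) + c * m" 
      using that nat_dvd_not_less[of "m - k" m] dvd_add_left_iff[of m "c * m" "m - k"] by simp
    moreover have "var_x ^ (m - k) * (h * var_y ^ k) = var_x ^ ((m - k) + c * m) * var_y ^ k"
      by (simp add: h_def power_add mult_ac)
    ultimately show ?thesis
      
      unfolding m_def by (simp only:) (rule cof_torus[OF act_diag_y])
  qed
  ultimately have "cof (var_x ^ m * h) = 0"
    using m by (simp add: sum.remove[of _ 0])
  then show ?thesis by (simp add: h_def big_X_def m_def flip: power_add power_mult) (simp add: mult.commute)
qed

text \<open>\<open>y (Y - X) = y\<^sup>q - x\<^sup>q\<^sup>-\<^sup>1 y\<close> is fixed by the shear; the torus kills all terms but one.\<close>

lemma cof_difference:
  assumes b: "1 \<le> b" "b \<le> CARD('a) - 1" and c: "1 \<le> c"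
  shows "cof (big_X ^ c * (big_Y * (big_Y - big_X) ^ b)) = (0 :: 'a::finite_field cofixed)"
proof -
  define m where "m = CARD('a) - 1"
  have q: "CARD('a) = Suc m" using card_gt_1[where ?'a = 'a] by (simp add: m_def)
  define N :: "'a bipoly" where "N = var_y * (big_Y - big_X)"
  have N_eq: "N = var_y ^ CARD('a) - var_x ^ m * var_y"
    by (simp add: N_def big_X_def big_Y_def q algebra_simps)
  have N: "act (mat2 1 (- 1) 0 1) N = N"
    by (simp add: N_eq act_diff act_mult act_power act_x act_y cst_simps power_card_diff)
       (simp add: q algebra_simps)
  \<comment> \<open>The exponent of x is chosen so that the term k = m - b becomes x^(c m) y^m (Y -
    X)^b, the element to be killed.\<close>
  define h where "h = var_x ^ (c * m - b) * N ^ b"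
  have bm: "b \<le> c * m" using b c by (cases c) (auto simp: m_def)
  have "(\<Sum>k<m. cof (var_x ^ (m - k) * (h * var_y ^ k))) = 0"
    unfolding m_def
    by (rule cof_shear) (simp add: h_def act_mult act_power N act_x cst_simps)
  moreover have "cof (var_x ^ (m - k) * (h * var_y ^ k)) = 0" if "k < m" "k \<noteq> m - b" for k
  proof -
    \<comment> \<open>Modulo m this exponent is -(k + b), and 0 < k + b < 2m leaves k + b = m as the
      only way to be divisible.\<close>
    have "\<not> m dvd (m - k) + (c * m - b)"
    proof
      assume "m dvd (m - k) + (c * m - b)"
      moreover have "(m - k) + (c * m - b) + (k + b) = Suc c * m" using that bm by simp
      ultimately have "m dvd k + b"
        by (metis dvd_add_right_iff dvd_triv_right)
      then obtain t where t: "k + b = m * t" by blast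
      have "0 < k + b" "k + b < m * 2" "k + b \<noteq> m" using that b by (auto simp: m_def)
      then show False unfolding t by auto
    qed
    moreover have "var_x ^ (m - k) * (h * var_y ^ k) =
        var_x ^ ((m - k) + (c * m - b)) * (var_y ^ (k + b) * (big_Y - big_X) ^ b)"
      by (simp add: h_def N_def power_add power_mult_distrib mult_ac)
    ultimately show ?thesis
      unfolding m_def
      by (simp only:) (rule cof_torus, simp_all add: act_mult act_power act_diag act_diff act_diag_big cst_simps)
  qed
  ultimately have "cof (var_x ^ (m - (m - b)) * (h * var_y ^ (m - b))) = 0"
    using b by (simp add: sum.remove[of _ "m - b"] m_def)
  moreover have "var_x ^ (m - (m - b)) * (h * var_y ^ (m - b)) =
      (var_x ^ b * var_x ^ (c * m - b)) * ((var_y ^ b * var_y ^ (m - b)) * (big_Y - big_X) ^ b)"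
    using b by (simp add: h_def N_def power_mult_distrib m_def mult_ac)
  moreover have "var_x ^ b * var_x ^ (c * m - b) = (big_X ^ c :: 'a bipoly)"
    using bm by (simp add: big_X_def m_def mult.commute[of c] flip: power_mult power_add)
  moreover have "var_y ^ b * var_y ^ (m - b) = (big_Y :: 'a bipoly)"
    using b by (simp add: big_Y_def m_def flip: power_add)
  ultimately show ?thesis by simp
qed

section \<open>Monomials in X and Y modulo the relations\<close>

definition mon :: "nat \<Rightarrow> nat \<Rightarrow> 'a::finite_field cofixed" where
  "mon i j = cof (big_X ^ i * big_Y ^ j)"

lemma act_swap_big: "act (mat2 0 1 1 0) big_X = big_Y" "act (mat2 0 1 1 0) big_Y = big_X"
  by (simp_all add: big_X_def big_Y_def act_power act_swap)

lemma mon_commute: "mon i j = (mon j i :: 'a::finite_field cofixed)"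
  using cof_swap[of "big_X ^ i * big_Y ^ j :: 'a bipoly"]
  by (simp add: mon_def act_mult act_power act_swap_big mult.commute[of "big_Y ^ i"])

lemma mon_eq_0: "i \<noteq> 0 \<Longrightarrow> mon i 0 = (0 :: 'a::finite_field cofixed)"
  "i \<noteq> 0 \<Longrightarrow> mon 0 i = (0 :: 'a cofixed)"
  using cof_power_big_X[of "i - 1", where ?'a = 'a] mon_commute[of i 0, where ?'a = 'a] by (auto simp: mon_def simp del: power_Suc)

text \<open>Write Y^(j-1) as ((Y - X) + X)^(j-1): every term of X^i Y (Y - X) Y^(j-1) is then of the
  form treated in \<open>cof_difference\<close>, with b = k + 1 <= j. This is where the bound on j
  comes from.\<close>

lemma mon_shift:
  assumes i: "1 \<le> i" and j: "1 \<le> j" "j \<le> CARD('a) - 1"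
  shows "mon (Suc i) j = (mon i (Suc j) :: 'a::finite_field cofixed)"
proof -
  define D :: "'a bipoly" where "D = big_Y - big_X"
  have "big_Y ^ (j - 1) = (D + big_X) ^ (j - 1)" by (simp add: D_def)
  also have "\<dots> = (\<Sum>k\<le>j - 1. of_nat (j - 1 choose k) * D ^ k * big_X ^ (j - 1 - k))"
    by (rule binomial_ring)
  finally have e: "big_X ^ i * (big_Y * D) * big_Y ^ (j - 1) = 
     (\<Sum>k\<le>j - 1. cst (of_nat (j - 1 choose k)) * (big_X ^ (i + (j - 1 - k)) * (big_Y * D ^ Suc k)))"
    by (simp add: sum_distrib_left power_add cst_def of_nat_poly mult_ac)
  have "cof (big_X ^ (i + (j - 1 - k)) * (big_Y * D ^ Suc k)) = 0" if "k \<le> j - 1" for k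
    unfolding D_def by (rule cof_difference) (use that i j in auto)
  then have "cof (big_X ^ i * (big_Y * D) * big_Y ^ (j - 1)) = 0"
    unfolding e cof_sum by (simp add: cof_cst)
  moreover have "big_X ^ i * (big_Y * D) * big_Y ^ (j - 1) = big_X ^ i * big_Y ^ Suc j - big_X ^ Suc i * big_Y ^ j"
    using j by (cases j) (simp_all add: D_def algebra_simps)
  ultimately show ?thesis by (simp add: mon_def cof_diff)
qed

lemma mon_eq_of_le:
  assumes "1 \<le> i" "1 \<le> j" "j \<le> CARD('a)"
  shows "mon i j = (mon (i + j - 1) 1 :: 'a::finite_field cofixed)"
  using assms(2,1,3)
proof (induction j arbitrary: i rule: dec_induct)
  case base
  show ?case by simp
next
  case (step n)
  then have "mon i (Suc n) = (mon (Suc i) n :: 'a cofixed)" by (intro mon_shift[symmetric]) auto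
  also have "\<dots> = mon (i + Suc n - 1) 1" using step by simp
  finally show ?case .
qed

text \<open>If i + j <= 2q then one of the exponents is at most q, and the swap puts it in second
  place.\<close>

lemma mon_eq:
  assumes "1 \<le> i" "1 \<le> j" "i + j \<le> 2 * CARD('a)"
  shows "mon i j = (mon (i + j - 1) 1 :: 'a::finite_field cofixed)"
proof (cases "j \<le> CARD('a)")
  case True
  then show ?thesis using assms by (intro mon_eq_of_le)
next
  case False
  then have "mon j i = (mon (j + i - 1) 1 :: 'a cofixed)"
    using assms by (intro mon_eq_of_le) auto
  then show ?thesis using mon_commute[of i j, where ?'a = 'a] by (simp add: add.commute)
qed

section \<open>Generators of the cofixed space\<close>

lemma D1_mon: "D1 \<odot> mon i j = (\<Sum>l=0..CARD('a). mon (i + l) (CARD('a) - l + j) :: 'a::finite_field cofixed)"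
proof -
  have "mon (i + l) (CARD('a) - l + j) = cof (big_X ^ l * big_Y ^ (CARD('a) - l) * (big_X ^ i * big_Y ^ j) :: 'a bipoly)"
    for l by (simp only: mon_def power_add mult_ac)
  then show ?thesis by (simp only: mon_def[of i j] scale_cof D1.rep_eq dickson_1_def sum_distrib_right cof_sum)
qed

lemma D0_mon: "D0 \<odot> mon i j = (\<Sum>l=1..CARD('a). mon (i + l) (CARD('a) + 1 - l + j) :: 'a::finite_field cofixed)"
proof -
  have "mon (i + l) (CARD('a) + 1 - l + j) = cof (big_X ^ l * big_Y ^ (CARD('a) + 1 - l) * (big_X ^ i * big_Y ^ j) :: 'a bipoly)"
    for l by (simp only: mon_def power_add mult_ac)
  then show ?thesis by (simp only: mon_def[of i j] scale_cof D0.rep_eq dickson_0_def sum_distrib_right cof_sum)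
qed

lemma of_nat_card_invar: "of_nat CARD('a) = (0 :: 'a::finite_field invar)"
proof -
  have "of_nat n = invar_cst (of_nat n :: 'a)" for n
  proof (induction n)
    case 0
    show ?case by (simp add: zero_invar_def invar_cst_def cst_simps)
  next
    case (Suc n)
    have "invar_cst (1 + a) = 1 + invar_cst a" for a :: 'a
      by (simp add: Rep_invar_inject[symmetric] invar_cst.rep_eq plus_invar.rep_eq one_invar.rep_eq cst_simps)
    then show ?case using Suc by simp
  qed
  then show ?thesis by (simp add: of_nat_card_eq_0 zero_invar_def invar_cst_def cst_simps)
qed

lemma sum_const_scale: "(\<Sum>l\<in>A. v) = of_nat (card A) \<odot> (v :: 'a::finite_field cofixed)"
proof -
  have "(\<Sum>l\<in>A. 1 \<odot> v) = (\<Sum>l\<in>A. 1) \<odot> v" by (rule SG.scale_sum_left[symmetric])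
  then show ?thesis by simp
qed

lemma mon_split: "mon (i + CARD('a) + 1) j = D1 \<odot> mon (i + 1) j - D0 \<odot> (mon i j :: 'a::finite_field cofixed)"
proof -
  have "(\<Sum>l=1..CARD('a) + 1. mon (i + l) (CARD('a) + 1 - l + j)) = D1 \<odot> (mon (i + 1) j :: 'a cofixed)"
    unfolding D1_mon by (rule sum.reindex_bij_witness[of _ Suc "\<lambda>l. l - 1"]) auto
  moreover have "{1..CARD('a) + 1} = insert (CARD('a) + 1) {1..CARD('a)}" by auto
  ultimately show ?thesis by (simp add: D0_mon algebra_simps)
qed

text \<open>All q + 1 monomials have positive exponents and degree i + j + q <= 2q, so they
  coincide; and q + 1 = 1 in the field.\<close>

lemma D1_mon_same:
  assumes "1 \<le> i" "1 \<le> j" "i + j \<le> CARD('a)"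
  shows "D1 \<odot> mon i j = (mon (i + j + CARD('a) - 1) 1 :: 'a::finite_field cofixed)"
proof -
  have "D1 \<odot> mon i j = (\<Sum>l=0..CARD('a). mon (i + j + CARD('a) - 1) 1 :: 'a cofixed)"
    unfolding D1_mon
  proof (rule sum.cong)
    fix l assume "l \<in> {0..CARD('a)}"
    then show "mon (i + l) (CARD('a) - l + j) = (mon (i + j + CARD('a) - 1) 1 :: 'a cofixed)"
      using assms by (subst mon_eq) (auto simp: add_ac)
  qed simp
  then show ?thesis by (simp add: sum_const_scale of_nat_card_invar distrib_right)
qed

text \<open>The same argument with q coinciding monomials of degree i + j + q + 1, hence the strict
  bound; their sum is q = 0 times one of them.\<close>

lemma D0_mon_same:
  assumes "1 \<le> i" "1 \<le> j" "i + j < CARD('a)"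
  shows "D0 \<odot> mon i j = (0 :: 'a::finite_field cofixed)"
proof -
  have "D0 \<odot> mon i j = (\<Sum>l=1..CARD('a). mon (i + j + CARD('a)) 1 :: 'a cofixed)"
    unfolding D0_mon
  proof (rule sum.cong)
    fix l assume "l \<in> {1..CARD('a)}"
    then show "mon (i + l) (CARD('a) + 1 - l + j) = (mon (i + j + CARD('a)) 1 :: 'a cofixed)"
      using assms by (subst mon_eq) (auto simp: add_ac)
  qed simp
  then show ?thesis by (simp add: sum_const_scale of_nat_card_invar)
qed

lemma D0_mon_0: "D0 \<odot> mon 0 0 = (0 :: 'a::finite_field cofixed)"
proof -
  have "D0 \<odot> mon 0 0 = (\<Sum>l=1..CARD('a). mon CARD('a) 1 :: 'a cofixed)"
    unfolding D0_mon
  proof (rule sum.cong)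
    fix l assume "l \<in> {1..CARD('a)}"
    then show "mon (0 + l) (CARD('a) + 1 - l + 0) = (mon CARD('a) 1 :: 'a cofixed)"
      using card_gt_1[where ?'a = 'a] by (subst mon_eq) auto
  qed simp
  then show ?thesis by (simp add: sum_const_scale of_nat_card_invar)
qed

text \<open>The end terms X^q and Y^q vanish and the other q - 1 coincide. This is why X^(q-1) Y is
  absent from the list of generators.\<close>

lemma D1_mon_0: "D1 \<odot> mon 0 0 = - (mon (CARD('a) - 1) 1 :: 'a::finite_field cofixed)"
proof -
  define q where "q = CARD('a)"
  have q: "1 < q" using card_gt_1 by (simp add: q_def)
  then have s: "{0..q} = insert 0 (insert q {1..<q})" by auto
  have "D1 \<odot> mon 0 0 = (\<Sum>l=0..q. mon l (q - l) :: 'a cofixed)"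
    unfolding D1_mon by (simp add: q_def)
  also have "\<dots> = (\<Sum>l\<in>{1..<q}. mon l (q - l))"
    using q by (simp add: s mon_eq_0)
  also have "\<dots> = (\<Sum>l\<in>{1..<q}. mon (q - 1) 1)"
  proof (rule sum.cong)
    fix l assume "l \<in> {1..<q}"
    then show "mon l (q - l) = (mon (q - 1) 1 :: 'a cofixed)"
      by (subst mon_eq) (auto simp: q_def)
  qed simp
  also have "\<dots> = of_nat (q - 1) \<odot> mon (q - 1) 1" by (simp add: sum_const_scale)
  also have "of_nat (q - 1) = (- 1 :: 'a invar)"
    using q by (subst of_nat_diff) (simp_all add: q_def of_nat_card_invar)
  finally show ?thesis by (simp add: q_def)
qed

lemma N2_gen_mon: "N2_gen i = (if i = 0 then mon 0 0 else mon i 1)"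
  by (simp add: N2_gen_def mon_def)

lemma D0_N2_gen: "i < CARD('a) - 1 \<Longrightarrow> D0 \<odot> N2_gen i = (0 :: 'a::finite_field cofixed)"
  by (auto simp: N2_gen_mon D0_mon_0 intro!: D0_mon_same)

text \<open>Stated for a family of subspaces closed under multiplication by the Dickson invariants, so that
  it yields both the generation of \<open>S\<^sub>G\<close> as a module and the bases of its graded components.\<close>

lemma mon_mem:
  fixes W :: "nat \<Rightarrow> 'a::finite_field cofixed set"
  assumes sub: "\<And>n. cof_vs.subspace (W n)"
    and D0: "\<And>n v. v \<in> W n \<Longrightarrow> D0 \<odot> v \<in> W (n + CARD('a) + 1)"
    and D1: "\<And>n v. v \<in> W n \<Longrightarrow> D1 \<odot> v \<in> W (n + CARD('a))"
    and top: "mon CARD('a) 1 \<in> W (CARD('a) + 1)"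
    and zero: "mon 0 0 \<in> W 0"
    and gen: "\<And>i. 0 < i \<Longrightarrow> i < CARD('a) - 1 \<Longrightarrow> mon i 1 \<in> W (i + 1)"
  shows "mon i j \<in> W (i + j)"
proof (induction "i + j" arbitrary: i j rule: less_induct)
  case less
  define q where "q = CARD('a)"
  have q: "1 < q" using card_gt_1 by (simp add: q_def)
  have W0: "0 \<in> W n" for n using sub by (rule cof_vs.subspace_0)
  \<comment> \<open>An exponent above q is lowered by X^(q+1) = X D1 - D0; both monomials on the
    right have smaller degree.\<close>
  have big: "mon i j \<in> W (i + j)" if "q < i" and IH: "\<And>i' j'. i' + j' < i + j \<Longrightarrow> mon i' j' \<in> W (i' + j')" for i j
  proof -
    obtain k where k: "i = k + q + 1" using \<open>q < i\<close> less_imp_Suc_add by (metis Suc_eq_plus1 add.commute)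
    have "D1 \<odot> mon (k + 1) j \<in> W (i + j)" "D0 \<odot> mon k j \<in> W (i + j)"
      using D1[OF IH[of "k + 1" j]] D0[OF IH[of k j]] q by (simp_all add: k q_def add_ac)
    then show ?thesis
      using mon_split[of k j, where ?'a = 'a] cof_vs.subspace_diff[OF sub] by (simp add: k q_def)
  qed
  consider "q < i" | "q < j" | "i = 0" "j = 0" | "i = 0" "j \<noteq> 0" | "i \<noteq> 0" "j = 0"
    | "1 \<le> i" "1 \<le> j" "i \<le> q" "j \<le> q" by linarith
  then show ?case
  proof cases
    case 1
    then show ?thesis using big less by blast
  next
    case 2
    then have "mon j i \<in> W (j + i)" using big less by (metis add.commute)
    then show ?thesis using mon_commute by (metis add.commute)
  next
    case 6
    define m where "m = i + j"
    have m: "2 \<le> m" "m \<le> 2 * q" using 6 by (auto simp: m_def)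
    have e: "mon i j = (mon (m - 1) 1 :: 'a cofixed)"
      using 6 mon_eq[of i j, where ?'a = 'a] by (simp add: m_def q_def)
    \<comment> \<open>The monomial X^(m-1) Y is a generator for m < q, \<open>- D1\<close> times 1
      for m = q and the top generator for m = q + 1. Beyond that it is \<open>D1\<close> times
      X^(m-q-1) Y, where m <= 2q makes \<open>D1_mon_same\<close> applicable.\<close>
    consider "m < q" | "m = q" | "m = q + 1" | "q + 2 \<le> m" by linarith
    then have "mon (m - 1) 1 \<in> W m"
    proof cases
      case 1
      then show ?thesis using gen[of "m - 1"] m by (simp add: q_def)
    next
      case 2
      then show ?thesis using D1[OF zero] cof_vs.subspace_neg[OF sub] by (fastforce simp: D1_mon_0 q_def)
    next
      case 3
      then show ?thesis using top by (simp add: q_def)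
    next
      case 4
      have "D1 \<odot> mon (m - q - 1) 1 = (mon (m - q - 1 + 1 + q - 1) 1 :: 'a cofixed)"
        unfolding q_def by (rule D1_mon_same) (use 4 m in \<open>auto simp: q_def\<close>)
      moreover have "D1 \<odot> mon (m - q - 1) 1 \<in> W (m - q - 1 + 1 + q)"
        unfolding q_def by (intro D1 less) (use 4 q in \<open>auto simp: q_def m_def\<close>)
      ultimately show ?thesis using 4 by simp
    qed
    then show ?thesis using e by (simp add: m_def)
  qed (use zero W0 in \<open>simp_all add: mon_eq_0\<close>)
qed

lemma cof_monomial:
  "cof (var_x ^ i * var_y ^ j) = (if CARD('a) - 1 dvd i \<and> CARD('a) - 1 dvd j 
     then mon (i div (CARD('a) - 1)) (j div (CARD('a) - 1)) else 0 :: 'a::finite_field cofixed)"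
proof -
  have x: "cof (var_x ^ i * var_y ^ j) = (0 :: 'a cofixed)" if "\<not> CARD('a) - 1 dvd i" for i j
    using act_diag_y that by (rule cof_torus)
  have "cof (var_x ^ i * var_y ^ j) = (0 :: 'a cofixed)" if "\<not> CARD('a) - 1 dvd j"
    using x[OF that, of i] cof_swap[of "var_x ^ i * var_y ^ j :: 'a bipoly"]
    by (simp add: act_mult act_power act_swap mult.commute[of "var_y ^ i"])
  then show ?thesis using x[of i j]
    by (auto simp: mon_def big_X_def big_Y_def simp flip: power_mult)
qed

lemma cof_homogeneous_mem:
  fixes W :: "nat \<Rightarrow> 'a::finite_field cofixed set"
  assumes sub: "\<And>n. cof_vs.subspace (W n)" and mon: "\<And>i j. mon i j \<in> W (i + j)"
    and f: "homogeneous d f"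
  shows "cof f \<in> (if CARD('a) - 1 dvd d then W (d div (CARD('a) - 1)) else {0})" (is "_ \<in> ?W")
proof -
  have W: "cof_vs.subspace ?W" using sub cof_vs.subspace_single_0 by simp
  have "cof (cst (coeff (coeff f j) i) * var_x ^ i * var_y ^ j) \<in> ?W" for i j
  proof (cases "coeff (coeff f j) i = 0")
    case True
    then show ?thesis using cof_vs.subspace_0[OF W] by (simp add: cst_simps cof_0)
  next
    case False
    then have d: "d = i + j" using f by (simp add: homogeneous_def)
    have "cof (var_x ^ i * var_y ^ j) \<in> ?W"
      using mon cof_vs.subspace_0[OF sub] by (auto simp: cof_monomial d div_add)
    then show ?thesis
      unfolding mult.assoc cof_cst by (rule cof_vs.subspace_scale[OF W])
  qed
  then show ?thesis
    by (subst bipoly_sum_monomials) (simp only: cof_sum, intro cof_vs.subspace_sum[OF W])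
qed

lemma span_UNIV: "SG.span (insert (mon CARD('a) 1) (N2_gen ` {..<CARD('a) - 1})) = (UNIV :: 'a::finite_field cofixed set)"
  (is "SG.span ?B = _")
proof -
  define W where "W = (\<lambda>n::nat. SG.span ?B)"
  have sub: "cof_vs.subspace (W n)" for n
    unfolding W_def cof_vs.subspace_def by (simp add: SG.span_zero SG.span_add SG.span_scale)
  have q: "0 < CARD('a) - 1" using card_gt_1[where ?'a = 'a] by simp
  have mon: "mon i j \<in> W (i + j)" for i j
  proof (rule mon_mem[OF sub])
    show "mon 0 0 \<in> W 0"
      unfolding W_def using q by (intro SG.span_base) (force simp: N2_gen_mon image_iff)
    show "mon i 1 \<in> W (i + 1)" if "0 < i" "i < CARD('a) - 1" for i
      unfolding W_def using that by (intro SG.span_base) (force simp: N2_gen_mon image_iff)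
  qed (simp_all add: W_def SG.span_base SG.span_scale)
  have "cof f \<in> W 0" for f
  proof (subst bipoly_sum_monomials, simp only: cof_sum, intro cof_vs.subspace_sum[OF sub])
    fix i j
    show "cof (cst (coeff (coeff f j) i) * var_x ^ i * var_y ^ j) \<in> W 0"
      using mon cof_vs.subspace_0[OF sub]
      by (auto simp: cof_monomial mult.assoc cof_cst W_def intro!: SG.span_scale)
  qed
  then show ?thesis using cof_surj unfolding W_def by (metis UNIV_eq_I)
qed

section \<open>The trace and the sum over rows\<close>

text \<open>Right translation by an invertible h permutes H. Both the group and the set of nonzero
  matrices with zero second row are stable under it; the former gives the trace, the latter the row
  sum.\<close>

lemma sum_act_coinv_kernel:
  fixes H :: "('a::finite_field^2^2) set"
  assumes H: "\<And>g h. g \<in> H \<Longrightarrow> invertible h \<Longrightarrow> g ** h \<in> H" and f: "f \<in> coinv_kernel"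
  shows "(\<Sum>g\<in>H. act g f) = 0"
  using f unfolding coinv_kernel_def
proof (induction rule: bipoly_vs.span_induct_alt)
  case base
  show ?case by (simp add: act_0)
next
  case (step c x y)
  then obtain h f where x: "x = act h f - f" and h: "invertible h" by blast
  from h obtain h' where h': "h ** h' = mat 1" "h' ** h = mat 1" by (auto simp: invertible_def)
  then have "invertible h'" by (auto simp: invertible_def)
  have "(\<Sum>g\<in>H. act (g ** h) f) = (\<Sum>g\<in>H. act g f)"
  proof (rule sum.reindex_bij_witness[of _ "\<lambda>g. g ** h'" "\<lambda>g. g ** h"])
    fix g assume "g \<in> H"
    then show "g ** h \<in> H" "g ** h' \<in> H" using H h \<open>invertible h'\<close> by auto
    show "g ** h ** h' = g" "g ** h' ** h = g" by (simp_all add: h' flip: matrix_mul_assoc)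
  qed simp
  then have "(\<Sum>g\<in>H. act g x) = 0" by (simp add: x act_diff act_act sum_subtractf)
  then show ?case
    using step.IH by (simp add: act_add act_mult act_cst sum.distrib flip: cst_mult sum_distrib_left)
qed

section \<open>Sums of powers of linear forms\<close>

lemma cst_sum: "cst (sum f A) = (\<Sum>a\<in>A. cst (f a))"
  by (induction A rule: infinite_finite_induct) (simp_all add: cst_simps)

lemma sum_cst_product:
  fixes f g :: "'a::finite_field \<Rightarrow> 'a"
  shows "(\<Sum>(a, c)\<in>UNIV. cst (f a) * cst (g c) * z) = cst (\<Sum>a\<in>UNIV. f a) * cst (\<Sum>c\<in>UNIV. g c) * z"
  unfolding cst_sum
  unfolding sum_product
  unfolding sum_distrib_right sum.cartesian_product UNIV_Times_UNIV case_prod_unfold ..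

text \<open>After the change of sign c -> -c every coefficient of the expanded power is 1. The
  double sum then factors into two power sums, which are both -1 when the two exponents are positive
  multiples of q - 1; otherwise one of them is 0.\<close>

lemma sum_linear_forms:
  assumes Q: "Q = CARD('a::finite_field) ^ Suc e"
  defines "m \<equiv> CARD('a) - 1"
  shows "(\<Sum>(a, c)\<in>UNIV. (cst a * var_x + cst c * var_y) ^ (Q - 1)) =
    (\<Sum>k | k < Q \<and> (0 < k \<and> m dvd k) \<and> (0 < Q - 1 - k \<and> m dvd Q - 1 - k). var_x ^ k * var_y ^ (Q - 1 - k) :: 'a bipoly)"
proof -
  have "(\<Sum>(a, c)\<in>UNIV. (cst a * var_x + cst c * var_y :: 'a bipoly) ^ (Q - 1)) =
      (\<Sum>(a, c)\<in>UNIV. (cst a * var_x - cst c * var_y) ^ (Q - 1))"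
    by (rule sum.reindex_bij_witness[of _ "\<lambda>(a, c). (a, - c)" "\<lambda>(a, c). (a, - c)"])
      (auto simp: cst_simps)
  also have "\<dots> = (\<Sum>(a, c)\<in>UNIV. \<Sum>k<Q. cst (a ^ k) * cst (c ^ (Q - 1 - k)) * (var_x ^ k * var_y ^ (Q - 1 - k)))"
    unfolding power_card_minus_1_diff[OF Q] by (simp add: power_mult_distrib cst_power mult_ac)
  also have "\<dots> = (\<Sum>k<Q. cst (\<Sum>a\<in>UNIV. a ^ k) * cst (\<Sum>c\<in>UNIV. c ^ (Q - 1 - k)) * (var_x ^ k * var_y ^ (Q - 1 - k)))"
    unfolding sum_cst_product[symmetric] case_prod_unfold by (rule sum.swap)
  also have "\<dots> = (\<Sum>k<Q. if (0 < k \<and> m dvd k) \<and> (0 < Q - 1 - k \<and> m dvd Q - 1 - k) then var_x ^ k * var_y ^ (Q - 1 - k) else 0)"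
    by (rule sum.cong) (auto simp: sum_powers cst_simps m_def)
  also have "\<dots> = (\<Sum>k | k < Q \<and> (0 < k \<and> m dvd k) \<and> (0 < Q - 1 - k \<and> m dvd Q - 1 - k). var_x ^ k * var_y ^ (Q - 1 - k))"
    by (subst sum.inter_filter[symmetric]) (simp_all add: lessThan_def)
  finally show ?thesis .
qed

text \<open>The exponent q - 1 is not a sum of two positive multiples of q - 1.\<close>

lemma sum_linear_forms_card:
  "(\<Sum>(a, c)\<in>UNIV. (cst a * var_x + cst c * var_y) ^ (CARD('a) - 1)) = (0 :: 'a::finite_field bipoly)"
proof -
  have e: "{k. k < CARD('a) \<and> (0 < k \<and> CARD('a) - 1 dvd k) \<and> 0 < CARD('a) - 1 - k \<and> CARD('a) - 1 dvd CARD('a) - 1 - k} = {}"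
    by (auto dest!: dvd_imp_le)
  show ?thesis
    by (subst sum_linear_forms[of _ 0]) (simp, unfold e, rule sum.empty)
qed

text \<open>Since q^2 - 1 = (q + 1)(q - 1), the surviving exponents are j(q - 1) and (q + 1 - j)(q -
  1) with 1 <= j <= q, exactly those of \<open>dickson_0\<close>.\<close>

lemma sum_linear_forms_card_sq:
  "(\<Sum>(a, c)\<in>UNIV. (cst a * var_x + cst c * var_y) ^ ((CARD('a))\<^sup>2 - 1)) = (dickson_0 :: 'a::finite_field bipoly)"
proof -
  define q where "q = CARD('a)"
  define m where "m = q - 1"
  have q: "q = Suc m" and m: "0 < m" using card_gt_1[where ?'a = 'a] by (simp_all add: q_def m_def)
  have q2: "q\<^sup>2 - 1 = m * (q + 1)" by (simp add: q power2_eq_square)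
  have q2': "0 < q\<^sup>2" by (simp add: q)
  have "(\<Sum>(a, c)\<in>UNIV. (cst a * var_x + cst c * var_y) ^ (q\<^sup>2 - 1)) =
    (\<Sum>k | k < q\<^sup>2 \<and> (0 < k \<and> m dvd k) \<and> (0 < q\<^sup>2 - 1 - k \<and> m dvd q\<^sup>2 - 1 - k). var_x ^ k * var_y ^ (q\<^sup>2 - 1 - k) :: 'a bipoly)"
    unfolding m_def q_def by (rule sum_linear_forms[of _ 1]) (simp add: power2_eq_square)
  also have "\<dots> = (\<Sum>j = 1..q. var_x ^ (m * j) * var_y ^ (m * (q + 1 - j)))"
  proof (rule sum.reindex_bij_witness[of _ "\<lambda>j. m * j" "\<lambda>k. k div m"])
    fix j assume j: "j \<in> {1..q}"
    have "m * j < m * (q + 1)" using m j by (intro mult_strict_left_mono) auto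
    then have "m * j < q\<^sup>2" using q2 by linarith
    moreover have "m * (q + 1) - m * j = m * (q + 1 - j)" by (rule diff_mult_distrib2[symmetric])
    ultimately show "m * j \<in> {k. k < q\<^sup>2 \<and> (0 < k \<and> m dvd k) \<and> (0 < q\<^sup>2 - 1 - k \<and> m dvd q\<^sup>2 - 1 - k)}"
      using m j q2 q2' by (auto simp del: mult_Suc_right add_Suc_right)
    show "m * j div m = j" using m by simp
  next
    fix k assume k: "k \<in> {k. k < q\<^sup>2 \<and> (0 < k \<and> m dvd k) \<and> (0 < q\<^sup>2 - 1 - k \<and> m dvd q\<^sup>2 - 1 - k)}"
    then obtain j where kj: "k = m * j" by blast
    have "m * j < m * (q + 1)" "0 < m * j" using k q2 by (auto simp: kj)
    then have j: "0 < j" "j < q + 1" by (auto simp only: mult_less_cancel1 nat_0_less_mult_iff)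
    then show "k div m \<in> {1..q}" using m by (simp add: kj)
    show "m * (k div m) = k" using m by (simp add: kj)
    show "var_x ^ (m * (k div m)) * var_y ^ (m * (q + 1 - k div m)) = (var_x ^ k * var_y ^ (q\<^sup>2 - 1 - k) :: 'a bipoly)"
      unfolding q2 kj using m by (simp add: diff_mult_distrib2 del: mult_Suc_right)
  qed
  also have "\<dots> = dickson_0"
    by (simp add: dickson_0_def big_X_def big_Y_def power_mult m_def q_def)
  finally show ?thesis by (simp add: q_def)
qed

section \<open>The trace over the whole group\<close>

definition gl_trace :: "'a::finite_field bipoly \<Rightarrow> 'a bipoly" where
  "gl_trace f = (\<Sum>g | invertible g. act g f)"

lemma gl_trace_coinv_kernel: "f \<in> coinv_kernel \<Longrightarrow> gl_trace f = 0"
  unfolding gl_trace_def by (rule sum_act_coinv_kernel) (auto intro: invertible_mult)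

lemma gl_trace_mult_invar: "gl_trace (Rep_invar r * f) = Rep_invar r * gl_trace f"
  using Rep_invar[of r] by (simp add: gl_trace_def act_mult sum_distrib_left)

text \<open>Sum over the columns v, w of the matrix. For fixed v the sum of l(w)^(q-1) over all w is
  0, and over the line through v it is -l(v)^(q-1); hence over the w independent of v it is
  l(v)^(q-1). What remains is the sum of l(v)^(q^2-1).\<close>

lemma gl_trace_top: "gl_trace (big_X ^ CARD('a) * big_Y) = (dickson_0 :: 'a::finite_field bipoly)"
proof -
  define q where "q = CARD('a)"
  have q: "1 < q" using card_gt_1 by (simp add: q_def)
  define l where "l = (\<lambda>(a :: 'a, c). cst a * var_x + cst c * var_y)"
  define S where "S = (\<lambda>(a :: 'a, c). {(b, d). a * d - b * c \<noteq> 0})"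
  have inner: "(\<Sum>w\<in>S v. l w ^ (q - 1)) = l v ^ (q - 1)" if v: "v \<noteq> (0, 0)" for v
  proof -
    obtain a c where ac: "v = (a, c)" by (cases v)
    \<comment> \<open>The vectors dependent on v form the line through v, parametrized once because
      v is nonzero.\<close>
    have S: "- S v = range (\<lambda>t. (t * a, t * c))"
    proof
      show "range (\<lambda>t. (t * a, t * c)) \<subseteq> - S v" by (auto simp: S_def ac)
      show "- S v \<subseteq> range (\<lambda>t. (t * a, t * c))"
      proof
        fix w assume w: "w \<in> - S v"
        obtain b d where bd: "w = (b, d)" by (cases w)
        have "w = ((if a = 0 then d / c else b / a) * a, (if a = 0 then d / c else b / a) * c)"
          using v w by (auto simp: bd ac S_def nonzero_eq_divide_eq mult.commute)
        then show "w \<in> range (\<lambda>t. (t * a, t * c))" by (rule range_eqI)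
      qed
    qed
    have "(\<Sum>w\<in>- S v. l w ^ (q - 1)) = (\<Sum>t\<in>UNIV. l (t * a, t * c) ^ (q - 1))"
      unfolding S by (rule sum.reindex[unfolded comp_def]) (use v in \<open>auto simp: inj_on_def ac\<close>)
    also have "\<dots> = (\<Sum>t\<in>UNIV. cst (t ^ (q - 1)) * l v ^ (q - 1))"
      by (rule sum.cong) (simp_all add: l_def ac cst_simps cst_power mult.assoc power_mult_distrib flip: distrib_left)
    also have "\<dots> = cst (\<Sum>t\<in>UNIV. t ^ (q - 1)) * l v ^ (q - 1)"
      by (simp add: cst_sum sum_distrib_right)
    also have "\<dots> = - (l v ^ (q - 1))"
      using q by (simp add: sum_powers q_def cst_simps)
    finally have "(\<Sum>w\<in>- S v. l w ^ (q - 1)) = - (l v ^ (q - 1))" .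
    moreover have "(\<Sum>w\<in>UNIV. l w ^ (q - 1)) = 0"
      using sum_linear_forms_card[where ?'a = 'a] by (simp add: l_def q_def case_prod_unfold)
    moreover have "(\<Sum>w\<in>UNIV. l w ^ (q - 1)) = (\<Sum>w\<in>S v. l w ^ (q - 1)) + (\<Sum>w\<in>- S v. l w ^ (q - 1))"
      using sum.subset_diff[of "S v" UNIV "\<lambda>w. l w ^ (q - 1)"] by (simp add: Compl_eq_Diff_UNIV add.commute)
    ultimately show ?thesis by (simp add: add_eq_0_iff)
  qed
  have "gl_trace (big_X ^ q * big_Y) = (\<Sum>(v, w)\<in>Sigma UNIV S. (l v ^ (q - 1)) ^ q * l w ^ (q - 1))"
    unfolding gl_trace_def
    by (rule sum.reindex_bij_witness[of _ "\<lambda>((a, c), (b, d)). mat2 a b c d"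
          "\<lambda>g. ((g$1$1, g$2$1), (g$1$2, g$2$2))"])
      (auto simp: S_def l_def invertible_det_nz det_2 vec_eq_iff forall_2
        act_mult act_power act_x act_y big_X_def big_Y_def q_def)
  also have "\<dots> = (\<Sum>v\<in>UNIV. (l v ^ (q - 1)) ^ q * (\<Sum>w\<in>S v. l w ^ (q - 1)))"
    by (subst sum.Sigma[symmetric]) (simp_all add: sum_distrib_left)
  also have "\<dots> = (\<Sum>v\<in>UNIV. l v ^ (q\<^sup>2 - 1))"
  proof (rule sum.cong)
    fix v
    have e: "q\<^sup>2 - 1 = (q - 1) * q + (q - 1)" using q by (cases q) (simp_all add: power2_eq_square)
    show "(l v ^ (q - 1)) ^ q * (\<Sum>w\<in>S v. l w ^ (q - 1)) = l v ^ (q\<^sup>2 - 1)"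
    proof (cases "v = (0, 0)")
      case True
      then show ?thesis using q unfolding e by (simp add: l_def cst_simps power_0_left)
    next
      case False
      then show ?thesis unfolding e inner[OF False] by (simp only: power_mult power_add)
    qed
  qed simp
  also have "\<dots> = dickson_0"
    using sum_linear_forms_card_sq[where ?'a = 'a] by (simp add: l_def q_def case_prod_unfold)
  finally show ?thesis by (simp add: q_def)
qed

section \<open>The sum over nonzero rows\<close>

text \<open>This is f(x, 0), encoded by a singular matrix so that \<open>act_act\<close> and the
  homomorphism laws of \<open>act\<close> apply to it.\<close>

definition restr :: "'a::comm_ring_1 bipoly \<Rightarrow> 'a bipoly" where
  "restr = act (mat2 1 0 0 0)"

definition row_sum :: "'a::finite_field bipoly \<Rightarrow> 'a bipoly" where
  "row_sum f = (\<Sum>g | g$2 = 0 \<and> g \<noteq> 0. act g f)"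

lemma row_sum_coinv_kernel: "f \<in> coinv_kernel \<Longrightarrow> row_sum f = 0"
  unfolding row_sum_def
proof (rule sum_act_coinv_kernel)
  fix g h :: "'a^2^2" assume g: "g \<in> {g. g$2 = 0 \<and> g \<noteq> 0}" and "invertible h"
  then obtain h' where "h ** h' = mat 1" by (auto simp: invertible_def)
  then have "g ** h ** h' = g" by (simp flip: matrix_mul_assoc)
  moreover have "0 ** h' = 0" by (simp add: matrix_matrix_mult_def vec_eq_iff)
  ultimately have "g ** h \<noteq> 0" using g by auto
  moreover have "(g ** h)$2 = 0" using g by (simp add: matrix_matrix_mult_def vec_eq_iff)
  ultimately show "g ** h \<in> {g. g$2 = 0 \<and> g \<noteq> 0}" by simp
qed

text \<open>Complete the nonzero first row of g to an invertible h. Then g is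
  \<open>mat2 1 0 0 0 ** h\<close>, and invariance absorbs h.\<close>

lemma act_row_invar:
  fixes g :: "'a::finite_field^2^2"
  assumes "g$2 = 0" "g \<noteq> 0"
  shows "act g (Rep_invar r) = restr (Rep_invar r)"
proof -
  define h where "h = (if g$1$1 = 0 then mat2 (g$1$1) (g$1$2) 1 0 else mat2 (g$1$1) (g$1$2) 0 1)"
  have "invertible h"
    using assms by (auto simp: h_def invertible_mat2 vec_eq_iff forall_2)
  then have "act h (Rep_invar r) = Rep_invar r" using Rep_invar[of r] by simp
  moreover have "g = mat2 1 0 0 0 ** h"
    using assms by (simp add: h_def vec_eq_iff forall_2 matrix_matrix_mult_def sum_2)
  ultimately show ?thesis by (metis act_act restr_def)
qed

lemma row_sum_mult_invar: "row_sum (Rep_invar r * f) = restr (Rep_invar r) * row_sum f"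
  by (simp add: row_sum_def act_mult act_row_invar sum_distrib_left)

lemma row_sum_eq:
  "row_sum f = (\<Sum>(a, b)\<in>UNIV. act (mat2 a b 0 0) f) - act 0 (f :: 'a::finite_field bipoly)"
proof -
  have "(\<Sum>(a, b)\<in>UNIV. act (mat2 a b 0 0) f) = (\<Sum>g | g$2 = 0. act g f)"
    by (rule sum.reindex_bij_witness[of _ "\<lambda>g. (g$1$1, g$1$2)" "\<lambda>(a, b). mat2 a b 0 0"])
      (auto simp: vec_eq_iff forall_2)
  moreover have "{g :: 'a^2^2. g$2 = 0} = insert 0 {g. g$2 = 0 \<and> g \<noteq> 0}" by auto
  ultimately show ?thesis by (simp add: row_sum_def)
qed

lemma row_sum_1: "row_sum 1 = (- 1 :: 'a::finite_field bipoly)"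
  using of_nat_card_eq_0[where ?'a = 'a] by (simp add: row_sum_eq act_1 case_prod_unfold of_nat_poly flip: UNIV_Times_UNIV)

text \<open>The zero row contributes nothing, and the sums over a and over b are both -1.\<close>

lemma row_sum_monomial:
  assumes "0 < i" "0 < j"
  shows "row_sum (big_X ^ i * big_Y ^ j) = (big_X ^ (i + j) :: 'a::finite_field bipoly)"
proof -
  define m where "m = CARD('a) - 1"
  have m: "0 < m" using card_gt_1[where ?'a = 'a] by (simp add: m_def)
  have e: "act (mat2 a b 0 0) (big_X ^ i * big_Y ^ j) = cst (a ^ (m * i)) * cst (b ^ (m * j)) * big_X ^ (i + j)" for a b :: 'a
  proof -
    have "act (mat2 a b 0 0) var_x = cst a * var_x" "act (mat2 a b 0 0) var_y = cst b * var_x"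
      by (simp_all add: act_x act_y cst_simps)
    then show ?thesis
      by (simp only: big_X_def big_Y_def m_def act_mult act_power cst_power power_mult power_mult_distrib power_add)
        (simp only: mult_ac)
  qed
  have "act 0 (big_X ^ i * big_Y ^ j) = (0 :: 'a bipoly)"
    using card_gt_1[where ?'a = 'a] assms
    by (simp add: big_X_def big_Y_def act_mult act_power act_x act_y cst_simps power_0_left)
  moreover have "(\<Sum>(a, b)\<in>UNIV. act (mat2 a b 0 0) (big_X ^ i * big_Y ^ j)) =
      cst (\<Sum>a\<in>UNIV. a ^ (m * i)) * cst (\<Sum>b\<in>UNIV. b ^ (m * j)) * (big_X ^ (i + j) :: 'a bipoly)"
    unfolding e by (rule sum_cst_product)
  ultimately show ?thesis
    using m assms unfolding row_sum_eq sum_powers m_def[symmetric] by (simp add: cst_simps)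
qed

section \<open>Restriction of invariants to a line\<close>

text \<open>These matrices substitute a x for y, so vanishing under them says that the outer
  polynomial has the root a x.\<close>

lemma act_row: "act (mat2 1 a 0 0) f = [:poly f [:0, a:]:]"
proof (induction f rule: bipoly_induct)
  case y
  show ?case by (simp add: act_y cst_simps) (simp add: cst_def var_x_def var_y_def)
next
  case x
  show ?case by (simp add: act_x cst_simps) (simp add: var_x_def)
next
  case (cst c)
  show ?case by (simp add: act_cst) (simp add: cst_def)
qed (simp_all add: act_add act_mult)

lemma restr_eq: "restr f = [:coeff f 0:]"
  by (simp add: restr_def act_row poly_0_coeff_0)

lemma act_const: 
  "act (mat2 a b 0 d) [:p:] = [:pcompose p [:0, a:]:]"
proof (induction p)
  case 0
  show ?case by (simp add: act_0)
next
  case (pCons c p)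
  have "[:pCons c p:] = cst c + var_x * [:p:]" by (simp add: cst_def var_x_def)
  then have "act (mat2 a b 0 d) [:pCons c p:] = cst c + cst a * var_x * [:pcompose p [:0, a:]:]"
    by (simp only: act_add act_mult act_cst act_x pCons.IH) (simp add: cst_simps)
  then show ?case by (simp add: cst_def var_x_def pcompose_pCons)
qed

section \<open>Divisibility by the orbit product of y\<close>

lemma prod_linear_dvd:
  fixes f :: "'b::idom poly"
  assumes "finite A" "\<And>a. a \<in> A \<Longrightarrow> poly f a = 0"
  shows "(\<Prod>a\<in>A. [:- a, 1:]) dvd f"
  using assms
proof (induction A arbitrary: f rule: finite_induct)
  case (insert a A)
  then have "[:- a, 1:] dvd f" by (simp add: poly_eq_0_iff_dvd)
  then obtain g where g: "f = [:- a, 1:] * g" by (rule dvdE)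
  have "poly g b = 0" if "b \<in> A" for b
    using insert.prems[of b] insert.hyps that by (auto simp: g)
  then show ?case using insert.IH[of g] insert.hyps by (simp add: g mult_dvd_mono del: mult_pCons_left)
qed simp

text \<open>The product of the forms y - a x over all a in the field, that is, of the shear
  translates of y.\<close>

definition orbit_poly :: "'a::finite_field bipoly" where
  "orbit_poly = var_y * (big_Y - big_X)"

lemma orbit_poly_eq: "orbit_poly = var_y ^ CARD('a) - var_x ^ (CARD('a) - 1) * (var_y :: 'a::finite_field bipoly)"
proof -
  have "var_y ^ CARD('a) = (var_y * var_y ^ (CARD('a) - 1) :: 'a bipoly)"
    using card_gt_1[where ?'a = 'a] by (simp flip: power_Suc)
  then show ?thesis by (simp add: orbit_poly_def big_X_def big_Y_def algebra_simps)
qed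

lemma orbit_poly_monic:
  "degree (orbit_poly :: 'a::finite_field bipoly) = CARD('a)" "lead_coeff (orbit_poly :: 'a bipoly) = 1"
proof -
  have e: "(orbit_poly :: 'a bipoly) = monom 1 CARD('a) - monom (monom 1 (CARD('a) - 1)) 1" (is "_ = ?f")
    using monom_bipoly[of "1 :: 'a" "CARD('a) - 1" 1] monom_bipoly[of "1 :: 'a" 0 "CARD('a)"]
    by (simp add: orbit_poly_eq cst_simps)
  have "degree ?f = CARD('a)" "lead_coeff ?f = 1"
  proof -
    have "degree (monom (monom 1 (CARD('a) - 1)) 1 :: 'a bipoly) < degree (monom 1 CARD('a) :: 'a bipoly)"
      using card_gt_1[where ?'a = 'a] by (intro le_less_trans[OF degree_monom_le]) (simp add: degree_monom_eq)
    then show "degree ?f = CARD('a)"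
      using degree_add_eq_left[of "- monom (monom 1 (CARD('a) - 1)) 1" "monom 1 CARD('a) :: 'a bipoly"]
      by (simp add: degree_monom_eq)
    then show "lead_coeff ?f = 1" using card_gt_1[where ?'a = 'a] by simp
  qed
  then show "degree (orbit_poly :: 'a bipoly) = CARD('a)" "lead_coeff (orbit_poly :: 'a bipoly) = 1"
    by (simp_all add: e)
qed

text \<open>Each a x is a root of the left side, and both sides are monic of degree q in y.\<close>

lemma orbit_poly_prod: "orbit_poly = (\<Prod>a\<in>UNIV. [:- [:0, a:], 1:] :: 'a::finite_field bipoly)"
proof -
  let ?A = "(\<lambda>a::'a. [:0, a:]) ` UNIV"
  have inj: "inj (\<lambda>a::'a. [:0, a:])" by (auto simp: inj_on_def)
  have "poly orbit_poly [:0, a:] = 0" for a :: 'a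
  proof -
    have "act (mat2 1 a 0 0) (orbit_poly :: 'a bipoly) = 0"
      by (simp add: orbit_poly_eq act_diff act_mult act_power act_x act_y cst_simps power_mult_distrib
            finite_field_power_card_eq_same flip: cst_power)
         (use card_gt_1[where ?'a = 'a] in \<open>simp add: mult_ac flip: power_Suc\<close>)
    then show ?thesis by (simp add: act_row)
  qed
  then have "(\<Prod>c\<in>?A. [:- c, 1:]) dvd (orbit_poly :: 'a bipoly)"
    by (intro prod_linear_dvd) auto
  then have "(\<Prod>a\<in>UNIV. [:- [:0, a:], 1:]) dvd (orbit_poly :: 'a bipoly)"
    by (simp add: prod.reindex[OF inj])
  then obtain g where g: "(orbit_poly :: 'a bipoly) = (\<Prod>a\<in>UNIV. [:- [:0, a:], 1:]) * g" by blast
  have lin: "degree (\<Prod>a\<in>(UNIV :: 'a set). [:- [:0, a:], 1:]) = CARD('a)"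
    by (subst degree_prod_eq_sum_degree) auto
  have "lead_coeff (\<Prod>a\<in>(UNIV :: 'a set). [:- [:0, a:], 1:]) = 1"
    by (simp add: lead_coeff_prod)
  then have "lead_coeff g = 1"
    using orbit_poly_monic(2)[where ?'a = 'a] unfolding g by (simp only: lead_coeff_mult mult_1)
  moreover from this have "g \<noteq> 0" by auto
  have "(\<Prod>a\<in>(UNIV :: 'a set). [:- [:0, a:], 1:]) \<noteq> 0" by simp
  then have "degree g = 0"
    using orbit_poly_monic(1)[where ?'a = 'a] \<open>g \<noteq> 0\<close> lin unfolding g by (subst (asm) degree_mult_eq) auto
  ultimately have "g = 1" by (metis degree_eq_zeroE lead_coeff_pCons(2) one_pCons coeff_pCons_0)
  then show ?thesis by (simp add: g)
qed

lemma orbit_poly_dvd: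
  fixes f :: "'a::finite_field bipoly"
  assumes "\<And>a. act (mat2 1 a 0 0) f = 0"
  shows "orbit_poly dvd f"
proof -
  have inj: "inj (\<lambda>a::'a. [:0, a:])" by (auto simp: inj_on_def)
  have "(\<Prod>c\<in>(\<lambda>a::'a. [:0, a:]) ` UNIV. [:- c, 1:]) dvd f"
    using assms by (intro prod_linear_dvd) (auto simp: act_row)
  then show ?thesis by (simp add: prod.reindex[OF inj] orbit_poly_prod)
qed

lemma orbit_poly_neq_0: "orbit_poly \<noteq> (0 :: 'a::finite_field bipoly)"
  using orbit_poly_monic(2)[where ?'a = 'a] by auto

lemma act_orbit_poly: "act (mat2 1 a 0 1) orbit_poly = (orbit_poly :: 'a::finite_field bipoly)"
proof -
  have e: "var_x ^ (CARD('a) - 1) * var_x = (var_x ^ CARD('a) :: 'a bipoly)"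
    using card_gt_1[where ?'a = 'a] by (simp flip: power_Suc2)
  have "act (mat2 1 a 0 1) orbit_poly = 
      (cst a * var_x + cst 1 * var_y) ^ CARD('a) - var_x ^ (CARD('a) - 1) * (cst a * var_x + cst 1 * var_y :: 'a bipoly)"
    by (simp add: orbit_poly_eq act_diff act_mult act_power act_x act_y cst_simps)
  also have "\<dots> = cst a * var_x ^ CARD('a) + var_y ^ CARD('a) - var_x ^ (CARD('a) - 1) * var_x * cst a - var_x ^ (CARD('a) - 1) * var_y"
    unfolding power_card_lin by (simp add: cst_simps algebra_simps)
  also have "\<dots> = orbit_poly" unfolding e by (simp add: orbit_poly_eq algebra_simps)
  finally show ?thesis .
qed

text \<open>A polynomial fixed by all shears restricts on the line \<open>x = 0\<close> to a polynomial in \<open>y\<^sup>q\<close>: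
  \<open>f - f(x,0)\<close> is divisible by the orbit product of \<open>y\<close>, with a shear-invariant quotient.\<close>

lemma shear_invariant_coeff:
  fixes f :: "'a::finite_field bipoly"
  assumes "\<And>a. act (mat2 1 a 0 1) f = f" "coeff (coeff f n) 0 \<noteq> 0"
  shows "CARD('a) dvd n"
  using assms
proof (induction "degree f" arbitrary: f n rule: less_induct)
  case less
  define q where "q = CARD('a)"
  have q: "1 < q" using card_gt_1 by (simp add: q_def)
  define h where "h = f - [:coeff f 0:]"
  \<comment> \<open>By shear invariance f restricts to every line y = a x as it does to y = 0, so h
    vanishes on all of them.\<close>
  have "act (mat2 1 a 0 0) f = [:coeff f 0:]" for a
  proof -
    have "act (mat2 1 a 0 0) f = restr (act (mat2 1 a 0 1) f)"
      by (simp add: restr_def act_act)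
        (rule arg_cong[where f = "\<lambda>g. act g f"], simp add: vec_eq_iff forall_2 matrix_matrix_mult_def sum_2)
    then show ?thesis by (simp add: less.prems restr_eq)
  qed
  then have "act (mat2 1 a 0 0) h = 0" for a
    by (simp add: h_def act_diff) (simp add: act_row)
  then obtain g where g: "h = orbit_poly * g" using orbit_poly_dvd[of h] by blast
  have f: "f = [:coeff f 0:] + (var_y ^ q - var_x ^ (q - 1) * var_y) * g"
    using g by (simp add: h_def orbit_poly_eq q_def algebra_simps)
  show ?case
  proof (cases "n = 0 \<or> g = 0")
    case True
    moreover have "n = 0" if "g = 0"
    proof (rule ccontr)
      assume "n \<noteq> 0"
      moreover have "f = [:coeff f 0:]" using f that by simp
      ultimately have "coeff f n = 0" by (metis coeff_pCons_Suc coeff_0 not0_implies_Suc)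
      then show False using less.prems(2) by simp
    qed
    ultimately show ?thesis by auto
  next
    case False
    have "act (mat2 1 a 0 1) h = h" for a
      by (simp add: h_def act_diff less.prems act_const pcompose_idR)
    then have inv: "act (mat2 1 a 0 1) g = g" for a
      using orbit_poly_neq_0[where ?'a = 'a] by (simp add: g act_mult act_orbit_poly)
    have "degree h = q + degree g"
      using False orbit_poly_neq_0[where ?'a = 'a] by (simp add: g degree_mult_eq orbit_poly_monic q_def)
    moreover have "degree h \<le> degree f"
      unfolding h_def by (rule degree_diff_le) simp_all
    ultimately have deg: "degree g < degree f" using q by linarith
    have y: "var_y ^ q * g = monom 1 q * g" for q :: nat and g :: "'a bipoly"
      using monom_bipoly[of "1 :: 'a" 0 q] by (simp add: cst_simps)
    have x: "var_x ^ (q - 1) * var_y * g = monom (monom 1 (q - 1)) 1 * g"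
      using monom_bipoly[of "1 :: 'a" "q - 1" 1] by (simp add: cst_simps)
    \<comment> \<open>On the line x = 0 the subtracted part x^(q-1) y g disappears, so a power y^n
      with n > 0 comes from y^q g and the induction hypothesis applies to n - q.\<close>
    have "coeff (coeff (var_x ^ (q - 1) * var_y * g) n) 0 = 0"
      unfolding x using q by (simp add: coeff_monom_mult)
    then have c: "coeff (coeff f n) 0 = coeff (coeff (var_y ^ q * g) n) 0"
      using False by (subst f) (auto simp: left_diff_distrib coeff_pCons split: nat.splits)
    then have "q \<le> n" "coeff (coeff g (n - q)) 0 \<noteq> 0"
      using less.prems(2) unfolding y by (auto simp: coeff_monom_mult split: if_splits)
    then have "q dvd n - q" using less.hyps[OF deg inv] by (simp add: q_def)
    then show ?thesis using \<open>q \<le> n\<close> by (simp add: q_def dvd_minus_self)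
  qed
qed

lemma coeff_act_swap: "coeff (coeff (act (mat2 0 1 1 0) f) j) i = coeff (coeff f i) j"
proof (induction f arbitrary: i j rule: bipoly_induct)
  case (cst c)
  show ?case by (simp add: act_cst) (simp add: cst_def coeff_pCons split: nat.splits)
next
  case x
  show ?case by (simp add: act_x cst_simps) (simp add: var_x_def var_y_def coeff_pCons split: nat.splits)
next
  case y
  show ?case by (simp add: act_y cst_simps) (simp add: var_x_def var_y_def coeff_pCons split: nat.splits)
next
  case (mult f g)
  have "coeff (coeff (act (mat2 0 1 1 0) (f * g)) j) i = 
     (\<Sum>k\<le>j. \<Sum>l\<le>i. coeff (coeff f l) k * coeff (coeff g (i - l)) (j - k))"
    by (simp add: act_mult coeff_mult coeff_sum mult)
  also have "\<dots> = coeff (coeff (f * g) i) j"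
    by (subst sum.swap) (simp add: coeff_mult coeff_sum)
  finally show ?case .
qed (simp_all add: act_add)

text \<open>The swap turns f(x, 0) into f(0, y), where the shears force q to divide n; the torus
  forces q - 1 to divide n, and the two are coprime.\<close>

lemma invar_restr_coeff:
  assumes c: "coeff (coeff (Rep_invar (r :: 'a::finite_field invar)) 0) n \<noteq> 0"
  shows "CARD('a) * (CARD('a) - 1) dvd n"
proof -
  let ?f = "Rep_invar r"
  have inv: "act g ?f = ?f" if "invertible g" for g using Rep_invar[of r] that by simp
  have "coeff (coeff ?f n) 0 = coeff (coeff ?f 0) n"
    using coeff_act_swap[of ?f n 0] by (simp add: inv invertible_mat2)
  then have q: "CARD('a) dvd n"
    using c by (intro shear_invariant_coeff[of ?f]) (simp_all add: inv invertible_mat2)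
  have "CARD('a) - 1 dvd n"
  proof (rule ccontr)
    assume "\<not> CARD('a) - 1 dvd n"
    then obtain a :: 'a where a: "a \<noteq> 0" "a ^ n \<noteq> 1" by (rule power_neq_1_witness)
    have e: "mat2 1 0 0 0 ** mat2 a 0 0 1 = mat2 a 0 0 0 ** mat2 1 0 0 0"
      by (simp add: vec_eq_iff forall_2 matrix_matrix_mult_def sum_2)
    have "restr ?f = restr (act (mat2 a 0 0 1) ?f)" using a by (simp add: inv invertible_mat2)
    also have "\<dots> = act (mat2 a 0 0 0) (restr ?f)" by (simp only: restr_def act_act e)
    finally have "coeff ?f 0 = pcompose (coeff ?f 0) [:0, a:]" by (simp add: restr_eq act_const)
    then have "coeff (coeff ?f 0) n = a ^ n * coeff (coeff ?f 0) n" by (metis coeff_pcompose_linear)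
    then show False using a c by simp
  qed
  moreover have "coprime (CARD('a)) (CARD('a) - 1)"
    using card_gt_1[where ?'a = 'a] coprime_Suc_left_nat[of "CARD('a) - 1"] by simp
  ultimately show ?thesis using q by (simp add: divides_mult)
qed

section \<open>Semi-invariants and divisibility by D0\<close>

text \<open>Transformation by det^(-j), written without inverses. Since \<open>dickson_L\<close>
  transforms by det, dividing by it raises j by one.\<close>

definition semi_invariant :: "nat \<Rightarrow> 'a::comm_ring_1 bipoly \<Rightarrow> bool" where
  "semi_invariant j f \<longleftrightarrow> (\<forall>g. invertible g \<longrightarrow> cst (det g) ^ j * act g f = f)"

text \<open>The matrix \<open>mat2 1 0 0 a\<close> fixes the line y = 0 pointwise but has
  determinant a, so a^j times the restriction equals the restriction.\<close>

lemma semi_invariant_restr: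
  fixes f :: "'a::finite_field bipoly"
  assumes f: "semi_invariant j f" and j: "\<not> CARD('a) - 1 dvd j"
  shows "restr f = 0"
proof -
  obtain a :: 'a where a: "a \<noteq> 0" "a ^ j \<noteq> 1" using j by (rule power_neq_1_witness)
  have "cst a ^ j * act (mat2 1 0 0 a) f = f"
    using f a unfolding semi_invariant_def by (auto dest!: spec[of _ "mat2 1 0 0 a"] simp: invertible_mat2 det_2)
  then have "restr f = restr (cst (a ^ j) * act (mat2 1 0 0 a) f)" by (simp add: cst_power)
  also have "\<dots> = cst (a ^ j) * act (mat2 1 0 0 0 ** mat2 1 0 0 a) f"
    by (simp add: restr_def act_mult act_cst act_act)
  also have "mat2 1 0 0 0 ** mat2 1 0 0 a = mat2 1 0 0 0"
    by (simp add: vec_eq_iff forall_2 matrix_matrix_mult_def sum_2)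
  finally have "cst (a ^ j - 1) * restr f = 0" by (simp add: restr_def cst_simps algebra_simps)
  then show ?thesis using a by (simp add: cst_def)
qed

text \<open>Semi-invariance carries the vanishing on y = 0 to every line through the origin. The
  lines y = a x give the factor \<open>orbit_poly\<close>, the line x = 0 gives x, and their product
  is \<open>- dickson_L\<close>.\<close>

lemma semi_invariant_div:
  fixes f :: "'a::finite_field bipoly"
  assumes f: "semi_invariant j f" and r: "restr f = 0"
  obtains f' where "f = dickson_L * f'" "semi_invariant (Suc j) f'"
proof -
  have van: "restr (act g f) = 0" if "invertible g" for g
  proof -
    have "cst (det g) ^ j * restr (act g f) = restr (cst (det g) ^ j * act g f)"
      by (simp add: restr_def act_mult act_power act_cst)
    also have "\<dots> = 0" using f that r by (simp add: semi_invariant_def)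
    finally show ?thesis using that by (simp add: invertible_det_nz cst_def)
  qed
  have "act (mat2 1 a 0 0) f = restr (act (mat2 1 a 0 1) f)" for a
    by (simp add: restr_def act_act)
      (rule arg_cong[where f = "\<lambda>g. act g f"], simp add: vec_eq_iff forall_2 matrix_matrix_mult_def sum_2)
  then have "act (mat2 1 a 0 0) f = 0" for a using van by (simp add: invertible_mat2)
  then obtain g where g: "f = orbit_poly * g" using orbit_poly_dvd by blast
  let ?S = "mat2 0 1 1 0 :: 'a^2^2"
  have "act (mat2 1 0 0 0 ** ?S) f = 0"
    using van[of ?S] by (simp add: restr_def act_act invertible_mat2)
  \<comment> \<open>On x = 0 the orbit polynomial is y^q, written in x after the swap. It is
    nonzero, so the cofactor has to vanish there.\<close>
  moreover have "act (mat2 1 0 0 0 ** ?S) orbit_poly = (var_x ^ CARD('a) :: 'a bipoly)"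
    using card_gt_1[where ?'a = 'a]
    by (simp add: orbit_poly_eq act_diff act_mult act_power act_x act_y cst_simps
        matrix_matrix_mult_def sum_2)
  ultimately have "restr (act ?S g) = 0"
    by (simp add: g act_mult var_neq_0 restr_def act_act)
  then have "coeff (act ?S g) 0 = 0" by (simp add: restr_eq)
  then obtain k where k: "act ?S g = var_y * k"
    by (metis poly_0_coeff_0 poly_eq_0_iff_dvd dvdE minus_zero var_y_def)
  have "?S ** ?S = mat 1"
    by (simp add: vec_eq_iff forall_2 matrix_matrix_mult_def sum_2 mat_def)
  have "act (mat 1) g = g"
    by (induction g rule: bipoly_induct) (simp_all add: act_cst act_x act_y act_add act_mult mat_def cst_simps)
  then have "g = act ?S (act ?S g)" using \<open>?S ** ?S = mat 1\<close> by (simp add: act_act)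
  also have "\<dots> = var_x * act ?S k" by (simp only: k act_mult act_swap)
  finally have g_eq: "g = var_x * act ?S k" .
  then have fL: "f = dickson_L * (- act ?S k)"
    unfolding g by (subst g_eq) (simp add: dickson_L_eq orbit_poly_def algebra_simps)
  define f' where "f' = - act ?S k"
  have "semi_invariant (Suc j) f'"
    unfolding semi_invariant_def
  proof (intro allI impI)
    fix g :: "'a^2^2" assume "invertible g"
    then have "cst (det g) ^ j * act g f = f" using f by (simp add: semi_invariant_def)
    then have "dickson_L * (cst (det g) ^ Suc j * act g f') = dickson_L * f'"
      by (simp add: fL act_mult act_dickson_L mult_ac flip: f'_def)
    then show "cst (det g) ^ Suc j * act g f' = f'"
      using dickson_L_neq_0[where ?'a = 'a] by (metis mult_left_cancel)
  qed
  then show thesis using that[of f'] fL by (simp add: f'_def)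
qed

text \<open>Divide by \<open>dickson_L\<close> q - 1 times. The first division uses the assumption;
  at stage n with 0 < n < q - 1 the restriction vanishes by itself, by
  \<open>semi_invariant_restr\<close>. The final quotient is invariant because det^(q-1) =
  1.\<close>

lemma invar_restr_eq_0:
  assumes "restr (Rep_invar r) = 0"
  shows "D0 dvd (r :: 'a::finite_field invar)"
proof -
  define m where "m = CARD('a) - 1"
  have "\<exists>f. Rep_invar r = dickson_L ^ n * f \<and> semi_invariant n f" if "n \<le> m" for n
    using that
  proof (induction n)
    case 0
    show ?case using Rep_invar[of r] by (simp add: semi_invariant_def)
  next
    case (Suc n)
    then obtain f where f: "Rep_invar r = dickson_L ^ n * f" "semi_invariant n f" by auto
    have "restr f = 0"
    proof (cases "n = 0")
      case True
      then show ?thesis using assms f by simp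
    next
      case False
      then have "\<not> m dvd n" using Suc.prems by (auto dest: dvd_imp_le)
      then show ?thesis using f(2) semi_invariant_restr by (simp add: m_def)
    qed
    with f(2) obtain f' where "f = dickson_L * f'" "semi_invariant (Suc n) f'" by (rule semi_invariant_div)
    then show ?case using f(1) by (auto simp: mult_ac)
  qed
  then obtain f where f: "Rep_invar r = dickson_L ^ m * f" "semi_invariant m f" by blast
  have "act g f = f" if "invertible g" for g
  proof -
    have "cst (det g) ^ m = 1"
      using that finite_field_power_minus_1[of "det g"] unfolding m_def
      by (metis cst_power cst_simps(2) invertible_det_nz)
    then show ?thesis using f(2) that unfolding semi_invariant_def by (metis mult_1)
  qed
  then have "Rep_invar (Abs_invar f) = f" by (simp add: Abs_invar_inverse)
  then have "Rep_invar r = Rep_invar (D0 * Abs_invar f)"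
    by (simp add: times_invar.rep_eq D0.rep_eq dickson_0_eq f(1) m_def)
  then show ?thesis by (simp add: Rep_invar_inject)
qed

section \<open>Independence of the generators\<close>

lemma big_X_power: "big_X ^ k = [:monom 1 ((CARD('a) - 1) * k) :: 'a::finite_field poly:]"
  using monom_bipoly[of "1 :: 'a" "(CARD('a) - 1) * k" 0]
  by (simp add: big_X_def cst_simps monom_0 flip: power_mult)

lemma restr_1: "restr 1 = 1"
  by (simp add: restr_def act_1)

lemma restr_dickson:
  "restr dickson_0 = (0 :: 'a::finite_field bipoly)"
  "restr dickson_1 = (big_X ^ CARD('a) :: 'a::finite_field bipoly)"
proof -
  have 0: "CARD('a) - 1 \<noteq> 0" using card_gt_1[where ?'a = 'a] by simp
  have b: "restr big_X = (big_X :: 'a bipoly)" "restr big_Y = (0 :: 'a bipoly)"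
    using 0 by (simp_all add: restr_def big_X_def big_Y_def act_power act_x act_y cst_simps)
  then have p: "act (mat2 1 0 0 0) (big_X ^ i * big_Y ^ j) = (if j = 0 then big_X ^ i else 0 :: 'a bipoly)" for i j
    by (simp add: restr_def act_mult act_power)
  show "restr dickson_0 = (0 :: 'a bipoly)"
    unfolding dickson_0_def restr_def act_sum p by (intro sum.neutral) auto
  have "{0..CARD('a)} = insert CARD('a) {0..<CARD('a)}" by auto
  then show "restr dickson_1 = (big_X ^ CARD('a) :: 'a bipoly)"
    unfolding dickson_1_def restr_def act_sum p by simp
qed

lemma restr_eq_0_of_D0_dvd:
  assumes "D0 dvd (r :: 'a::finite_field invar)"
  shows "restr (Rep_invar r) = 0"
proof -
  obtain s where "r = D0 * s" using assms by blast
  then show ?thesis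
    using restr_dickson(1)[where ?'a = 'a]
    by (simp add: times_invar.rep_eq D0.rep_eq restr_def act_mult)
qed

lemma D0_not_dvd_1: "\<not> D0 dvd (1 :: 'a::finite_field invar)"
  using restr_eq_0_of_D0_dvd[of "1 :: 'a invar"] by (auto simp: one_invar.rep_eq restr_1)

lemma gl_trace_mon_eq_0:
  assumes "r \<odot> mon CARD('a) 1 = (0 :: 'a::finite_field cofixed)"
  shows "r = 0"
proof -
  have "Rep_invar r * (big_X ^ CARD('a) * big_Y) \<in> coinv_kernel"
    using assms by (simp add: mon_def scale_cof cof_eq_0_iff)
  then have "Rep_invar r * dickson_0 = 0"
    using gl_trace_coinv_kernel by (metis gl_trace_mult_invar gl_trace_top)
  then have "Rep_invar r = 0"
    using dickson_L_neq_0[where ?'a = 'a] by (simp add: dickson_0_eq)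
  then show ?thesis by (metis Rep_invar_inject zero_invar.rep_eq)
qed

text \<open>In units of \<open>q - 1\<close>, the degrees of the generators \<open>N2_gen i\<close> are distinct modulo \<open>q\<close>, while
  the invariants restrict to polynomials in \<open>x\<^sup>q\<^sup>(\<^sup>q\<^sup>-\<^sup>1\<^sup>)\<close>, so no cancellation is possible.\<close>

lemma generators_independent:
  assumes 0: "r \<odot> mon CARD('a) 1 + (\<Sum>i<CARD('a) - 1. s i \<odot> N2_gen i) = (0 :: 'a::finite_field cofixed)"
  shows "r = 0" and "\<And>i. i < CARD('a) - 1 \<Longrightarrow> D0 dvd s i"
proof -
  define q where "q = CARD('a)"
  define m where "m = q - 1"
  have q: "q = Suc m" and m: "0 < m" using card_gt_1[where ?'a = 'a] by (simp_all add: q_def m_def)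
  \<comment> \<open>Multiplying by \<open>D0\<close> removes the torsion generators and leaves
    \<open>D0 * r\<close> acting on the top one, which the trace detects.\<close>
  have "D0 \<odot> (\<Sum>i<m. s i \<odot> N2_gen i) = (0 :: 'a cofixed)"
    unfolding SG.scale_sum_right
  proof (rule sum.neutral, intro ballI)
    fix i assume "i \<in> {..<m}"
    then have "D0 \<odot> N2_gen i = (0 :: 'a cofixed)" by (intro D0_N2_gen) (simp add: m_def q_def)
    then show "D0 \<odot> s i \<odot> N2_gen i = (0 :: 'a cofixed)"
      by (metis SG.scale_scale SG.scale_zero_right mult.commute)
  qed
  moreover have "D0 \<odot> (r \<odot> mon q 1 + (\<Sum>i<m. s i \<odot> N2_gen i)) = (0 :: 'a cofixed)"
    using 0 by (simp add: q_def m_def)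
  ultimately have "(D0 * r) \<odot> mon CARD('a) 1 = (0 :: 'a cofixed)"
    by (simp add: SG.scale_right_distrib q_def)
  then have "D0 * r = 0" by (rule gl_trace_mon_eq_0)
  then have "dickson_0 * Rep_invar r = 0" by (metis D0.rep_eq times_invar.rep_eq zero_invar.rep_eq)
  then have "Rep_invar r = 0"
    using dickson_L_neq_0[where ?'a = 'a] by (simp add: dickson_0_eq)
  then show r: "r = 0" by (metis Rep_invar_inject zero_invar.rep_eq)
  define b :: "nat \<Rightarrow> 'a bipoly" where "b = (\<lambda>i. if i = 0 then 1 else big_X ^ i * big_Y)"
  \<comment> \<open>Row sums of the generators are signed powers of X: \<open>d i\<close> is the
    exponent, \<open>e i\<close> the sign. The value 1 is skipped since there is no generator Y; the
    exponents for i < m are distinct and less than q.\<close>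
  define d where "d = (\<lambda>i :: nat. if i = 0 then 0 else Suc i)"
  define e :: "nat \<Rightarrow> 'a" where "e = (\<lambda>i. if i = 0 then - 1 else 1)"
  define p where "p = (\<lambda>i. coeff (Rep_invar (s i)) 0)"
  have b: "row_sum (b i) = [:monom (e i) (m * d i):]" for i
    using row_sum_monomial[of i 1, where ?'a = 'a] row_sum_1[where ?'a = 'a]
    by (simp add: b_def d_def e_def big_X_power monom_0 q_def m_def del: power_Suc mult_Suc_right)
       (simp add: one_pCons)
  have "cof (\<Sum>i<m. Rep_invar (s i) * b i) = 0"
  proof -
    have "(\<Sum>i<m. s i \<odot> N2_gen i) = (0 :: 'a cofixed)" using 0 r by (simp add: m_def q_def)
    moreover have "N2_gen i = cof (b i)" for i by (simp add: N2_gen_def b_def)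
    ultimately show ?thesis by (simp add: cof_sum scale_cof)
  qed
  then have "row_sum (\<Sum>i<m. Rep_invar (s i) * b i) = 0"
    using row_sum_coinv_kernel by (simp add: cof_eq_0_iff)
  moreover have "row_sum (sum f A) = (\<Sum>i\<in>A. row_sum (f i))" for f :: "nat \<Rightarrow> 'a bipoly" and A
    unfolding row_sum_def act_sum by (rule sum.swap)
  ultimately have "(\<Sum>i<m. restr (Rep_invar (s i)) * row_sum (b i)) = 0"
    by (simp add: row_sum_mult_invar)
  then have "(\<Sum>i<m. [:p i * monom (e i) (m * d i):]) = 0"
    by (simp add: restr_eq b p_def mult.commute)
  then have "[:\<Sum>i<m. p i * monom (e i) (m * d i):] = 0" 
  proof -
    have "(\<Sum>i<m. [:g i:]) = [:\<Sum>i<m. g i:]" for g :: "nat \<Rightarrow> 'a poly"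
      by (induction m) simp_all
    then show "(\<Sum>i<m. [:p i * monom (e i) (m * d i):]) = 0 \<Longrightarrow> ?thesis" by simp
  qed
  then have sum0: "(\<Sum>i<m. monom (e i) (m * d i) * p i) = 0" by (simp add: mult.commute)
  show "D0 dvd s j" if "j < CARD('a) - 1" for j
  proof (rule invar_restr_eq_0, unfold restr_eq, rule ccontr)
    assume "[:coeff (Rep_invar (s j)) 0:] \<noteq> 0"
    then have "p j \<noteq> 0" by (simp add: p_def)
    then obtain n where n: "coeff (p j) n \<noteq> 0" by (auto simp: poly_eq_iff)
    have jm: "j < m" using that by (simp add: m_def q_def)
    have dv: "q * m dvd k" if "coeff (p i) k \<noteq> 0" for i k
      using invar_restr_coeff[of "s i" k] that by (simp add: p_def q_def m_def)
    have z: "coeff (monom (e i) (m * d i) * p i) (n + m * d j) = 0" if i: "i < m" "i \<noteq> j" for i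
    proof (rule ccontr)
      assume "coeff (monom (e i) (m * d i) * p i) (n + m * d j) \<noteq> 0"
      then have le: "m * d i \<le> n + m * d j" and "coeff (p i) (n + m * d j - m * d i) \<noteq> 0"
        by (auto simp: coeff_monom_mult split: if_splits)
      then obtain k l where "n + m * d j - m * d i = q * m * k" "n = q * m * l"
        using dv n by (meson dvdE)
      then have "m * (q * l + d j) = m * (q * k + d i)" using le by (simp add: algebra_simps)
      then have "q * l + d j = q * k + d i" using m by simp
      then have "d j mod q = d i mod q" by (metis mod_mult_self4)
      moreover have "d j < q" "d i < q" using i jm by (auto simp: d_def q)
      ultimately have "d j = d i" by simp
      then show False using i by (auto simp: d_def split: if_splits)
    qed
    have "0 = (\<Sum>i<m. coeff (monom (e i) (m * d i) * p i) (n + m * d j))"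
      using arg_cong[OF sum0, of "\<lambda>f. coeff f (n + m * d j)"] by (simp add: coeff_sum)
    also have "\<dots> = coeff (monom (e j) (m * d j) * p j) (n + m * d j)"
      using jm z by (subst sum.remove[of _ j]) auto
    also have "\<dots> = e j * coeff (p j) n" by (simp add: coeff_monom_mult)
    finally show False using n by (auto simp: e_def split: if_splits)
  qed
qed

section \<open>Coordinates in a direct sum of copies of the quotient\<close>

lemma span_image_sum:
  assumes "finite I" "v \<in> SG.span (e ` I)"
  shows "\<exists>s. v = (\<Sum>i\<in>I. s i \<odot> (e i :: 'a::finite_field cofixed))"
  using assms
proof (induction I arbitrary: v rule: finite_induct)
  case (insert j I)
  then obtain k where "v - k \<odot> e j \<in> SG.span (e ` I)" by (auto simp: SG.span_insert)
  then obtain s where s: "v - k \<odot> e j = (\<Sum>i\<in>I. s i \<odot> e i)" using insert.IH by blast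
  have "v = k \<odot> e j + (\<Sum>i\<in>I. s i \<odot> e i)" using s by (simp add: algebra_simps)
  also have "\<dots> = (\<Sum>i\<in>insert j I. (s(j := k)) i \<odot> e i)"
    using insert.hyps by (auto intro!: sum.cong)
  finally show ?case by blast
qed simp

lemma rep_dquot_scale:
  assumes "D0 \<odot> v = (0 :: 'a::finite_field cofixed)" "abs_dquot r = abs_dquot s"
  shows "r \<odot> v = s \<odot> v"
proof -
  obtain t where "r - s = D0 * t"
    using assms(2) by (auto simp: dquot.abs_eq_iff D0_rel_def)
  then have "(r - s) \<odot> v = t \<odot> D0 \<odot> v" by (simp add: mult.commute)
  then show ?thesis by (simp add: assms(1) SG.scale_left_diff_distrib)
qed

text \<open>The isomorphism multiplies by arbitrarily chosen representatives. As \<open>D0\<close>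
  kills each e i, the choice does not matter, which gives linearity; independence modulo
  \<open>D0\<close> gives injectivity.\<close>

lemma dquot_basisI:
  fixes e :: "nat \<Rightarrow> 'a::finite_field cofixed"
  assumes tors: "\<And>i. i < n \<Longrightarrow> D0 \<odot> e i = 0"
    and indep: "\<And>s i. (\<Sum>i<n. s i \<odot> e i) = 0 \<Longrightarrow> i < n \<Longrightarrow> D0 dvd s i"
  shows "dquot_basis n e (SG.span (e ` {..<n}))"
proof -
  define \<phi> where "\<phi> = (\<lambda>h. \<Sum>i<n. rep_dquot (h i) \<odot> e i)"
  have ar: "abs_dquot (rep_dquot x) = x" for x :: "'a dquot"
    by (rule Quotient_abs_rep[OF Quotient_dquot])
  have "bij_betw \<phi> (dquot_copies n) (SG.span (e ` {..<n}))"
    unfolding bij_betw_def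
  proof
    show "inj_on \<phi> (dquot_copies n)"
    proof (rule inj_onI)
      fix h k assume hk: "h \<in> dquot_copies n" "k \<in> dquot_copies n" "\<phi> h = \<phi> k"
      then have "(\<Sum>i<n. (rep_dquot (h i) - rep_dquot (k i)) \<odot> e i) = 0"
        by (simp add: \<phi>_def SG.scale_left_diff_distrib sum_subtractf)
      then have "abs_dquot (rep_dquot (h i)) = abs_dquot (rep_dquot (k i))" if "i < n" for i
        using indep[of "\<lambda>i. rep_dquot (h i) - rep_dquot (k i)" i] that
        by (simp only: dquot.abs_eq_iff D0_rel_def)
      then have "h i = k i" for i
        using hk by (cases "i < n") (simp_all add: ar dquot_copies_def)
      then show "h = k" by blast
    qed
    show "\<phi> ` dquot_copies n = SG.span (e ` {..<n})"
    proof
      show "\<phi> ` dquot_copies n \<subseteq> SG.span (e ` {..<n})"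
        unfolding \<phi>_def by (intro image_subsetI SG.span_sum SG.span_scale SG.span_base) auto
      show "SG.span (e ` {..<n}) \<subseteq> \<phi> ` dquot_copies n"
      proof
        fix v assume "v \<in> SG.span (e ` {..<n})"
        then obtain s where s: "v = (\<Sum>i<n. s i \<odot> e i)" using span_image_sum by blast
        define h where "h = (\<lambda>i. if i < n then abs_dquot (s i) else 0)"
        have "v = \<phi> h"
          unfolding s \<phi>_def by (rule sum.cong) (auto simp: h_def ar intro!: rep_dquot_scale tors)
        moreover have "h \<in> dquot_copies n" by (simp add: h_def dquot_copies_def)
        ultimately show "v \<in> \<phi> ` dquot_copies n" by blast
      qed
    qed
  qed
  moreover have "\<phi> (\<lambda>i. h i + k i) = \<phi> h + \<phi> k" for h k
    unfolding \<phi>_def sum.distrib[symmetric] SG.scale_left_distrib[symmetric]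
    by (intro sum.cong rep_dquot_scale tors) (auto simp: ar simp flip: plus_dquot.abs_eq)
  moreover have "\<phi> (\<lambda>i. r \<otimes> h i) = r \<odot> \<phi> h" for r h
    unfolding \<phi>_def SG.scale_sum_right SG.scale_scale
    by (intro sum.cong rep_dquot_scale tors) (auto simp: ar simp flip: dquot_scale.abs_eq)
  moreover have "\<phi> (\<lambda>j. if j = i then dquot_one else 0) = e i" if "i < n" for i
  proof -
    have "\<phi> (\<lambda>j. if j = i then dquot_one else 0) = (\<Sum>j<n. (if j = i then 1 else 0) \<odot> e j)"
      unfolding \<phi>_def
      by (intro sum.cong rep_dquot_scale tors) (auto simp: ar dquot_one_def zero_dquot_def)
    also have "\<dots> = (\<Sum>j<n. if j = i then e j else 0)" by (rule sum.cong) auto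
    finally show ?thesis using that by simp
  qed
  ultimately show ?thesis unfolding dquot_basis_def by blast
qed

text \<open>An element of F[D1] is P(D1), and its restriction is P(x^(q(q-1))), which vanishes only
  for P = 0. Combined with divisibility by \<open>D0\<close> this gives freeness over F[D1].\<close>

lemma adjoin_D1_restr:
  assumes "r \<in> adjoin {D1}" "restr (Rep_invar r) = 0"
  shows "r = (0 :: 'a::finite_field invar)"
proof -
  have "\<exists>P. Rep_invar r = poly (map_poly cst P) dickson_1" if "r \<in> adjoin {D1}" for r :: "'a invar"
    using that
  proof (induction rule: adjoin.induct)
    case (1 c)
    have "Rep_invar (invar_cst c) = poly (map_poly cst [:c:]) dickson_1"
      by (simp add: invar_cst.rep_eq map_poly_pCons cst_simps)
    then show ?case by blast
  next
    case (2 a)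
    have "Rep_invar a = poly (map_poly cst [:0, 1:]) dickson_1"
      using 2 by (simp add: D1.rep_eq map_poly_pCons cst_simps)
    then show ?case by blast
  next
    case (3 r s)
    then obtain P Q where "Rep_invar r = poly (map_poly cst P) dickson_1" "Rep_invar s = poly (map_poly cst Q) dickson_1"
      by blast
    then have "Rep_invar (r + s) = poly (map_poly cst (P + Q)) dickson_1"
      by (simp add: plus_invar.rep_eq poly_map_poly_add cst_simps)
    then show ?case by blast
  next
    case (4 r s)
    then obtain P Q where "Rep_invar r = poly (map_poly cst P) dickson_1" "Rep_invar s = poly (map_poly cst Q) dickson_1"
      by blast
    then have "Rep_invar (r * s) = poly (map_poly cst (P * Q)) dickson_1"
      by (simp add: times_invar.rep_eq poly_map_poly_mult cst_simps)
    then show ?case by blast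
  qed
  then obtain P where P: "Rep_invar r = poly (map_poly cst P) dickson_1" using assms(1) by blast
  define N where "N = (CARD('a) - 1) * CARD('a)"
  have "0 < N" using card_gt_1[where ?'a = 'a] by (simp add: N_def)
  have "restr (poly (map_poly cst P) dickson_1) = [:pcompose P (monom 1 N):]"
  proof (induction P)
    case 0
    show ?case by (simp add: restr_def act_0)
  next
    case (pCons c P)
    have "restr (poly (map_poly cst (pCons c P)) dickson_1) = 
        cst c + restr dickson_1 * restr (poly (map_poly cst P) dickson_1)"
      by (simp add: map_poly_pCons cst_simps restr_def act_add act_mult act_cst)
    then show ?case
      by (simp only: pCons.IH restr_dickson big_X_power N_def pcompose_pCons)
        (simp add: cst_def)
  qed
  then have "pcompose P (monom 1 N) = 0" using assms(2) P by simp
  then have "P = 0"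
    using pcompose_eq_0[of P "monom 1 N"] \<open>0 < N\<close> by (simp add: degree_monom_eq)
  then have "Rep_invar r = 0" using P by simp
  then show ?thesis by (metis Rep_invar_inject zero_invar.rep_eq)
qed

section \<open>The Hilbert series\<close>

definition gen_deg :: "nat \<Rightarrow> nat \<Rightarrow> nat" where
  "gen_deg q i = (if i = 0 then 0 else (i + 1) * (q - 1))"

text \<open>The a for which some D0^a D1^b X^q Y has degree d; b is then determined. The 1 in a + 1
  accounts for X^q Y, whose degree equals that of \<open>D0\<close>.\<close>

definition top_index :: "nat \<Rightarrow> nat \<Rightarrow> nat set" where
  "top_index q d = {a. (a + 1) * (q\<^sup>2 - 1) \<le> d \<and> q\<^sup>2 - q dvd d - (a + 1) * (q\<^sup>2 - 1)}"

definition gen_index :: "nat \<Rightarrow> nat \<Rightarrow> nat set" where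
  "gen_index q d = {i. i < q - 1 \<and> gen_deg q i \<le> d \<and> q\<^sup>2 - q dvd d - gen_deg q i}"

definition basis_vec :: "nat \<Rightarrow> nat + nat \<Rightarrow> 'a::finite_field cofixed" where
  "basis_vec d k = (let q = CARD('a) in case k of
      Inl a \<Rightarrow> (D0 ^ a * D1 ^ ((d - (a + 1) * (q\<^sup>2 - 1)) div (q\<^sup>2 - q))) \<odot> mon q 1
    | Inr i \<Rightarrow> D1 ^ ((d - gen_deg q i) div (q\<^sup>2 - q)) \<odot> N2_gen i)"

lemma finite_index:
  assumes "1 < q"
  shows "finite (top_index q d)" "finite (gen_index q d)"
proof -
  have "1 * 1 < q\<^sup>2" using assms unfolding power2_eq_square by (intro mult_strict_mono) auto
  then have A: "1 \<le> q\<^sup>2 - 1" by simp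
  have "a \<le> d" if "(a + 1) * (q\<^sup>2 - 1) \<le> d" for a
  proof -
    have "(a + 1) * 1 \<le> (a + 1) * (q\<^sup>2 - 1)" using A by (intro mult_le_mono) auto
    then show ?thesis using that by simp
  qed
  then have "top_index q d \<subseteq> {..d}" unfolding top_index_def by (intro subsetI) (simp only: mem_Collect_eq atMost_iff)
  then show "finite (top_index q d)" by (rule finite_subset) simp
  show "finite (gen_index q d)" by (simp add: gen_index_def)
qed

section \<open>Independence and spanning in each degree\<close>

lemma Rep_invar_sum: "Rep_invar (sum f I) = (\<Sum>i\<in>I. Rep_invar (f i))"
  by (induction I rule: infinite_finite_induct) (simp_all add: zero_invar.rep_eq plus_invar.rep_eq)

lemma Rep_invar_power: "Rep_invar (r ^ n) = Rep_invar r ^ n"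
  by (induction n) (simp_all add: one_invar.rep_eq times_invar.rep_eq)

text \<open>Cancel the least power of \<open>dickson_0\<close> with nonzero coefficient and restrict
  to y = 0: only that term survives, as a nonzero multiple of a power of X.\<close>

lemma dickson_independent:
  fixes c :: "nat \<Rightarrow> 'a::finite_field"
  assumes fin: "finite I" and 0: "(\<Sum>a\<in>I. cst (c a) * (dickson_0 ^ a * dickson_1 ^ f a)) = 0" and a: "a \<in> I"
  shows "c a = 0"
proof (rule ccontr)
  assume "c a \<noteq> 0"
  define S where "S = {a \<in> I. c a \<noteq> 0}"
  define a0 where "a0 = Min S"
  have S: "finite S" "S \<noteq> {}" using fin a \<open>c a \<noteq> 0\<close> by (auto simp: S_def)
  have a0: "a0 \<in> S" "\<And>a. a \<in> S \<Longrightarrow> a0 \<le> a" using S by (simp_all add: a0_def)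
  have "(\<Sum>a\<in>I. cst (c a) * (dickson_0 ^ a * dickson_1 ^ f a)) =
      (\<Sum>a\<in>S. cst (c a) * (dickson_0 ^ a * dickson_1 ^ f a))"
    using fin by (intro sum.mono_neutral_right) (auto simp: S_def cst_simps)
  also have "\<dots> = (\<Sum>a\<in>S. dickson_0 ^ a0 * (cst (c a) * (dickson_0 ^ (a - a0) * dickson_1 ^ f a)))"
  proof (rule sum.cong)
    fix a assume "a \<in> S"
    then have "dickson_0 ^ a = dickson_0 ^ a0 * (dickson_0 ^ (a - a0) :: 'a bipoly)"
      using a0 by (simp flip: power_add)
    then show "cst (c a) * (dickson_0 ^ a * dickson_1 ^ f a) = dickson_0 ^ a0 * (cst (c a) * (dickson_0 ^ (a - a0) * dickson_1 ^ f a))"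
      by (simp add: mult_ac)
  qed simp
  finally have "dickson_0 ^ a0 * (\<Sum>a\<in>S. cst (c a) * (dickson_0 ^ (a - a0) * dickson_1 ^ f a)) = 0"
    using 0 by (simp add: sum_distrib_left)
  moreover have "dickson_0 \<noteq> (0 :: 'a bipoly)"
    using dickson_L_neq_0[where ?'a = 'a] by (simp add: dickson_0_eq)
  ultimately have "(\<Sum>a\<in>S. cst (c a) * (dickson_0 ^ (a - a0) * dickson_1 ^ f a)) = 0" by simp
  then have "restr (\<Sum>a\<in>S. cst (c a) * (dickson_0 ^ (a - a0) * dickson_1 ^ f a)) = 0"
    by (simp add: restr_def act_0)
  then have "(\<Sum>a\<in>S. cst (c a) * (restr dickson_0 ^ (a - a0) * restr dickson_1 ^ f a)) = 0"
    by (simp add: restr_def act_sum act_mult act_power act_cst)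
  moreover have "(\<Sum>a\<in>S. cst (c a) * (restr dickson_0 ^ (a - a0) * restr dickson_1 ^ f a)) = 
      cst (c a0) * restr dickson_1 ^ f a0"
  proof -
    have "cst (c a) * (restr dickson_0 ^ (a - a0) * restr dickson_1 ^ f a) = 0" if "a \<in> S - {a0}" for a
    proof -
      have "a - a0 \<noteq> 0" using a0(2)[of a] that by auto
      then show ?thesis by (simp add: restr_dickson power_0_left)
    qed
    then have "(\<Sum>a\<in>S - {a0}. cst (c a) * (restr dickson_0 ^ (a - a0) * restr dickson_1 ^ f a)) = 0"
      by (intro sum.neutral) blast
    then show ?thesis using S a0 by (simp add: sum.remove[of _ a0])
  qed
  ultimately have "cst (c a0) * (big_X ^ CARD('a)) ^ f a0 = (0 :: 'a bipoly)" by (simp add: restr_dickson)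
  then show False using a0(1) by (simp add: S_def big_X_def var_neq_0 cst_def)
qed

text \<open>Collecting terms gives a relation as in \<open>generators_independent\<close>. In a
  fixed degree each torsion generator carries a single power of \<open>D1\<close>, so divisibility
  of its coefficient by \<open>D0\<close> already forces the scalar to be 0.\<close>

lemma basis_vec_independent:
  fixes c :: "nat + nat \<Rightarrow> 'a::finite_field"
  defines "q \<equiv> CARD('a)"
  assumes 0: "(\<Sum>k\<in>top_index q d <+> gen_index q d. invar_cst (c k) \<odot> (basis_vec d k :: 'a cofixed)) = 0"
  shows "\<forall>k\<in>top_index q d <+> gen_index q d. c k = 0"
proof -
  have q: "1 < q" using card_gt_1 by (simp add: q_def)
  define f where "f = (\<lambda>a. (d - (a + 1) * (q\<^sup>2 - 1)) div (q\<^sup>2 - q))"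
  define g where "g = (\<lambda>i. (d - gen_deg q i) div (q\<^sup>2 - q))"
  define r where "r = (\<Sum>a\<in>top_index q d. invar_cst (c (Inl a)) * (D0 ^ a * D1 ^ f a))"
  define s where "s = (\<lambda>i. if i \<in> gen_index q d then invar_cst (c (Inr i)) * D1 ^ g i else 0)"
  note fin = finite_index[OF q]
  have "(\<Sum>k\<in>top_index q d <+> gen_index q d. invar_cst (c k) \<odot> (basis_vec d k :: 'a cofixed)) =
      (\<Sum>a\<in>top_index q d. invar_cst (c (Inl a)) \<odot> (D0 ^ a * D1 ^ f a) \<odot> mon q 1)
      + (\<Sum>i\<in>gen_index q d. invar_cst (c (Inr i)) \<odot> D1 ^ g i \<odot> N2_gen i)"
    unfolding sum.Plus[OF fin] by (simp add: basis_vec_def Let_def f_def g_def comp_def flip: q_def)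
  also have "(\<Sum>a\<in>top_index q d. invar_cst (c (Inl a)) \<odot> (D0 ^ a * D1 ^ f a) \<odot> mon q 1) = r \<odot> (mon q 1 :: 'a cofixed)"
    by (simp add: r_def SG.scale_sum_left)
  also have "(\<Sum>i\<in>gen_index q d. invar_cst (c (Inr i)) \<odot> D1 ^ g i \<odot> N2_gen i) = (\<Sum>i<q - 1. s i \<odot> (N2_gen i :: 'a cofixed))"
    by (rule sum.mono_neutral_cong_left) (auto simp: s_def gen_index_def)
  finally have "r \<odot> mon CARD('a) 1 + (\<Sum>i<CARD('a) - 1. s i \<odot> N2_gen i) = (0 :: 'a cofixed)"
    using 0 by (simp add: q_def)
  note ind = generators_independent[OF this]
  have "(\<Sum>a\<in>top_index q d. cst (c (Inl a)) * (dickson_0 ^ a * dickson_1 ^ f a)) = Rep_invar r"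
    by (simp add: r_def Rep_invar_sum times_invar.rep_eq Rep_invar_power invar_cst.rep_eq D0.rep_eq D1.rep_eq)
  then have "(\<Sum>a\<in>top_index q d. cst (c (Inl a)) * (dickson_0 ^ a * dickson_1 ^ f a)) = 0"
    by (simp add: ind(1) zero_invar.rep_eq)
  then have "c (Inl a) = 0" if "a \<in> top_index q d" for a
    using dickson_independent[OF fin(1), of "\<lambda>a. c (Inl a)"] that by blast
  moreover have "c (Inr i) = 0" if i: "i \<in> gen_index q d" for i
  proof -
    have "D0 dvd s i" using ind(2) i by (simp add: gen_index_def q_def)
    then have "restr (Rep_invar (s i)) = 0" by (rule restr_eq_0_of_D0_dvd)
    then have "cst (c (Inr i)) * (big_X ^ CARD('a)) ^ g i = (0 :: 'a bipoly)"
      using i restr_dickson(2)[where ?'a = 'a]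
      by (simp add: s_def times_invar.rep_eq Rep_invar_power invar_cst.rep_eq D1.rep_eq restr_def act_mult act_cst act_power)
    then show ?thesis by (simp add: big_X_def var_neq_0 cst_def)
  qed
  ultimately show ?thesis by auto
qed

lemma dim_span_family:
  fixes v :: "'i \<Rightarrow> 'a::finite_field cofixed"
  assumes fin: "finite I"
    and ind: "\<And>c. (\<Sum>i\<in>I. invar_cst (c i) \<odot> v i) = 0 \<Longrightarrow> \<forall>i\<in>I. c i = 0"
  shows "cof_vs.dim (cof_vs.span (v ` I)) = card I"
proof -
  have one: "invar_cst 1 = (1 :: 'a invar)" "invar_cst (- 1) = (- 1 :: 'a invar)" "invar_cst 0 = (0 :: 'a invar)"
    by (simp_all add: Rep_invar_inject[symmetric] invar_cst.rep_eq one_invar.rep_eq uminus_invar.rep_eq zero_invar.rep_eq cst_simps)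
  have inj: "inj_on v I"
  proof (rule inj_onI, rule ccontr)
    fix i j assume ij: "i \<in> I" "j \<in> I" "v i = v j" "i \<noteq> j"
    define c :: "'i \<Rightarrow> 'a" where "c = (\<lambda>k. if k = i then 1 else if k = j then - 1 else 0)"
    have "(\<Sum>k\<in>I. invar_cst (c k) \<odot> v k) = (\<Sum>k\<in>{i, j}. invar_cst (c k) \<odot> v k)"
      using fin ij by (intro sum.mono_neutral_right) (auto simp: c_def one)
    also have "\<dots> = 0" using ij by (simp add: c_def one)
    finally have "\<forall>k\<in>I. c k = 0" by (rule ind)
    then show False using ij by (auto simp: c_def)
  qed
  have "\<not> cof_vs.dependent (v ` I)"
  proof
    assume "cof_vs.dependent (v ` I)"
    then obtain u w where u: "w \<in> v ` I" "u w \<noteq> 0" "(\<Sum>w\<in>v ` I. invar_cst (u w) \<odot> w) = 0"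
      using fin cof_vs.dependent_finite[of "v ` I"] by auto
    then have "(\<Sum>i\<in>I. invar_cst (u (v i)) \<odot> v i) = 0" using inj by (simp add: sum.reindex)
    then show False using ind[of "\<lambda>i. u (v i)"] u by auto
  qed
  then show ?thesis using inj by (simp add: cof_vs.dim_eq_card_independent card_image)
qed

lemma scale_mem_span:
  assumes "\<And>x. x \<in> S \<Longrightarrow> r \<odot> x \<in> cof_vs.span T" "v \<in> cof_vs.span S"
  shows "r \<odot> v \<in> cof_vs.span (T :: 'a::finite_field cofixed set)"
  using assms(2)
proof (induction rule: cof_vs.span_induct_alt)
  case base
  show ?case by (simp add: cof_vs.span_zero)
next
  case (step c x y)
  have "r \<odot> (invar_cst c \<odot> x + y) = invar_cst c \<odot> r \<odot> x + r \<odot> y"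
    by (simp add: SG.scale_right_distrib mult.commute)
  moreover have "r \<odot> x \<in> cof_vs.span T" using step assms(1) by blast
  ultimately show ?case
    using step by (simp only:) (intro cof_vs.span_add cof_vs.span_scale)
qed

lemma generator_homogeneous:
  "homogeneous (gen_deg CARD('a) i) (if i = 0 then 1 else big_X ^ i * big_Y :: 'a::finite_field bipoly)"
  "homogeneous ((CARD('a))\<^sup>2 - 1) (big_X ^ CARD('a) * big_Y :: 'a bipoly)"
proof -
  show "homogeneous (gen_deg CARD('a) i) (if i = 0 then 1 else big_X ^ i * big_Y :: 'a bipoly)"
    using homogeneous_big[of i 1, where ?'a = 'a] by (simp add: gen_deg_def homogeneous_1)
  have "(CARD('a))\<^sup>2 - 1 = (CARD('a) + 1) * (CARD('a) - 1)"
    by (simp add: power2_eq_square algebra_simps)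
  then show "homogeneous ((CARD('a))\<^sup>2 - 1) (big_X ^ CARD('a) * big_Y :: 'a bipoly)"
    using homogeneous_big[of "CARD('a)" 1, where ?'a = 'a] by simp
qed

lemma generator_cof_deg:
  "(N2_gen i :: 'a::finite_field cofixed) \<in> cof_deg (gen_deg CARD('a) i)"
  "(mon CARD('a) 1 :: 'a cofixed) \<in> cof_deg ((CARD('a))\<^sup>2 - 1)"
proof -
  have "(N2_gen i :: 'a cofixed) = cof (if i = 0 then 1 else big_X ^ i * big_Y)"
    by (simp add: N2_gen_def)
  then show "(N2_gen i :: 'a cofixed) \<in> cof_deg (gen_deg CARD('a) i)"
    unfolding cof_deg_def using generator_homogeneous(1) by blast
  show "(mon CARD('a) 1 :: 'a cofixed) \<in> cof_deg ((CARD('a))\<^sup>2 - 1)"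
    unfolding cof_deg_def mon_def using generator_homogeneous(2)[where ?'a = 'a] by auto
qed

lemma cof_deg_scale:
  assumes "homogeneous d (Rep_invar r)" "v \<in> cof_deg e"
  shows "r \<odot> v \<in> cof_deg (d + e)"
  using assms unfolding cof_deg_def by (auto simp: scale_cof intro: homogeneous_mult)

lemma cof_deg_subspace: "cof_vs.subspace (cof_deg d :: 'a::finite_field cofixed set)"
proof (rule cof_vs.subspaceI)
  show "0 \<in> (cof_deg d :: 'a cofixed set)"
    unfolding cof_deg_def using homogeneous_0 by (force simp flip: cof_0)
next
  fix x y :: "'a cofixed" assume "x \<in> cof_deg d" "y \<in> cof_deg d"
  then show "x + y \<in> cof_deg d"
    unfolding cof_deg_def using homogeneous_add by (force simp flip: cof_add)
next
  fix c and x :: "'a cofixed" assume "x \<in> cof_deg d"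
  then show "invar_cst c \<odot> x \<in> cof_deg d"
    using cof_deg_scale[of 0 "invar_cst c" x d] homogeneous_monomial[of 0 0 c]
    by (simp add: invar_cst.rep_eq)
qed

lemma basis_vec_cof_deg:
  assumes "k \<in> top_index CARD('a) d <+> gen_index CARD('a) d"
  shows "(basis_vec d k :: 'a::finite_field cofixed) \<in> cof_deg d"
proof -
  define q where "q = CARD('a)"
  have hom: "homogeneous (a * (q\<^sup>2 - 1) + b * (q\<^sup>2 - q)) (Rep_invar (D0 ^ a * D1 ^ b :: 'a invar))" for a b
    unfolding times_invar.rep_eq Rep_invar_power D0.rep_eq D1.rep_eq q_def
    by (intro homogeneous_mult homogeneous_power homogeneous_dickson)
  from assms show ?thesis
  proof (rule PlusE)
    fix a assume a: "a \<in> top_index CARD('a) d" and k: "k = Inl a"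
    define b where "b = (d - (a + 1) * (q\<^sup>2 - 1)) div (q\<^sup>2 - q)"
    have "b * (q\<^sup>2 - q) = d - (a + 1) * (q\<^sup>2 - 1)" "(a + 1) * (q\<^sup>2 - 1) \<le> d"
      using a by (auto simp: b_def top_index_def q_def)
    then have d: "a * (q\<^sup>2 - 1) + b * (q\<^sup>2 - q) + (q\<^sup>2 - 1) = d" by simp
    have "basis_vec d k = (D0 ^ a * D1 ^ b) \<odot> (mon q 1 :: 'a cofixed)"
      by (simp add: basis_vec_def k b_def q_def Let_def)
    then show ?thesis
      using cof_deg_scale[OF hom generator_cof_deg(2)[where ?'a = 'a], of a b] d by (simp add: q_def)
  next
    fix i assume i: "i \<in> gen_index CARD('a) d" and k: "k = Inr i"
    define b where "b = (d - gen_deg q i) div (q\<^sup>2 - q)"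
    have "b * (q\<^sup>2 - q) = d - gen_deg q i" "gen_deg q i \<le> d"
      using i by (auto simp: b_def gen_index_def q_def)
    then have d: "b * (q\<^sup>2 - q) + gen_deg q i = d" by simp
    have "basis_vec d k = D1 ^ b \<odot> (N2_gen i :: 'a cofixed)"
      by (simp add: basis_vec_def k b_def q_def Let_def)
    then show ?thesis
      using cof_deg_scale[OF hom generator_cof_deg(1)[of i, where ?'a = 'a], of 0 b] d by (simp add: q_def)
  qed
qed

text \<open>The candidate spans are closed under both Dickson invariants: \<open>D0\<close> raises a
  by one or kills the vector, and \<open>D1\<close> keeps the index and raises only its own
  exponent. Hence \<open>mon_mem\<close> applies.\<close>

lemma cof_deg_eq_span:
  "(cof_deg d :: 'a::finite_field cofixed set) =
    cof_vs.span (basis_vec d ` (top_index CARD('a) d <+> gen_index CARD('a) d))"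
proof
  define q where "q = CARD('a)"
  define m where "m = q - 1"
  define A where "A = q\<^sup>2 - 1"
  define B where "B = q\<^sup>2 - q"
  have q: "q = Suc m" and m: "0 < m" using card_gt_1[where ?'a = 'a] by (simp_all add: q_def m_def)
  have A: "A = m * (q + 1)" and B: "B = m * q" by (simp_all add: A_def B_def q power2_eq_square)
  have B0: "0 < B" using m by (simp add: B q)
  define I where "I = (\<lambda>d. top_index q d <+> gen_index q d)"
  define V where "V = (\<lambda>d. cof_vs.span (basis_vec d ` I d :: 'a cofixed set))"
  have b1: "basis_vec d (Inl a) = (D0 ^ a * D1 ^ ((d - (a + 1) * A) div B)) \<odot> (mon q 1 :: 'a cofixed)"
    and b2: "basis_vec d (Inr i) = D1 ^ ((d - gen_deg q i) div B) \<odot> (N2_gen i :: 'a cofixed)" for d a i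
    by (simp_all add: basis_vec_def Let_def q_def A_def B_def)
  have m1: "Inl a \<in> I d \<longleftrightarrow> (a + 1) * A \<le> d \<and> B dvd d - (a + 1) * A"
    and m2: "Inr i \<in> I d \<longleftrightarrow> i < q - 1 \<and> gen_deg q i \<le> d \<and> B dvd d - gen_deg q i" for d a i
    by (auto simp: I_def top_index_def gen_index_def A_def B_def)
  have base: "basis_vec d k \<in> V d" if "k \<in> I d" for d k
    using that by (auto simp: V_def intro: cof_vs.span_base)
  have V0: "0 \<in> V d" for d by (simp add: V_def cof_vs.span_zero)
  have D0V: "D0 \<odot> v \<in> V (d + A)" if "v \<in> V d" for v d
    using that unfolding V_def
  proof (rule scale_mem_span[rotated])
    fix x :: "'a cofixed" assume "x \<in> basis_vec d ` I d"
    then obtain k where k: "k \<in> I d" and x: "x = basis_vec d k" by blast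
    show "D0 \<odot> x \<in> cof_vs.span (basis_vec (d + A) ` I (d + A))"
    proof (cases k)
      case (Inl a)
      have e: "d + A - (Suc a + 1) * A = d - (a + 1) * A" by simp
      have "D0 \<odot> x = basis_vec (d + A) (Inl (Suc a))"
        unfolding x Inl b1 e by (simp add: mult_ac)
      moreover have "Inl (Suc a) \<in> I (d + A)"
        using k unfolding Inl m1 e by auto
      ultimately show ?thesis using base unfolding V_def by simp
    next
      case (Inr i)
      then have "D0 \<odot> (N2_gen i :: 'a cofixed) = 0"
        using k D0_N2_gen by (auto simp: I_def gen_index_def q_def)
      then have "D0 \<odot> x = 0"
        unfolding x Inr b2 by (metis SG.scale_scale SG.scale_zero_right mult.commute)
      then show ?thesis by (simp add: cof_vs.span_zero)
    qed
  qed
  have D1V: "D1 \<odot> v \<in> V (d + B)" if "v \<in> V d" for v d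
    using that unfolding V_def
  proof (rule scale_mem_span[rotated])
    fix x :: "'a cofixed" assume "x \<in> basis_vec d ` I d"
    then obtain k where k: "k \<in> I d" and x: "x = basis_vec d k" by blast
    have dv: "(d + B - n) div B = Suc ((d - n) div B)" "B dvd d + B - n" "n \<le> d + B" 
      if "n \<le> d" "B dvd d - n" for n
      using that B0 by (simp_all add: add.commute flip: Nat.add_diff_assoc)
    have "k \<in> I (d + B) \<and> D1 \<odot> x = basis_vec (d + B) k"
    proof (cases k)
      case (Inl a)
      have n: "(a + 1) * A \<le> d" "B dvd d - (a + 1) * A"
        using k unfolding Inl m1 by auto
      show ?thesis
        using dv[OF n] unfolding x Inl b1 m1 by (simp add: mult_ac)
    next
      case (Inr i)
      have n: "gen_deg q i \<le> d" "B dvd d - gen_deg q i" "i < q - 1"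
        using k unfolding Inr m2 by auto
      show ?thesis
        using dv[OF n(1,2)] n(3) unfolding x Inr b2 m2 by simp
    qed
    then show "D1 \<odot> x \<in> cof_vs.span (basis_vec (d + B) ` I (d + B))"
      using base unfolding V_def by simp
  qed
  \<comment> \<open>The index n counts the degree in X and Y; the factor m = q - 1 converts it to
    the degree in x and y.\<close>
  define W where "W = (\<lambda>n. V (m * n))"
  have sub: "cof_vs.subspace (W n)" for n by (simp add: W_def V_def cof_vs.subspace_span)
  have gen: "N2_gen i \<in> V (gen_deg q i)" if "i < q - 1" for i
    using base[of "Inr i" "gen_deg q i"] that by (simp add: b2 m2)
  have mon: "mon i j \<in> W (i + j)" for i j
  proof (rule mon_mem[OF sub])
    show "D0 \<odot> v \<in> W (n + CARD('a) + 1)" if "v \<in> W n" for n v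
      using D0V[of v "m * n"] that by (simp add: W_def A q_def algebra_simps)
    show "D1 \<odot> v \<in> W (n + CARD('a))" if "v \<in> W n" for n v
      using D1V[of v "m * n"] that by (simp add: W_def B q_def algebra_simps)
    show "mon CARD('a) 1 \<in> W (CARD('a) + 1)"
      using base[of "Inl 0" A] by (simp add: b1 m1 W_def q_def A)
    show "mon 0 0 \<in> W 0"
      using gen[of 0] m by (simp add: W_def gen_deg_def N2_gen_mon m_def)
    show "mon i 1 \<in> W (i + 1)" if "0 < i" "i < CARD('a) - 1" for i
      using gen[of i] that by (simp add: W_def gen_deg_def N2_gen_mon q_def m_def mult.commute)
  qed
  show "(cof_deg d :: 'a cofixed set) \<subseteq> cof_vs.span (basis_vec d ` (top_index CARD('a) d <+> gen_index CARD('a) d))"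
  proof
    fix v :: "'a cofixed" assume "v \<in> cof_deg d"
    then obtain f where f: "v = cof f" "homogeneous d f" by (auto simp: cof_deg_def)
    have "v \<in> (if m dvd d then W (d div m) else {0})"
      using cof_homogeneous_mem[of W, OF sub mon f(2)] unfolding m_def q_def f(1) .
    then have "v \<in> V d" using V0 by (auto simp: W_def split: if_splits)
    then show "v \<in> cof_vs.span (basis_vec d ` (top_index CARD('a) d <+> gen_index CARD('a) d))"
      by (simp add: V_def I_def q_def)
  qed
  show "cof_vs.span (basis_vec d ` (top_index CARD('a) d <+> gen_index CARD('a) d)) \<subseteq> (cof_deg d :: 'a cofixed set)"
    by (rule cof_vs.span_minimal) (auto intro: basis_vec_cof_deg cof_deg_subspace)
qed

lemma dim_cof_deg:
  "cof_vs.dim (cof_deg d :: 'a::finite_field cofixed set) = card (top_index CARD('a) d) + card (gen_index CARD('a) d)"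
proof -
  have fin: "finite (top_index CARD('a) d)" "finite (gen_index CARD('a) d)"
    by (intro finite_index card_gt_1)+
  then have "cof_vs.dim (cof_deg d :: 'a cofixed set) = card (top_index CARD('a) d <+> gen_index CARD('a) d)"
    unfolding cof_deg_eq_span by (intro dim_span_family basis_vec_independent) auto
  then show ?thesis using fin by (simp add: card_Plus)
qed

section \<open>Generating functions\<close>

text \<open>The expansion of 1/(1 - t^k) for k > 0, given by coefficients so that products count
  index sets.\<close>

definition geometric :: "nat \<Rightarrow> rat fps" where
  "geometric k = Abs_fps (\<lambda>n. if k dvd n then 1 else 0)"

lemma geometric_mult: "0 < k \<Longrightarrow> (1 - fps_X ^ k) * geometric k = 1"
proof (rule fps_ext)
  fix n assume k: "0 < k"
  have "fps_nth ((1 - fps_X ^ k) * geometric k) n = fps_nth (geometric k) n - fps_nth (fps_X ^ k * geometric k) n"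
    by (simp add: left_diff_distrib)
  also have "\<dots> = (if n = 0 then 1 else 0)"
    unfolding fps_X_power_mult_nth
    using k by (auto simp: geometric_def dvd_minus_self dest: dvd_imp_le)
  also have "\<dots> = fps_nth (1 :: rat fps) n" by simp
  finally show "fps_nth ((1 - fps_X ^ k) * geometric k) n = fps_nth (1 :: rat fps) n" .
qed

lemma fps_divide_geometric: "0 < k \<Longrightarrow> (f :: rat fps) / (1 - fps_X ^ k) = f * geometric k"
  using fps_inverse_unique[OF geometric_mult] by (simp add: fps_divide_unit)

lemma fps_divide_geometric2:
  assumes "0 < k" "0 < l"
  shows "(f :: rat fps) / ((1 - fps_X ^ k) * (1 - fps_X ^ l)) = f * (geometric k * geometric l)"
proof -
  have "(1 - fps_X ^ k) * (1 - fps_X ^ l) * (geometric k * geometric l) =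
      ((1 - fps_X ^ k) * geometric k) * ((1 - fps_X ^ l) * geometric l)"
    by (simp only: mult_ac)
  also have "\<dots> = 1" using assms by (simp add: geometric_mult)
  finally show ?thesis
    using assms by (subst fps_divide_unit) (simp_all add: fps_inverse_unique)
qed

lemma geometric_mult_nth:
  assumes "0 < k"
  shows "fps_nth (geometric k * geometric l) n = of_nat (card {a. a * k \<le> n \<and> l dvd n - a * k})"
proof -
  have "fps_nth (geometric k * geometric l) n = (\<Sum>i = 0..n. if k dvd i \<and> l dvd n - i then 1 else 0)"
    unfolding fps_mult_nth geometric_def by (intro sum.cong) auto
  also have "\<dots> = of_nat (card {i \<in> {0..n}. k dvd i \<and> l dvd n - i})"
    by (subst sum.inter_filter[symmetric]) simp_all
  also have "card {i \<in> {0..n}. k dvd i \<and> l dvd n - i} = card {a. a * k \<le> n \<and> l dvd n - a * k}"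
    by (rule bij_betw_same_card[of "\<lambda>i. i div k"], rule bij_betw_byWitness[of _ "\<lambda>a. a * k"]) (use assms in auto)
  finally show ?thesis .
qed

lemma sum_gen_deg:
  assumes "1 < q"
  shows "(\<Sum>i<q - 1. f (gen_deg q i)) = f 0 + (\<Sum>j = 2..q - 1. f (j * (q - 1)) :: rat fps)"
proof -
  have "{..<q - 1} = insert 0 {1..<q - 1}" using assms by auto
  then have "(\<Sum>i<q - 1. f (gen_deg q i)) = f 0 + (\<Sum>i\<in>{1..<q - 1}. f (gen_deg q i))"
    by (simp add: gen_deg_def)
  also have "(\<Sum>i\<in>{1..<q - 1}. f (gen_deg q i)) = (\<Sum>j = 2..q - 1. f (j * (q - 1)))"
    by (rule sum.reindex_bij_witness[of _ "\<lambda>j. j - 1" Suc]) (auto simp: gen_deg_def)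
  finally show ?thesis .
qed

lemma Hilb_eq:
  defines "q \<equiv> CARD('a::finite_field)"
  shows "Hilb (cof_deg :: nat \<Rightarrow> 'a cofixed set) =
    fps_X ^ (q\<^sup>2 - 1) * (geometric (q\<^sup>2 - 1) * geometric (q\<^sup>2 - q))
    + (1 + (\<Sum>j = 2..q - 1. fps_X ^ (j * (q - 1)))) * geometric (q\<^sup>2 - q)"
proof (rule fps_ext)
  fix d
  have q: "1 < q" unfolding q_def by (rule card_gt_1)
  define A where "A = q\<^sup>2 - 1"
  define B where "B = q\<^sup>2 - q"
  have "1 * 1 < q\<^sup>2" using q unfolding power2_eq_square by (intro mult_strict_mono) auto
  then have A: "0 < A" by (simp add: A_def)
  have top: "fps_nth (fps_X ^ A * (geometric A * geometric B)) d = of_nat (card (top_index q d))"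
  proof (cases "d < A")
    case True
    have "A \<le> (a + 1) * A" for a by simp
    then have "top_index q d = {}"
      using True unfolding top_index_def A_def[symmetric] by (auto simp: not_le dest: order_trans)
    then show ?thesis using True by (simp only: fps_X_power_mult_nth) simp
  next
    case False
    then have "{a. a * A \<le> d - A \<and> B dvd d - A - a * A} = top_index q d"
      unfolding top_index_def A_def[symmetric] B_def[symmetric] by auto
    then show ?thesis
      using False A by (simp only: fps_X_power_mult_nth geometric_mult_nth) simp
  qed
  have gen: "fps_nth ((\<Sum>i<q - 1. fps_X ^ gen_deg q i) * geometric B) d = of_nat (card (gen_index q d))"
  proof -
    have "fps_nth ((\<Sum>i<q - 1. fps_X ^ gen_deg q i) * geometric B) d =
        (\<Sum>i<q - 1. fps_nth (fps_X ^ gen_deg q i * geometric B) d)"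
      by (simp add: sum_distrib_right fps_sum_nth)
    also have "\<dots> = (\<Sum>i<q - 1. if gen_deg q i \<le> d \<and> B dvd d - gen_deg q i then 1 else 0)"
      unfolding fps_X_power_mult_nth by (intro sum.cong) (auto simp: geometric_def)
    also have "\<dots> = of_nat (card {i \<in> {..<q - 1}. gen_deg q i \<le> d \<and> B dvd d - gen_deg q i})"
      by (subst sum.inter_filter[symmetric]) simp_all
    finally show ?thesis by (simp add: gen_index_def B_def)
  qed
  have s: "(\<Sum>i<q - 1. fps_X ^ gen_deg q i) = (1 + (\<Sum>j = 2..q - 1. fps_X ^ (j * (q - 1))) :: rat fps)"
    using sum_gen_deg[OF q, of "\<lambda>n. fps_X ^ n"] by simp
  show "fps_nth (Hilb (cof_deg :: nat \<Rightarrow> 'a cofixed set)) d = fps_nth (fps_X ^ (q\<^sup>2 - 1) * (geometric (q\<^sup>2 - 1) * geometric (q\<^sup>2 - q))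
    + (1 + (\<Sum>j = 2..q - 1. fps_X ^ (j * (q - 1)))) * geometric (q\<^sup>2 - q)) d"
    unfolding s[symmetric] fps_add_nth using top gen
    by (simp add: Hilb_def dim_cof_deg A_def B_def flip: q_def)
qed

text \<open>Put s = t^(q-1). The identity (1 - s^(q+1)) a = 1 splits s^(q+1) b off the first
  summand; the rest follows from (s^(q+1) + 1 + P)(1 - s) = (1 - s^q)(1 - s + s^2).\<close>

lemma hilbert_series_eq:
  assumes "1 < q"
  shows "fps_X ^ (q\<^sup>2 - 1) * (geometric (q\<^sup>2 - 1) * geometric (q\<^sup>2 - q))
    + (1 + (\<Sum>j = 2..q - 1. fps_X ^ (j * (q - 1)))) * geometric (q\<^sup>2 - q) =
    1 + fps_X ^ (2 * (q - 1)) * geometric (q - 1)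
    + fps_X ^ (2 * (q\<^sup>2 - 1)) * (geometric (q\<^sup>2 - 1) * geometric (q\<^sup>2 - q))"
proof -
  define m where "m = q - 1"
  have q: "q = Suc m" and m: "0 < m" using assms by (simp_all add: m_def)
  define s :: "rat fps" where "s = fps_X ^ m"
  have A: "fps_X ^ (q\<^sup>2 - 1) = s ^ (q + 1)" and B: "fps_X ^ (q\<^sup>2 - q) = s ^ q"
  proof -
    have "q\<^sup>2 - 1 = m * (q + 1)" "q\<^sup>2 - q = m * q" by (simp_all add: q power2_eq_square)
    then show "fps_X ^ (q\<^sup>2 - 1) = s ^ (q + 1)" "fps_X ^ (q\<^sup>2 - q) = s ^ q"
      by (simp_all only: s_def power_mult)
  qed
  have A2: "fps_X ^ (2 * (q\<^sup>2 - 1)) = s ^ (q + 1) * s ^ (q + 1)"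
    unfolding A[symmetric] by (simp add: mult_2 power_add)
  define a where "a = geometric (q\<^sup>2 - 1)"
  define b where "b = geometric (q\<^sup>2 - q)"
  define c where "c = geometric m"
  have a: "(1 - s ^ (q + 1)) * a = 1" and b: "(1 - s ^ q) * b = 1" and c: "(1 - s) * c = 1"
  proof -
    have "0 < q\<^sup>2 - 1" "0 < q\<^sup>2 - q" using m by (simp_all add: q power2_eq_square)
    then show "(1 - s ^ (q + 1)) * a = 1" "(1 - s ^ q) * b = 1"
      unfolding A[symmetric] B[symmetric] a_def b_def by (simp_all only: geometric_mult)
    show "(1 - s) * c = 1" unfolding c_def s_def using m by (rule geometric_mult)
  qed
  define P where "P = (\<Sum>j = 2..q - 1. fps_X ^ (j * (q - 1)) :: rat fps)"
  have P: "P * (1 - s) = s ^ 2 - s ^ q"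
  proof -
    have "P = (\<Sum>j = 2..m. s ^ j)"
      by (simp add: P_def s_def q mult.commute flip: power_mult)
    moreover have "(\<Sum>j = 2..Suc n. s ^ j) * (1 - s) = s ^ 2 - s ^ Suc (Suc n)" for n
    proof (induction n)
      case (Suc n)
      have "(\<Sum>j = 2..Suc (Suc n). s ^ j) = (\<Sum>j = 2..Suc n. s ^ j) + s ^ Suc (Suc n)"
        by (subst sum.cl_ivl_Suc) simp
      then have "(\<Sum>j = 2..Suc (Suc n). s ^ j) * (1 - s) = s ^ 2 - s ^ Suc (Suc n) + s ^ Suc (Suc n) * (1 - s)"
        by (simp only: distrib_right Suc.IH)
      also have "\<dots> = s ^ 2 - s ^ Suc (Suc (Suc n))" by (simp add: algebra_simps)
      finally show ?case .
    qed (simp add: power2_eq_square)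
    ultimately show ?thesis using m q by (metis Suc_pred)
  qed
  have "(s ^ (q + 1) * (a * b) + (1 + P) * b) = 1 + s ^ 2 * c + s ^ (q + 1) * s ^ (q + 1) * (a * b)"
  proof -
    have "s ^ (q + 1) * (a * b) - s ^ (q + 1) * s ^ (q + 1) * (a * b) = s ^ (q + 1) * b * ((1 - s ^ (q + 1)) * a)"
      by (simp add: algebra_simps)
    also have "\<dots> = s ^ (q + 1) * b" by (simp only: a mult_1_right)
    finally have 1: "s ^ (q + 1) * (a * b) = s ^ (q + 1) * b + s ^ (q + 1) * s ^ (q + 1) * (a * b)"
      by (simp add: algebra_simps)
    have "(s ^ (q + 1) + 1 + P) * ((1 - s) * c) = (1 - s ^ q) + (1 - s ^ q) * s ^ 2 * c"
    proof -
      have "(s ^ (q + 1) + 1 + P) * (1 - s) = (1 - s ^ q) * (1 - s) + (1 - s ^ q) * s ^ 2"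
        using P by (simp add: algebra_simps power2_eq_square)
      then have "(s ^ (q + 1) + 1 + P) * ((1 - s) * c) = ((1 - s ^ q) * (1 - s) + (1 - s ^ q) * s ^ 2) * c"
        by (simp only: mult.assoc[symmetric])
      also have "\<dots> = (1 - s ^ q) * ((1 - s) * c) + (1 - s ^ q) * s ^ 2 * c" by (simp only: distrib_right mult.assoc)
      finally show ?thesis by (simp only: c mult_1_right)
    qed
    then have "(s ^ (q + 1) + 1 + P) * b = ((1 - s ^ q) * b) * (1 + s ^ 2 * c)"
      by (simp only: c mult_1_right) (simp add: algebra_simps)
    then have "(s ^ (q + 1) + 1 + P) * b = 1 + s ^ 2 * c" by (simp only: b mult_1)
    then show ?thesis using 1 by (simp add: algebra_simps)
  qed
  moreover have "fps_X ^ (2 * (q - 1)) = s ^ 2" by (simp add: s_def m_def mult.commute flip: power_mult)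
  ultimately show ?thesis unfolding A A2 P_def[symmetric] a_def[symmetric] b_def[symmetric] by (simp add: c_def m_def)
qed

section \<open>The decomposition, the minimal generators and the two forms of the series\<close>

theorem theoremB15:
  fixes q :: nat and N1 N2 :: "'a::finite_field cofixed set"
  assumes q: "q = CARD('a)"
    and N1: "N1 = range (\<lambda>r. r \<odot> cof (big_X ^ q * big_Y))"
    and N2: "N2 = SG.span (N2_gen ` {..<q - 1})"
  shows
    "(SG.subspace N1 \<and> SG.subspace N2 \<and> N1 \<inter> N2 = {0} \<and> {u + v | u v. u \<in> N1 \<and> v \<in> N2} = UNIV)
   \<and> (SG.independent {cof (big_X ^ q * big_Y) :: 'a cofixed} \<and> SG.span {cof (big_X ^ q * big_Y)} = N1)
   \<and> dquot_basis (q - 1) N2_gen N2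
   \<and> (\<exists>M1 M2 :: 'a cofixed set.
        M1 \<inter> M2 = {}
      \<and> (\<forall>m \<in> M1 \<union> M2. \<exists>d. m \<in> cof_deg d)
      \<and> SG.span (M1 \<union> M2) = UNIV
      \<and> (\<forall>M'. M' \<subset> M1 \<union> M2 \<longrightarrow> SG.span M' \<noteq> UNIV)
      \<and> free_over (adjoin {D1}) (span_over (adjoin {D1}) M1)
      \<and> free_over (adjoin {D0, D1}) (span_over (adjoin {D0, D1}) M2)
      \<and> (\<forall>m \<in> M1. D0 \<odot> m = 0)
      \<and> (\<exists>m. M2 = {m} \<and> m \<in> cof_deg (q\<^sup>2 - 1)))
   \<and> Hilb (cof_deg :: nat \<Rightarrow> 'a cofixed set)
       = fps_X ^ (q\<^sup>2 - 1) / ((1 - fps_X ^ (q\<^sup>2 - 1)) * (1 - fps_X ^ (q\<^sup>2 - q)))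
         + (1 + (\<Sum>j = 2..q - 1. fps_X ^ (j * (q - 1)))) / (1 - fps_X ^ (q\<^sup>2 - q))
   \<and> Hilb (cof_deg :: nat \<Rightarrow> 'a cofixed set)
       = 1 + fps_X ^ (2 * (q - 1)) / (1 - fps_X ^ (q - 1))
         + fps_X ^ (2 * (q\<^sup>2 - 1)) / ((1 - fps_X ^ (q\<^sup>2 - 1)) * (1 - fps_X ^ (q\<^sup>2 - q)))"
proof (intro conjI)
  let ?t = "mon q 1 :: 'a cofixed"
  let ?e = "N2_gen :: nat \<Rightarrow> 'a cofixed"
  define M1 where "M1 = ?e ` {..<q - 1}"
  have q1: "1 < q" unfolding q by (rule card_gt_1)
  then have q2: "0 < q\<^sup>2 - 1" "0 < q\<^sup>2 - q" "0 < q - 1"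
    by (simp_all add: power2_eq_square one_less_mult)
  have t: "cof (big_X ^ q * big_Y) = ?t" by (simp add: mon_def)
  note ind = generators_independent[where ?'a = 'a, folded q]
  have one: "(1 :: 'a invar) \<noteq> 0" using D0_not_dvd_1[where ?'a = 'a] by auto
  have N1': "N1 = SG.span {?t}" unfolding N1 t by (auto simp: SG.span_singleton)
  have N2': "N2 = SG.span M1" by (simp add: N2 M1_def)
  have span: "SG.span (insert ?t M1) = UNIV"
    unfolding M1_def q by (rule span_UNIV)
  have not_top: "?t \<notin> SG.span M1"
  proof
    assume "?t \<in> SG.span M1"
    then obtain s where "?t = (\<Sum>i<q - 1. s i \<odot> ?e i)" unfolding M1_def using span_image_sum by blast
    then have "1 \<odot> ?t + (\<Sum>i<q - 1. (- s i) \<odot> ?e i) = 0" by (simp add: sum_negf)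
    then have "(1 :: 'a invar) = 0" by (rule ind(1))
    then show False using one by blast
  qed
  have not_gen: "?e j \<notin> SG.span (insert ?t (?e ` ({..<q - 1} - {j})))" if j: "j < q - 1" for j
  proof
    assume "?e j \<in> SG.span (insert ?t (?e ` ({..<q - 1} - {j})))"
    then obtain r where "?e j - r \<odot> ?t \<in> SG.span (?e ` ({..<q - 1} - {j}))"
      by (auto simp: SG.span_insert)
    then obtain s where s: "?e j - r \<odot> ?t = (\<Sum>i\<in>{..<q - 1} - {j}. s i \<odot> ?e i)"
      using span_image_sum by (metis finite_Diff finite_lessThan)
    \<comment> \<open>Moving \<open>?e j\<close> to the other side gives it the coefficient -1,
      which \<open>D0\<close> does not divide.\<close>
    define s' where "s' = s(j := - 1)"
    have "(\<Sum>i<q - 1. s' i \<odot> ?e i) = - ?e j + (\<Sum>i\<in>{..<q - 1} - {j}. s i \<odot> ?e i)"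
      using j by (subst sum.remove[of _ j]) (auto simp: s'_def intro!: sum.cong)
    then have "r \<odot> ?t + (\<Sum>i<q - 1. s' i \<odot> ?e i) = 0" unfolding s[symmetric] by simp
    then have "D0 dvd s' j" using ind(2) j by blast
    then show False using D0_not_dvd_1[where ?'a = 'a] by (simp add: s'_def)
  qed
  \<comment> \<open>Distinctness turns sums over the set \<open>M1\<close> into sums over indices,
    the form in which independence is available.\<close>
  have inj: "inj_on ?e {..<q - 1}"
  proof (rule inj_onI, rule ccontr)
    fix i j assume ij: "i \<in> {..<q - 1}" "j \<in> {..<q - 1}" "?e i = ?e j" "i \<noteq> j"
    have "?e j \<in> SG.span (insert ?t (?e ` ({..<q - 1} - {j})))"
      by (intro SG.span_base insertI2 image_eqI[of _ _ i]) (use ij in auto)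
    then show False using not_gen[of j] ij by simp
  qed
  have top0: "r = 0" if "r \<odot> ?t = 0" for r using gl_trace_mon_eq_0[where ?'a = 'a, folded q] that by blast
  have indep_top: "independent_over R {?t}" for R
    unfolding independent_over_def using top0 by (auto dest!: subset_singletonD)
  show "SG.subspace N1" "SG.subspace N2" by (simp_all add: N1' N2' SG.subspace_span)
  show "N1 \<inter> N2 = {0}"
  proof
    show "N1 \<inter> N2 \<subseteq> {0}"
    proof
      fix v assume "v \<in> N1 \<inter> N2"
      then obtain r s where r: "v = r \<odot> ?t" and "v = (\<Sum>i<q - 1. s i \<odot> ?e i)"
        using span_image_sum[of "{..<q - 1}" v ?e] by (auto simp: N1 t N2)
      then have "r \<odot> ?t + (\<Sum>i<q - 1. (- s i) \<odot> ?e i) = 0" by (simp add: sum_negf)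
      then have "r = 0" by (rule ind(1))
      then show "v \<in> {0}" by (simp add: r)
    qed
  qed (simp add: N1' N2' SG.span_zero)
  show "{u + v |u v. u \<in> N1 \<and> v \<in> N2} = UNIV"
  proof -
    have "w \<in> {u + v |u v. u \<in> N1 \<and> v \<in> N2}" for w
    proof -
      have "w \<in> SG.span (insert ?t M1)" unfolding span by (rule UNIV_I)
      then obtain r where "w - r \<odot> ?t \<in> N2" by (auto simp: SG.span_insert N2')
      moreover have "w = r \<odot> ?t + (w - r \<odot> ?t)" by simp
      moreover have "r \<odot> ?t \<in> N1" by (auto simp: N1 t)
      ultimately show ?thesis by blast
    qed
    then show ?thesis by blast
  qed
  show "SG.independent {cof (big_X ^ q * big_Y) :: 'a cofixed}"
    unfolding t using indep_top[of UNIV] by (simp add: independent_over_UNIV)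
  show "SG.span {cof (big_X ^ q * big_Y)} = N1" by (simp add: N1' t)
  show "dquot_basis (q - 1) N2_gen N2"
    unfolding N2
  proof (rule dquot_basisI)
    show "D0 \<odot> ?e i = 0" if "i < q - 1" for i using that D0_N2_gen by (simp add: q)
    show "D0 dvd s i" if "(\<Sum>i<q - 1. s i \<odot> ?e i) = 0" "i < q - 1" for s i
      using ind(2)[of 0 s i] that by simp
  qed
  show "\<exists>M1 M2 :: 'a cofixed set.
        M1 \<inter> M2 = {}
      \<and> (\<forall>m \<in> M1 \<union> M2. \<exists>d. m \<in> cof_deg d)
      \<and> SG.span (M1 \<union> M2) = UNIV
      \<and> (\<forall>M'. M' \<subset> M1 \<union> M2 \<longrightarrow> SG.span M' \<noteq> UNIV)
      \<and> free_over (adjoin {D1}) (span_over (adjoin {D1}) M1)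
      \<and> free_over (adjoin {D0, D1}) (span_over (adjoin {D0, D1}) M2)
      \<and> (\<forall>m \<in> M1. D0 \<odot> m = 0)
      \<and> (\<exists>m. M2 = {m} \<and> m \<in> cof_deg (q\<^sup>2 - 1))"
  proof (rule exI[of _ M1], rule exI[of _ "{?t}"], intro conjI ballI allI impI)
    show "M1 \<inter> {?t} = {}" using not_top by (auto intro: SG.span_base)
    show "\<exists>d. m \<in> cof_deg d" if "m \<in> M1 \<union> {?t}" for m
      using that generator_cof_deg[where ?'a = 'a] by (auto simp: M1_def q)
    show "SG.span (M1 \<union> {?t}) = UNIV" unfolding Un_insert_right Un_empty_right by (rule span)
    show "SG.span M' \<noteq> UNIV" if M': "M' \<subset> M1 \<union> {?t}" for M'
    proof
      assume UN: "SG.span M' = UNIV"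
      from M' obtain x where x: "x \<in> M1 \<union> {?t}" "x \<notin> M'" by blast
      show False
      proof (cases "x = ?t")
        case True
        then have "SG.span M' \<subseteq> SG.span M1" using M' x by (intro SG.span_mono) blast
        then show False using not_top UN by blast
      next
        case False
        then obtain j where j: "j < q - 1" "x = ?e j" using x by (auto simp: M1_def)
        then have "M' \<subseteq> insert ?t (?e ` ({..<q - 1} - {j}))" using M' x by (auto simp: M1_def)
        then have "SG.span M' \<subseteq> SG.span (insert ?t (?e ` ({..<q - 1} - {j})))" by (rule SG.span_mono)
        then show False using not_gen[OF j(1)] UN by blast
      qed
    qed
    show "free_over (adjoin {D1}) (span_over (adjoin {D1}) M1)"
      unfolding free_over_def
    proof (intro exI[of _ M1] conjI refl)
      show "independent_over (adjoin {D1}) M1"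
        unfolding independent_over_def
      proof (intro allI impI ballI)
        fix T and r :: "'a cofixed \<Rightarrow> 'a invar" and b
        assume T: "finite T" "T \<subseteq> M1" and r: "\<forall>b\<in>T. r b \<in> adjoin {D1}"
          and 0: "(\<Sum>b\<in>T. r b \<odot> b) = 0" and b: "b \<in> T"
        \<comment> \<open>Coefficients on T are extended by 0 to all of \<open>M1\<close> and pulled
          back to indices. Independence then yields divisibility by \<open>D0\<close>, which for an
          element of F[D1] means 0.\<close>
        define s where "s = (\<lambda>i. if ?e i \<in> T then r (?e i) else 0)"
        obtain j where j: "j < q - 1" "b = ?e j" using T b by (auto simp: M1_def)
        have "(\<Sum>b\<in>T. r b \<odot> b) = (\<Sum>b\<in>M1. (if b \<in> T then r b else 0) \<odot> b)"
          using T by (intro sum.mono_neutral_cong_left) (auto simp: M1_def)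
        also have "\<dots> = (\<Sum>i<q - 1. s i \<odot> ?e i)"
          unfolding M1_def s_def by (subst sum.reindex[OF inj]) simp
        finally have "0 \<odot> ?t + (\<Sum>i<q - 1. s i \<odot> ?e i) = 0" using 0 by simp
        then have "D0 dvd s j" using j by (intro ind(2))
        then have "D0 dvd r b" using b j by (simp add: s_def)
        then show "r b = 0" using r b by (intro adjoin_D1_restr restr_eq_0_of_D0_dvd) auto
      qed
    qed
    show "free_over (adjoin {D0, D1}) (span_over (adjoin {D0, D1}) {?t})"
      unfolding free_over_def using indep_top by blast
    show "D0 \<odot> m = 0" if "m \<in> M1" for m
      using that D0_N2_gen by (auto simp: M1_def q)
    show "\<exists>m. {?t} = {m} \<and> m \<in> cof_deg (q\<^sup>2 - 1)"
      using generator_cof_deg(2)[where ?'a = 'a] by (simp add: q)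
  qed
  show H1: "Hilb (cof_deg :: nat \<Rightarrow> 'a cofixed set)
       = fps_X ^ (q\<^sup>2 - 1) / ((1 - fps_X ^ (q\<^sup>2 - 1)) * (1 - fps_X ^ (q\<^sup>2 - q)))
         + (1 + (\<Sum>j = 2..q - 1. fps_X ^ (j * (q - 1)))) / (1 - fps_X ^ (q\<^sup>2 - q))"
    using Hilb_eq[where ?'a = 'a, folded q] q2 by (simp only: fps_divide_geometric fps_divide_geometric2)
  show "Hilb (cof_deg :: nat \<Rightarrow> 'a cofixed set)
       = 1 + fps_X ^ (2 * (q - 1)) / (1 - fps_X ^ (q - 1))
         + fps_X ^ (2 * (q\<^sup>2 - 1)) / ((1 - fps_X ^ (q\<^sup>2 - 1)) * (1 - fps_X ^ (q\<^sup>2 - q)))"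
    using Hilb_eq[where ?'a = 'a, folded q] hilbert_series_eq[OF q1] q2
    by (simp only: fps_divide_geometric fps_divide_geometric2)
qed

end
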